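(* Assume the Riemann Hypothesis. Let $a,b,c,k$ be positive integers with $\gcd(a,b,c)=1$ and $a<c<b<2c$. Let $\alpha_k(a;c)<\frac1b$ be a real number such that $\Delta_k(a;c;x)\ll x^{\alpha_k(a;c)+\varepsilon}$ for every $\varepsilon>0$. Then for every $\varepsilon>0$, all $x\ge2$ and all $y$ with $1\le y<x^{1/b}$, $$\Delta_k(a,b;c;x)=\sum_{d\le y}\Delta_k\!\left(a;c;\frac{x}{d^b}\right)-\sum_{m\le x/y^b}u_k(a;c;m)\,\psi\!\left(\Big(\frac xm\Big)^{1/b}\right)+O\!\left(x^{\frac1{2c}+\varepsilon}y^{1-\frac b{2c}}+(xy^{-b})^{\alpha_k(a;c)+\varepsilon}+x^{\frac1a}y^{-1-\frac ba}\right).$$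
   Context: $\psi(t)=\{t\}-\frac12$, where $\{t\}$ is the fractional part of $t$. $\zeta$ is the Riemann zeta-function and $\mu_k$ is defined by $\sum_{n\ge1}\mu_k(n)n^{-s}=\zeta(s)^{-k}$ for $\Re s>1$. Put $u_k(a;c;n)=\sum_{l^ad^c=n}\mu_k(d)$ (sum over positive integers $l,d$), and $$\Delta_k(a;c;x)=\sum_{n\le x}u_k(a;c;n)-\frac{x^{1/a}}{\zeta^k(c/a)}.$$ The arithmetic function $f_k(a,b;c;n)$ is defined by $\sum_{n\ge1} f_k(a,b;c;n)n^{-s}=\zeta(as)\zeta(bs)/\zeta^k(cs)$ for $\Re s>1$, and $\Delta_k(a,b;c;x)$ is defined (for $a\ne b$) by $$\sum_{n\le x}f_k(a,b;c;n)=\frac{\zeta(b/a)}{\zeta^k(c/a)}x^{1/a}+\frac{\zeta(a/b)}{\zeta^k(c/b)}x^{1/b}+\Delta_k(a,b;c;x).$$ Implied constants depend only on $a,b,c,k,\alpha_k(a;c),\varepsilon$. *)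

theory Defs
  imports
    "HOL-Complex_Analysis.Complex_Analysis"
    "HOL-Real_Asymp.Real_Asymp"
    "HOL-Library.Landau_Symbols"
    "HOL-Computational_Algebra.Squarefree"
begin

text \<open>
  The Riemann zeta-function as the analytic continuation of its Dirichlet series (the summand for
  \<open>n = 0\<close> is \<open>0\<close>). The value at the pole \<open>1\<close> is a dummy, fixed only to make the function unique.
\<close>
definition zeta :: "complex \<Rightarrow> complex" where
  "zeta = (THE f. f holomorphic_on - {1}
                \<and> (\<forall>s. Re s > 1 \<longrightarrow> (\<lambda>n. of_nat n powr (- s)) sums f s)
                \<and> f 1 = 0)"

definition riemann_hypothesis :: bool where
  "riemann_hypothesis \<longleftrightarrow> (\<forall>s. zeta s = 0 \<and> 0 < Re s \<and> Re s < 1 \<longrightarrow> Re s = 1 / 2)"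

text \<open>
  The arithmetic function with generating Dirichlet series \<open>F\<close> on \<open>Re s > 1\<close>. Since
  \<open>of_nat 0 powr s = 0\<close> and division by zero yields zero, the summand for \<open>n = 0\<close> vanishes.
\<close>
definition dirichlet_coeffs :: "(complex \<Rightarrow> complex) \<Rightarrow> nat \<Rightarrow> complex" where
  "dirichlet_coeffs F = (THE f. f 0 = 0
                \<and> (\<forall>s. Re s > 1 \<longrightarrow> (\<lambda>n. f n / of_nat n powr s) sums F s))"

definition mu_coeff :: "nat \<Rightarrow> nat \<Rightarrow> complex" where
  "mu_coeff k = dirichlet_coeffs (\<lambda>s. 1 / zeta s ^ k)"

definition u_coeff :: "nat \<Rightarrow> nat \<Rightarrow> nat \<Rightarrow> nat \<Rightarrow> complex" where
  "u_coeff k a c n = (\<Sum>(l, d) | l \<ge> 1 \<and> d \<ge> 1 \<and> l ^ a * d ^ c = n. mu_coeff k d)"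

definition f_coeff :: "nat \<Rightarrow> nat \<Rightarrow> nat \<Rightarrow> nat \<Rightarrow> nat \<Rightarrow> complex" where
  "f_coeff k a b c = dirichlet_coeffs
     (\<lambda>s. zeta (of_nat a * s) * zeta (of_nat b * s) / zeta (of_nat c * s) ^ k)"

definition psi :: "real \<Rightarrow> real" where
  "psi t = frac t - 1 / 2"

definition Delta_u :: "nat \<Rightarrow> nat \<Rightarrow> nat \<Rightarrow> real \<Rightarrow> complex" where
  "Delta_u k a c x = (\<Sum>n | n \<ge> 1 \<and> real n \<le> x. u_coeff k a c n)
     - of_real (x powr (1 / real a)) / zeta (of_nat c / of_nat a) ^ k"

definition Delta_f :: "nat \<Rightarrow> nat \<Rightarrow> nat \<Rightarrow> nat \<Rightarrow> real \<Rightarrow> complex" where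
  "Delta_f k a b c x = (\<Sum>n | n \<ge> 1 \<and> real n \<le> x. f_coeff k a b c n)
     - zeta (of_nat b / of_nat a) / zeta (of_nat c / of_nat a) ^ k * of_real (x powr (1 / real a))
     - zeta (of_nat a / of_nat b) / zeta (of_nat c / of_nat b) ^ k * of_real (x powr (1 / real b))"


section \<open>The definite descriptions are well defined\<close>

text \<open>
  Existence of the continuation: the Taylor expansion of \<open>(n + 1) powr (1 - s)\<close> around \<open>n\<close>, summed
  over \<open>n\<close>, expresses \<open>(s - 1) * zeta s\<close> through the values of \<open>zeta\<close> at \<open>s + 1, \<dots>, s + J\<close> and a
  remainder that converges for \<open>Re s > - J\<close>.
\<close>

definition zeta_rem :: "nat \<Rightarrow> nat \<Rightarrow> complex \<Rightarrow> complex" where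
  "zeta_rem J n s = (of_nat n + 1) powr (1 - s)
     - (\<Sum>j\<le>J. ((1 - s) gchoose j) * of_nat n powr (1 - s - of_nat j))"

lemma summable_Suc_powr:
  assumes "e < - 1"
  shows "summable (\<lambda>n. real (Suc n) powr e)"
  using summable_Suc_iff[of "\<lambda>n. real n powr e"] assms
  by (simp add: summable_real_powr_iff del: of_nat_Suc)

lemma norm_zeta_rem_le:
  assumes "n \<ge> 1" "Re s + real J \<ge> 0"
  shows "norm (zeta_rem J n s) \<le>
           real (Suc J) * norm ((1 - s) gchoose Suc J) * real n powr (- Re s - real J)"
proof -
  define z where "z = 1 - s"
  define F :: "nat \<Rightarrow> complex \<Rightarrow> complex"
    where "F = (\<lambda>i w. fact i * (z gchoose i) * w powr (z - of_nat i))"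
  define S :: "complex set" where "S = of_real ` {real n..real n + 1}"
  have S_conv: "convex S"
    unfolding S_def by (intro convex_linear_image bounded_linear.linear[OF bounded_linear_of_real]) auto
  have nonpos: "w \<notin> \<real>\<^sub>\<le>\<^sub>0" if "w \<in> S" for w
    using that \<open>n \<ge> 1\<close> by (auto simp: S_def complex_nonpos_Reals_iff)
  have step: "fact (Suc i) * (z gchoose Suc i) = fact i * (z gchoose i) * (z - of_nat i)" for i
    by (simp only: gbinomial_mult_fact prod.atLeast0_lessThan_Suc)
  have deriv: "(F i has_field_derivative F (Suc i) w) (at w within S)" if "w \<in> S" for i w
  proof -
    have "(F i has_field_derivative
            fact i * (z gchoose i) * ((z - of_nat i) * w powr (z - of_nat i - 1))) (at w within S)"
      unfolding F_def
      by (intro DERIV_cmult has_field_derivative_at_within[OF has_field_derivative_powr] nonpos that)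
    also have "fact i * (z gchoose i) * ((z - of_nat i) * w powr (z - of_nat i - 1)) = F (Suc i) w"
      unfolding F_def step by (simp add: algebra_simps)
    finally show ?thesis .
  qed
  define B where "B = norm (fact (Suc J) * (z gchoose Suc J)) * real n powr (- Re s - real J)"
  have bound: "norm (F (Suc J) w) \<le> B" if w: "w \<in> S" for w
  proof -
    obtain t where t: "w = of_real t" "t \<ge> real n" using w by (auto simp: S_def)
    have "norm (w powr (z - of_nat (Suc J))) = t powr (- Re s - real J)"
      using t \<open>n \<ge> 1\<close> by (simp add: norm_powr_real_powr z_def algebra_simps)
    also have "\<dots> \<le> real n powr (- Re s - real J)"
      using t assms by (intro powr_mono2') auto
    finally show ?thesis
      unfolding F_def B_def norm_mult by (intro mult_left_mono) auto
  qed
  have mem: "of_nat n \<in> S" "of_nat n + 1 \<in> S"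
    by (auto simp: S_def image_iff intro: bexI[of _ "real n"] bexI[of _ "real n + 1"])
  have "norm (F 0 (of_nat n + 1) - (\<Sum>i\<le>J. F i (of_nat n) * ((of_nat n + 1) - of_nat n) ^ i / fact i))
          \<le> B * norm ((of_nat n + 1 :: complex) - of_nat n) ^ Suc J / fact J"
    by (rule complex_Taylor[OF S_conv deriv bound mem])
  also have "F 0 (of_nat n + 1) - (\<Sum>i\<le>J. F i (of_nat n) * ((of_nat n + 1) - of_nat n) ^ i / fact i)
               = zeta_rem J n s"
    by (simp add: F_def zeta_rem_def z_def)
  also have "B * norm ((of_nat n + 1 :: complex) - of_nat n) ^ Suc J / fact J
               = real (Suc J) * norm ((1 - s) gchoose Suc J) * real n powr (- Re s - real J)"
    by (simp add: B_def z_def norm_mult norm_fact field_simps del: of_nat_Suc)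
  finally show ?thesis .
qed

lemma holomorphic_gbinomial: "(\<lambda>s. (1 - s) gchoose j) holomorphic_on A"
  unfolding gbinomial_prod_rev by (intro holomorphic_intros) auto

lemma zeta_rem_summable:
  assumes "Re s + real J > 1"
  shows "summable (\<lambda>n. zeta_rem J (Suc n) s)"
proof (rule summable_comparison_test')
  show "summable (\<lambda>n. real (Suc J) * norm ((1 - s) gchoose Suc J) * real (Suc n) powr (- Re s - real J))"
    using assms by (intro summable_mult summable_Suc_powr) simp
  show "norm (zeta_rem J (Suc n) s) \<le> real (Suc J) * norm ((1 - s) gchoose Suc J) *
          real (Suc n) powr (- Re s - real J)" if "n \<ge> 0" for n
    using assms by (intro norm_zeta_rem_le) auto
qed

lemma zeta_rem_holomorphic:
  "(\<lambda>s. \<Sum>n. zeta_rem J (Suc n) s) holomorphic_on {s. Re s > 1 - real J}"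
proof (rule holomorphic_uniform_sequence)
  show "open {s. Re s > 1 - real J}" by (rule open_halfspace_Re_gt)
  show "(\<lambda>s. \<Sum>n<N. zeta_rem J (Suc n) s) holomorphic_on {s. Re s > 1 - real J}" for N
    unfolding zeta_rem_def
    by (intro holomorphic_intros holomorphic_gbinomial)
  fix s0 assume s0: "s0 \<in> {s. Re s > 1 - real J}"
  define d where "d = (Re s0 - (1 - real J)) / 2"
  have d: "d > 0" using s0 by (simp add: d_def)
  have ge: "Re s \<ge> 1 - real J + d" if "s \<in> cball s0 d" for s
  proof -
    have "\<bar>Re (s0 - s)\<bar> \<le> d" using that abs_Re_le_cmod[of "s0 - s"] by (simp add: dist_norm)
    hence "Re s \<ge> Re s0 - d" by (simp add: abs_le_iff)
    thus ?thesis unfolding d_def by argo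
  qed
  have "continuous_on (cball s0 d) (\<lambda>s. norm ((1 - s) gchoose Suc J))"
    by (intro continuous_on_norm holomorphic_on_imp_continuous_on holomorphic_gbinomial)
  hence "bounded ((\<lambda>s. norm ((1 - s) gchoose Suc J)) ` cball s0 d)"
    by (intro compact_imp_bounded compact_continuous_image compact_cball)
  then obtain C where "\<forall>s\<in>cball s0 d. norm ((1 - s) gchoose Suc J) \<le> C"
    unfolding bounded_iff by (auto simp del: mem_cball)
  hence C: "norm ((1 - s) gchoose Suc J) \<le> C" if "s \<in> cball s0 d" for s
    using that by blast
  have "uniform_limit (cball s0 d) (\<lambda>N s. \<Sum>n<N. zeta_rem J (Suc n) s)
          (\<lambda>s. \<Sum>n. zeta_rem J (Suc n) s) sequentially"
  proof (rule Weierstrass_m_test)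
    show "summable (\<lambda>n. real (Suc J) * C * real (Suc n) powr (- 1 - d))"
      using d by (intro summable_mult summable_Suc_powr) simp
    fix n s assume s: "s \<in> cball s0 d"
    have "norm (zeta_rem J (Suc n) s) \<le> real (Suc J) * norm ((1 - s) gchoose Suc J) *
            real (Suc n) powr (- Re s - real J)"
      using ge[OF s] d by (intro norm_zeta_rem_le) auto
    also have "\<dots> \<le> real (Suc J) * C * real (Suc n) powr (- 1 - d)"
      using C[OF s] ge[OF s] order.trans[OF norm_ge_zero C[OF s]]
      by (intro mult_mono powr_mono mult_nonneg_nonneg) auto
    finally show "norm (zeta_rem J (Suc n) s) \<le> real (Suc J) * C * real (Suc n) powr (- 1 - d)" .
  qed
  moreover have "cball s0 d \<subseteq> {s. Re s > 1 - real J}" using ge d by force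
  ultimately show "\<exists>d>0. cball s0 d \<subseteq> {s. Re s > 1 - real J} \<and>
      uniform_limit (cball s0 d) (\<lambda>N s. \<Sum>n<N. zeta_rem J (Suc n) s)
          (\<lambda>s. \<Sum>n. zeta_rem J (Suc n) s) sequentially"
    using d by blast
qed

lemma zeta_series_sums:
  assumes "Re s > 1"
  shows "(\<lambda>n. of_nat (Suc n) powr (- s)) sums (\<Sum>n. of_nat (Suc n) powr (- s) :: complex)"
proof -
  have "summable (\<lambda>n. real (Suc n) powr (- Re s))"
    using assms by (intro summable_Suc_powr) simp
  moreover have "norm (of_nat (Suc n) powr (- s) :: complex) = real (Suc n) powr (- Re s)" for n
    using norm_powr_real_powr[of "of_nat (Suc n)" "- s"] by (simp del: of_nat_Suc)
  ultimately have "summable (\<lambda>n. of_nat (Suc n) powr (- s) :: complex)"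
    by (rule_tac summable_norm_cancel) (simp only:)
  thus ?thesis by (rule summable_sums)
qed

lemma zeta_telescope:
  assumes "Re s > 1"
  shows "(\<lambda>n. (of_nat (Suc n) + 1) powr (1 - s) - of_nat (Suc n) powr (1 - s)) sums (- 1 :: complex)"
proof -
  have "(\<lambda>n. real n powr (1 - Re s)) \<longlonglongrightarrow> 0"
    using assms by real_asymp
  hence "(\<lambda>n. real (Suc n) powr (1 - Re s)) \<longlonglongrightarrow> 0"
    by (rule LIMSEQ_Suc)
  moreover have "norm (of_nat (Suc n) powr (1 - s) :: complex) = real (Suc n) powr (1 - Re s)" for n
    using norm_powr_real_powr[of "of_nat (Suc n)" "1 - s"] by (simp del: of_nat_Suc)
  ultimately have "(\<lambda>n. of_nat (Suc n) powr (1 - s) :: complex) \<longlonglongrightarrow> 0"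
    by (rule_tac tendsto_norm_zero_cancel) (simp only:)
  from telescope_sums[OF this]
  have "(\<lambda>n. of_nat (Suc (Suc n)) powr (1 - s) - of_nat (Suc n) powr (1 - s)) sums (0 - of_nat (Suc 0) powr (1 - s) :: complex)" .
  thus ?thesis by (simp add: add_ac)
qed

definition zeta_series :: "complex \<Rightarrow> complex" where
  "zeta_series s = (\<Sum>n. of_nat (Suc n) powr (- s))"

lemma zeta_recurrence:
  assumes "Re s > 1"
  shows "(s - 1) * zeta_series s = 1 + (\<Sum>n. zeta_rem (Suc J) (Suc n) s)
           - (\<Sum>j=1..J. ((1 - s) gchoose j) / of_nat (Suc j) * ((s + of_nat j - 1) * zeta_series (s + of_nat j)))"
proof -
  define T where "T = (\<lambda>j n. ((1 - s) gchoose j) * of_nat (Suc n) powr (1 - s - of_nat j))"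
  have rem: "zeta_rem (Suc J) (Suc n) s = ((of_nat (Suc n) + 1) powr (1 - s) - of_nat (Suc n) powr (1 - s))
      - (\<Sum>j=1..Suc J. T j n)" for n
  proof -
    have "{..Suc J} = insert 0 {1..Suc J}" by auto
    hence "(\<Sum>j\<le>Suc J. T j n) = T 0 n + (\<Sum>j=1..Suc J. T j n)" by simp
    thus ?thesis by (simp add: zeta_rem_def T_def)
  qed
  have T: "(\<lambda>n. T j n) sums (((1 - s) gchoose j) * zeta_series (s + of_nat j - 1))" if "j \<in> {1..Suc J}" for j
  proof -
    have "Re (s + of_nat j - 1) > 1" using that assms by simp
    from sums_mult[OF zeta_series_sums[OF this], of "(1 - s) gchoose j"]
    show ?thesis by (simp add: T_def zeta_series_def algebra_simps)
  qed
  have "(\<lambda>n. zeta_rem (Suc J) (Suc n) s) sums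
          (- 1 - (\<Sum>j=1..Suc J. ((1 - s) gchoose j) * zeta_series (s + of_nat j - 1)))"
    unfolding rem by (intro sums_diff zeta_telescope assms sums_sum T)
  hence "(\<Sum>n. zeta_rem (Suc J) (Suc n) s)
          = - 1 - (\<Sum>j=1..Suc J. ((1 - s) gchoose j) * zeta_series (s + of_nat j - 1))"
    by (rule sums_unique[symmetric])
  also have "(\<Sum>j=1..Suc J. ((1 - s) gchoose j) * zeta_series (s + of_nat j - 1))
      = (\<Sum>j=0..J. ((1 - s) gchoose Suc j) * zeta_series (s + of_nat j))"
    using sum.shift_bounds_cl_Suc_ivl[of "\<lambda>j. ((1 - s) gchoose j) * zeta_series (s + of_nat j - 1)" 0 J]
    by simp
  also have "\<dots> = (1 - s) * zeta_series s + (\<Sum>j=1..J. ((1 - s) gchoose Suc j) * zeta_series (s + of_nat j))"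
    by (subst sum.atLeast_Suc_atMost) (auto simp: gbinomial_prod_rev)
  also have "(\<Sum>j=1..J. ((1 - s) gchoose Suc j) * zeta_series (s + of_nat j))
     = - (\<Sum>j=1..J. ((1 - s) gchoose j) / of_nat (Suc j) * ((s + of_nat j - 1) * zeta_series (s + of_nat j)))"
    unfolding sum_negf [symmetric]
  proof (rule sum.cong)
    fix j
    have ring: "x * (1 - s - of_nat j) / y * z = - (x / y * ((s + of_nat j - 1) * z))" for x y z
      by (simp add: divide_inverse algebra_simps)
    have "((1 - s) gchoose Suc j) * of_nat (Suc j) = ((1 - s) gchoose j) * (1 - s - of_nat j)"
      by (simp add: gbinomial_prod_rev field_simps del: of_nat_Suc)
    hence E: "((1 - s) gchoose Suc j) = ((1 - s) gchoose j) * (1 - s - of_nat j) / of_nat (Suc j)"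
      by (simp add: field_simps del: of_nat_Suc)
    show "((1 - s) gchoose Suc j) * zeta_series (s + of_nat j)
      = - (((1 - s) gchoose j) / of_nat (Suc j) * ((s + of_nat j - 1) * zeta_series (s + of_nat j)))"
      unfolding E by (rule ring)
  qed simp
  finally show ?thesis by (simp add: algebra_simps)
qed

lemma zeta_halfplane:
  "\<exists>H. (J > 0 \<longrightarrow> H holomorphic_on {s. Re s > 1 - real J}) \<and>
       (\<forall>s. Re s > 1 \<longrightarrow> H s = (s - 1) * zeta_series s)"
proof (induction J)
  case 0
  show ?case by auto
next
  case (Suc J)
  then obtain H where H: "J > 0 \<longrightarrow> H holomorphic_on {s. Re s > 1 - real J}"
      "\<And>s. Re s > 1 \<Longrightarrow> H s = (s - 1) * zeta_series s" by blast
  define H' where "H' = (\<lambda>s. 1 + (\<Sum>n. zeta_rem (Suc J) (Suc n) s)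
           - (\<Sum>j=1..J. ((1 - s) gchoose j) / of_nat (Suc j) * H (s + of_nat j)))"
  have "H' holomorphic_on {s. Re s > 1 - real (Suc J)}"
    unfolding H'_def
  proof (intro holomorphic_intros zeta_rem_holomorphic holomorphic_gbinomial)
    fix j assume j: "j \<in> {1..J}"
    have "(H \<circ> (\<lambda>s. s + of_nat j)) holomorphic_on {s. Re s > 1 - real (Suc J)}"
      using H(1) j by (intro holomorphic_on_compose_gen[of _ _ H "{s. Re s > 1 - real J}"] holomorphic_intros) auto
    thus "(\<lambda>s. H (s + of_nat j)) holomorphic_on {s. Re s > 1 - real (Suc J)}" by (simp add: o_def)
  qed (simp only: of_nat_eq_0_iff; simp)
  moreover have "H' s = (s - 1) * zeta_series s" if "Re s > 1" for s
    unfolding zeta_recurrence[OF that, of J] H'_def using that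
    by (intro arg_cong2[of _ _ _ _ "(-)"] refl sum.cong) (simp add: H(2))
  ultimately show ?case by blast
qed

lemma zeta_ex:
  "\<exists>f. f holomorphic_on - {1} \<and> (\<forall>s. Re s > 1 \<longrightarrow> (\<lambda>n. of_nat n powr (- s)) sums f s) \<and> f 1 = 0"
proof -
  obtain H where H: "\<And>J. J > 0 \<Longrightarrow> H J holomorphic_on {s. Re s > 1 - real J}"
      "\<And>J s. Re s > 1 \<Longrightarrow> H J s = (s - 1) * zeta_series s"
    using zeta_halfplane by metis
  define P where "P = (\<lambda>J::nat. {s. Re s > 1 - real J})"
  have P: "open (P J)" "connected (P J)" for J
    unfolding P_def by (intro open_halfspace_Re_gt convex_connected convex_halfspace_Re_gt)+
  have eq_aux: "H J s = H K s" if "J > 0" "J \<le> K" "s \<in> P J" for J K s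
  proof (rule analytic_continuation_open[where f = "H J" and g = "H K" and s = "P 0" and s' = "P J"])
    show "P 0 \<noteq> {}" unfolding P_def by (auto intro: exI[of _ 2])
    show "H K holomorphic_on P J"
      using H(1)[of K] that unfolding P_def by (rule_tac holomorphic_on_subset) auto
    show "open (P 0)" "open (P J)" "connected (P J)" by (fact P)+
    show "H J holomorphic_on P J" using H(1)[OF that(1)] by (simp add: P_def)
    show "H J z = H K z" if "z \<in> P 0" for z using that by (simp add: P_def H(2))
    show "P 0 \<subseteq> P J" by (auto simp: P_def)
    show "s \<in> P J" by fact
  qed
  have eq: "H J s = H K s" if "J > 0" "K > 0" "s \<in> P J" "s \<in> P K" for J K s
  proof (cases "J \<le> K")
    case True
    show ?thesis by (rule eq_aux[OF that(1) True that(3)])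
  next
    case False
    show ?thesis by (rule eq_aux[OF that(2) _ that(4), symmetric]) (use False in simp)
  qed
  define N where "N = (\<lambda>s. nat \<lceil>\<bar>Re s\<bar>\<rceil> + 2)"
  have N: "N s > 0" "s \<in> P (N s)" for s
  proof -
    have "\<bar>Re s\<bar> \<le> real (nat \<lceil>\<bar>Re s\<bar>\<rceil>)" by (simp add: real_nat_ceiling_ge)
    moreover have "real (N s) = real (nat \<lceil>\<bar>Re s\<bar>\<rceil>) + 2" by (simp add: N_def)
    ultimately have "Re s > 1 - real (N s)" by linarith
    thus "s \<in> P (N s)" "N s > 0" unfolding P_def by simp (simp add: N_def)
  qed
  define G where "G = (\<lambda>s. H (N s) s)"
  have "G holomorphic_on P J" if "J > 0" for J
  proof (rule holomorphic_transform)
    show "H J holomorphic_on P J" using H(1)[OF that] by (simp add: P_def)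
    show "H J s = G s" if "s \<in> P J" for s
      unfolding G_def using \<open>J > 0\<close> N(1) that N(2) by (rule eq)
  qed
  hence "G field_differentiable (at s)" for s
    using N[of s] P(1) holomorphic_on_imp_differentiable_at by blast
  hence G: "G holomorphic_on UNIV"
    by (simp add: holomorphic_on_def)
  define f where "f = (\<lambda>s. G s / (s - 1))"
  have "f holomorphic_on - {1}"
    unfolding f_def by (intro holomorphic_intros holomorphic_on_subset[OF G]) auto
  moreover have "(\<lambda>n. of_nat n powr (- s)) sums f s" if "Re s > 1" for s
  proof -
    have "f s = zeta_series s"
      using that H(2)[OF that] by (auto simp: f_def G_def)
    hence "(\<lambda>n. of_nat (Suc n) powr (- s)) sums f s"
      using zeta_series_sums[OF that] by (simp add: zeta_series_def)
    thus ?thesis by (subst (asm) sums_Suc_iff) simp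
  qed
  moreover have "f 1 = 0" by (simp add: f_def)
  ultimately show ?thesis by blast
qed

lemma
  shows zeta_holomorphic: "zeta holomorphic_on - {1}"
    and zeta_sums: "Re s > 1 \<Longrightarrow> (\<lambda>n. of_nat n powr (- s)) sums zeta s"
    and zeta_1: "zeta 1 = 0"
proof -
  let ?P = "\<lambda>f. f holomorphic_on - {1} \<and> (\<forall>s. Re s > 1 \<longrightarrow> (\<lambda>n. of_nat n powr (- s)) sums f s) \<and> f 1 = 0"
  have "\<exists>!f. ?P f"
  proof (rule ex_ex1I[OF zeta_ex])
    fix f g assume fg: "?P f" "?P g"
    have "f s = g s" if "s \<noteq> 1" for s
    proof (rule analytic_continuation_open[where f = f and g = g and s = "{s. Re s > 1}" and s' = "- {1}"])
      show "{s. Re s > 1} \<noteq> {}" by (auto intro: exI[of _ 2])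
      show "connected (- {1 :: complex})" by (intro connected_punctured_universe) simp
    qed (use fg that in \<open>auto simp: open_halfspace_Re_gt intro: sums_unique2\<close>)
    with fg show "f = g" by (metis ext)
  qed
  from theI'[OF this] have "?P zeta" unfolding zeta_def .
  thus "zeta holomorphic_on - {1}" "zeta 1 = 0"
    "Re s > 1 \<Longrightarrow> (\<lambda>n. of_nat n powr (- s)) sums zeta s" by blast+
qed

text \<open>
  The coefficient functions exist because Dirichlet convolution multiplies the generating series and
  the Moebius function inverts \<open>zeta\<close>. All of these series converge absolutely for \<open>Re s > 1\<close>, which
  \<open>has_sum\<close> expresses.
\<close>

lemma dirichlet_coeffs_unique:
  fixes f g :: "nat \<Rightarrow> complex"
  assumes f0: "f 0 = g 0"
    and f: "\<And>s. Re s > 1 \<Longrightarrow> (\<lambda>n. f n / of_nat n powr s) sums F s"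
    and g: "\<And>s. Re s > 1 \<Longrightarrow> (\<lambda>n. g n / of_nat n powr s) sums F s"
  shows "f = g"
proof
  define h where "h = (\<lambda>n. f n - g n)"
  have h: "(\<lambda>n. h n / of_nat n powr s) sums 0" if "Re s > 1" for s
    using sums_diff[OF f[OF that] g[OF that]] by (simp add: h_def diff_divide_distrib)
  have "(\<lambda>n. h n / of_nat n powr 2) \<longlonglongrightarrow> 0"
    using h[of 2] by (intro summable_LIMSEQ_zero sums_summable) auto
  hence "Bseq (\<lambda>n. h n / of_nat n powr 2)"
    by (intro convergent_imp_Bseq convergentI)
  then obtain B where B: "B > 0" "\<And>n. norm (h n / of_nat n powr 2) \<le> B"
    unfolding Bseq_def by blast
  have hB: "norm (h n) \<le> B * real n ^ 2" if "n > 0" for n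
    using B(2)[of n] that by (simp add: norm_divide norm_power field_simps)
  have "h n = 0" for n
  proof (induction n rule: less_induct)
    case (less N)
    show ?case
    proof (cases "N = 0")
      case True
      thus ?thesis using f0 by (simp add: h_def)
    next
      case False
      define q where "q = real N / (real N + 1)"
      have q: "0 < q" "q < 1" using False by (simp_all add: q_def)
      define D where "D = (\<Sum>n. B * real N ^ 4 * real (n + Suc N) powr (- 2))"
      have summ: "summable (\<lambda>n. B * real N ^ 4 * real (n + Suc N) powr (- 2))"
        using summable_iff_shift[of "\<lambda>n. real n powr (- 2)" "Suc N"]
        by (intro summable_mult) (simp add: summable_real_powr_iff)
      have le: "norm (h N) \<le> q ^ k * D" for k
      proof -
        define t where "t = k + 4"
        define a where "a = (\<lambda>n. h n * of_nat N ^ t / of_nat n ^ t)"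
        have "(\<lambda>n. of_nat N ^ t * (h n / of_nat n powr of_nat t)) sums (of_nat N ^ t * 0)"
          using h[of "of_nat t"] by (intro sums_mult) (simp add: t_def)
        also have "(\<lambda>n. of_nat N ^ t * (h n / of_nat n powr of_nat t)) = a"
        proof
          fix n
          show "of_nat N ^ t * (h n / of_nat n powr of_nat t) = a n"
            using powr_nat'[of "of_nat n :: complex" t] by (cases "n = 0") (simp_all add: a_def t_def mult.commute)
        qed
        finally have a: "a sums 0" by simp
        have "(\<Sum>n<Suc N. a n) = a N"
          using less.IH by (simp add: a_def)
        also have "a N = h N" using False by (simp add: a_def)
        finally have "(\<lambda>n. a (n + Suc N)) sums (- h N)"
          using sums_split_initial_segment[OF a, of "Suc N"] by simp
        hence "norm (h N) = norm (\<Sum>n. a (n + Suc N))"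
          by (simp add: sums_iff)
        also have "\<dots> \<le> (\<Sum>n. q ^ k * (B * real N ^ 4 * real (n + Suc N) powr (- 2)))"
        proof (rule norm_suminf_le)
          fix n
          define m where "m = n + Suc N"
          have m: "real m > 0" "real m \<ge> real N + 1" by (auto simp: m_def)
          have "norm (a m) = norm (h m) * (real N / real m) ^ t"
            by (simp add: a_def norm_mult norm_divide norm_power power_divide)
          also have "\<dots> = norm (h m) * (real N / real m) ^ 4 * (real N / real m) ^ k"
            by (simp add: t_def power_add)
          also have "\<dots> \<le> (B * real m ^ 2) * (real N / real m) ^ 4 * q ^ k"
            using m hB[of m] B(1)
            by (intro mult_mono power_mono) (auto simp: q_def intro!: divide_left_mono)
          also have "\<dots> = q ^ k * (B * real N ^ 4 * real m powr (- 2))"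
            using m(1) by (simp add: powr_minus powr_numeral divide_simps)
          finally show "norm (a (n + Suc N)) \<le> q ^ k * (B * real N ^ 4 * real (n + Suc N) powr (- 2))"
            by (simp add: m_def)
        qed (intro summable_mult summ)
        also have "\<dots> = q ^ k * D"
          unfolding D_def by (intro suminf_mult summ)
        finally show ?thesis .
      qed
      have "(\<lambda>k. q ^ k * D) \<longlonglongrightarrow> 0 * D"
        using q by (intro tendsto_mult tendsto_const LIMSEQ_power_zero) auto
      hence "norm (h N) \<le> 0 * D"
        by (rule tendsto_lowerbound) (use le in auto)
      thus ?thesis by simp
    qed
  qed
  thus "f n = g n" for n by (simp add: h_def)
qed

definition has_dser :: "(nat \<Rightarrow> complex) \<Rightarrow> (complex \<Rightarrow> complex) \<Rightarrow> bool" where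
  "has_dser f F \<longleftrightarrow> (\<forall>s. Re s > 1 \<longrightarrow> ((\<lambda>n. f n / of_nat n powr s) has_sum F s) {1..})"

lemma dserD: "has_dser f F \<Longrightarrow> Re s > 1 \<Longrightarrow> ((\<lambda>n. f n / of_nat n powr s) has_sum F s) {1..}"
  by (simp add: has_dser_def)

lemma dser_cong: "has_dser f F \<Longrightarrow> (\<And>s. Re s > 1 \<Longrightarrow> F s = G s) \<Longrightarrow> has_dser f G"
  by (simp add: has_dser_def)

lemma has_sum_from_1_iff:
  "((\<lambda>n. f n / of_nat n powr s) has_sum (S :: complex)) {1..}
     \<longleftrightarrow> ((\<lambda>n. f n / of_nat n powr s) has_sum S) (UNIV :: nat set)"
  by (rule has_sum_cong_neutral) (auto simp: not_le)

lemma dser_sums: "has_dser f F \<Longrightarrow> Re s > 1 \<Longrightarrow> (\<lambda>n. f n / of_nat n powr s) sums F s"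
  unfolding has_dser_def has_sum_from_1_iff by (blast intro: has_sum_imp_sums)

lemma dirichlet_coeffs_dser:
  assumes "has_dser g F"
  shows dirichlet_coeffs_0: "dirichlet_coeffs F 0 = 0"
    and dirichlet_coeffs_sums:
      "Re s > 1 \<Longrightarrow> (\<lambda>n. dirichlet_coeffs F n / of_nat n powr s) sums F s"
proof -
  let ?P = "\<lambda>f. f 0 = 0 \<and> (\<forall>s. Re s > 1 \<longrightarrow> (\<lambda>n. f n / of_nat n powr s) sums F s)"
  have eq: "(g(0 := 0)) n / of_nat n powr s = g n / of_nat n powr s" for n s by simp
  have "\<exists>!f. ?P f"
  proof (rule ex_ex1I)
    show "\<exists>f. ?P f"
      using dser_sums[OF assms] by (intro exI[of _ "g(0 := 0)"]) (simp only: eq, simp)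
    show "f = f'" if "?P f" "?P f'" for f f'
      by (rule dirichlet_coeffs_unique[of f f' F]) (use that in auto)
  qed
  from theI'[OF this] have "?P (dirichlet_coeffs F)" unfolding dirichlet_coeffs_def .
  thus "dirichlet_coeffs F 0 = 0"
    "Re s > 1 \<Longrightarrow> (\<lambda>n. dirichlet_coeffs F n / of_nat n powr s) sums F s" by blast+
qed

definition dirichlet_conv :: "(nat \<Rightarrow> complex) \<Rightarrow> (nat \<Rightarrow> complex) \<Rightarrow> nat \<Rightarrow> complex" where
  "dirichlet_conv f g n = (\<Sum>(i, j) | i \<ge> 1 \<and> j \<ge> 1 \<and> i * j = n. f i * g j)"

lemma finite_factor_pairs: "finite {(i, j). i \<ge> 1 \<and> j \<ge> 1 \<and> i * j = (n :: nat)}"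
  by (rule finite_subset[of _ "{..n} \<times> {..n}"]) auto

lemma of_nat_mult_powr:
  "(of_nat (i * j) :: complex) powr s = of_nat i powr s * of_nat j powr s"
  by (simp add: powr_times_real_left)

lemma dser_dconv:
  assumes f: "has_dser f F" and g: "has_dser g G"
  shows "has_dser (dirichlet_conv f g) (\<lambda>s. F s * G s)"
  unfolding has_dser_def
proof safe
  fix s :: complex assume s: "Re s > 1"
  define a where "a = (\<lambda>n. f n / of_nat n powr s)"
  define b where "b = (\<lambda>n. g n / of_nat n powr s)"
  have a: "(a has_sum F s) {1..}" and b: "(b has_sum G s) {1..}"
    using dserD[OF f s] dserD[OF g s] by (simp_all add: a_def b_def)
  have abs: "(\<lambda>n. norm (a n)) summable_on {1..}" "(\<lambda>n. norm (b n)) summable_on {1..}"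
    using has_sum_imp_summable[OF a] has_sum_imp_summable[OF b]
    by (simp_all add: summable_on_iff_abs_summable_on_complex)
  have "(\<lambda>p. norm (case p of (i, j) \<Rightarrow> a i * b j)) summable_on {1..} \<times> {1..}"
    unfolding Infinite_Sum.abs_summable_on_Sigma_iff
    using abs by (auto simp: norm_mult infsum_cmult_right' infsum_nonneg abs_mult
                       intro!: summable_on_cmult_right summable_on_cmult_left)
  hence "(\<lambda>(i, j). a i * b j) summable_on {1..} \<times> {1..}"
    by (simp add: summable_on_iff_abs_summable_on_complex)
  hence "((\<lambda>(i, j). a i * b j) has_sum F s * G s) ({1..} \<times> {1..})"
    using has_sum_cmult_right[OF b] has_sum_cmult_left[OF a]
    by (intro has_sum_SigmaI[where g = "\<lambda>i. a i * G s"]) auto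
  also have "?this \<longleftrightarrow> ((\<lambda>(n, i, j). a i * b j) has_sum F s * G s)
      (SIGMA n:{1..}. {(i, j). i \<ge> 1 \<and> j \<ge> 1 \<and> i * j = n})"
    by (rule has_sum_reindex_bij_witness[of _ snd "\<lambda>p. (fst p * snd p, p)"]) auto
  finally have "((\<lambda>n. \<Sum>(i, j) | i \<ge> 1 \<and> j \<ge> 1 \<and> i * j = n. a i * b j) has_sum F s * G s) {1..}"
    by (rule has_sum_SigmaD) (auto intro!: has_sum_finiteI finite_factor_pairs[simplified])
  also have "(\<lambda>n. \<Sum>(i, j) | i \<ge> 1 \<and> j \<ge> 1 \<and> i * j = n. a i * b j)
      = (\<lambda>n. dirichlet_conv f g n / of_nat n powr s)"
    unfolding dirichlet_conv_def sum_divide_distrib a_def b_def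
    by (intro ext sum.cong) (auto simp flip: of_nat_mult_powr simp del: of_nat_mult)
  finally show "((\<lambda>n. dirichlet_conv f g n / of_nat n powr s) has_sum F s * G s) {1..}" .
qed

lemma dser_delta: "has_dser (\<lambda>n. if n = 1 then 1 else 0) (\<lambda>_. 1)"
  unfolding has_dser_def
proof safe
  fix s :: complex
  have "((\<lambda>n. (if n = 1 then 1 else 0) / of_nat n powr s) has_sum 1) {1::nat}"
    by (rule has_sum_finiteI) auto
  thus "((\<lambda>n. (if n = 1 then 1 else 0) / of_nat n powr s) has_sum 1) {1::nat..}"
    by (subst has_sum_cong_neutral[of "{1}"]) auto
qed

lemma dser_power: "has_dser f F \<Longrightarrow> \<exists>g. has_dser g (\<lambda>s. F s ^ k)"
proof (induction k)
  case (Suc k)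
  then obtain g where "has_dser g (\<lambda>s. F s ^ k)" by blast
  from dser_dconv[OF Suc.prems this] show ?case by auto
qed (use dser_delta in auto)

lemma dser_scale:
  assumes f: "has_dser f F" and c: "c \<ge> 1"
  shows "has_dser (\<lambda>n. \<Sum>m | m \<ge> 1 \<and> m ^ c = n. f m) (\<lambda>s. F (of_nat c * s))"
  unfolding has_dser_def
proof safe
  fix s :: complex assume s: "Re s > 1"
  have powr: "(of_nat (m ^ c) :: complex) powr s = of_nat m powr (of_nat c * s)" if "m \<ge> 1" for m
  proof -
    have "Ln (of_nat (m ^ c)) = of_real (ln (real (m ^ c)))"
      using that by (intro Ln_of_nat) simp
    also have "\<dots> = of_nat c * Ln (of_nat m)"
      using that by (simp add: ln_realpow)
    finally have "Ln (of_nat (m ^ c)) = of_nat c * Ln (of_nat m)" .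
    thus ?thesis using that by (simp add: powr_def algebra_simps del: of_nat_power)
  qed
  have fin: "finite {m. m \<ge> 1 \<and> m ^ c = n}" for n :: nat
    by (rule finite_subset[of _ "{..n}"]) (use c in \<open>auto intro: self_le_power\<close>)
  have "1 * 1 < real c * Re s" using s c by (intro mult_le_less_imp_less) auto
  hence "((\<lambda>m. f m / of_nat m powr (of_nat c * s)) has_sum F (of_nat c * s)) {1..}"
    by (intro dserD[OF f]) simp
  also have "?this \<longleftrightarrow> ((\<lambda>(n, m). f m / of_nat m powr (of_nat c * s)) has_sum F (of_nat c * s))
      (SIGMA n:{1..}. {m. m \<ge> 1 \<and> m ^ c = n})"
    by (rule has_sum_reindex_bij_witness[of _ snd "\<lambda>m. (m ^ c, m)"]) auto
  finally have "((\<lambda>n. \<Sum>m | m \<ge> 1 \<and> m ^ c = n. f m / of_nat m powr (of_nat c * s))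
      has_sum F (of_nat c * s)) {1..}"
    by (rule has_sum_SigmaD) (auto intro!: has_sum_finiteI fin[simplified])
  also have "(\<lambda>n. \<Sum>m | m \<ge> 1 \<and> m ^ c = n. f m / of_nat m powr (of_nat c * s))
      = (\<lambda>n. (\<Sum>m | m \<ge> 1 \<and> m ^ c = n. f m) / of_nat n powr s)"
    unfolding sum_divide_distrib by (intro ext sum.cong) (auto simp flip: powr simp del: of_nat_power)
  finally show "((\<lambda>n. (\<Sum>m | m \<ge> 1 \<and> m ^ c = n. f m) / of_nat n powr s)
      has_sum F (of_nat c * s)) {1..}" .
qed

lemma summable_bounded_dirichlet:
  assumes "\<And>n. norm (f n) \<le> 1" "Re s > 1"
  shows "summable (\<lambda>n. norm (f n / of_nat n powr s :: complex))"
proof (rule summable_comparison_test')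
  show "summable (\<lambda>n. real n powr (- Re s))"
    using assms(2) by (simp add: summable_real_powr_iff)
  show "norm (norm (f n / of_nat n powr s)) \<le> real n powr (- Re s)" if "n \<ge> 0" for n
    using assms(1)[of n] by (simp add: norm_divide norm_powr_real_powr powr_minus_divide divide_right_mono)
qed

lemma dser_zeta: "has_dser (\<lambda>_. 1) zeta"
  unfolding has_dser_def has_sum_from_1_iff
proof safe
  fix s :: complex assume s: "Re s > 1"
  have "(\<lambda>n. 1 / of_nat n powr s) sums zeta s"
    using zeta_sums[OF s] by (simp add: powr_minus divide_inverse)
  thus "((\<lambda>n. 1 / of_nat n powr s) has_sum zeta s) UNIV"
    by (intro norm_summable_imp_has_sum summable_bounded_dirichlet s) auto
qed

definition moebius :: "nat \<Rightarrow> complex" where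
  "moebius n = (if squarefree n then (- 1) ^ card (prime_factors n) else 0)"

lemma moebius_prime_mult:
  assumes "prime p" "\<not> p dvd d" "d > 0"
  shows "moebius (p * d) = - moebius d"
proof -
  have cop: "coprime p d" using assms(1,2) by (rule prime_imp_coprime)
  have "squarefree (p * d) \<longleftrightarrow> squarefree d"
    using squarefree_mult_coprime[OF cop] squarefree_prime[OF assms(1)]
    by (auto dest: squarefree_multD)
  moreover have "prime_factors (p * d) = insert p (prime_factors d)"
    using assms by (auto simp: prime_factors_product prime_factorization_prime)
  ultimately show ?thesis
    using assms by (auto simp: moebius_def card_insert_if)
qed

lemma sum_moebius:
  assumes "n > 1"
  shows "(\<Sum>d | d dvd n. moebius d) = 0"
proof -
  obtain p where p: "prime p" "p dvd n"
    using prime_factor_nat[of n] assms by auto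
  have fin: "finite {d. d dvd n}" using assms by simp
  let ?A = "{d. d dvd n \<and> \<not> p dvd d}" and ?B = "{d. d dvd n \<and> p dvd d \<and> squarefree d}"
  have pos: "d > 0" if "d dvd n" for d using that assms by (auto intro: Nat.gr0I)
  let ?A' = "{d. d dvd n \<and> \<not> p dvd d \<and> squarefree d}"
  have "(\<Sum>d | d dvd n. moebius d) = sum moebius (?A' \<union> ?B)"
    using fin by (intro sum.mono_neutral_right) (auto simp: moebius_def)
  also have "\<dots> = sum moebius ?A' + sum moebius ?B"
    using fin by (intro sum.union_disjoint) (auto elim: finite_subset[rotated])
  also have "sum moebius ?B = (\<Sum>d\<in>?A'. moebius (p * d))"
  proof (rule sum.reindex_bij_witness[of _ "\<lambda>d. p * d" "\<lambda>d. d div p"])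
    fix d assume d: "d \<in> ?B"
    then obtain e where e: "d = p * e" by auto
    have "p > 0" using p(1) by (rule prime_gt_0_nat)
    have "\<not> p dvd e"
    proof
      assume "p dvd e"
      hence "p ^ 2 dvd d" by (auto simp: e power2_eq_square)
      with d p show False by (auto simp: squarefree_def)
    qed
    moreover have "e dvd n" using d e by (auto intro: dvd_trans[of e d])
    moreover have "squarefree e" using d e by (auto dest: squarefree_multD)
    ultimately show "d div p \<in> ?A'" "p * (d div p) = d" "moebius (p * (d div p)) = moebius d"
      using e \<open>p > 0\<close> by auto
  next
    fix d assume d: "d \<in> ?A'"
    have "p > 0" using p(1) by (rule prime_gt_0_nat)
    thus "p * d div p = d" by simp
    have cop: "coprime p d" using p(1) d by (intro prime_imp_coprime) auto
    have "squarefree (p * d)"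
      using d by (intro squarefree_mult_coprime[OF cop squarefree_prime[OF p(1)]]) simp
    moreover have "p * d dvd n"
      using d p(2) cop by (intro divides_mult) auto
    ultimately show "p * d \<in> ?B" by simp
  qed
  also have "\<dots> = (\<Sum>d\<in>?A'. - moebius d)"
    using p pos by (intro sum.cong moebius_prime_mult) auto
  finally show ?thesis by (simp add: sum_negf)
qed

lemma dconv_moebius:
  assumes "n \<ge> 1"
  shows "dirichlet_conv (\<lambda>_. 1) moebius n = (if n = 1 then 1 else 0)"
proof -
  have "dirichlet_conv (\<lambda>_. 1) moebius n = (\<Sum>d | d dvd n. moebius d)"
    unfolding dirichlet_conv_def using assms
    by (intro sum.reindex_bij_witness[of _ "\<lambda>d. (n div d, d)" snd]) (auto simp: Suc_le_eq intro!: Nat.gr0I)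
  also have "\<dots> = (if n = 1 then 1 else 0)"
    using sum_moebius[of n] assms by (cases "n = 1") (auto simp: moebius_def)
  finally show ?thesis .
qed

lemma
  shows zeta_nonzero: "Re s > 1 \<Longrightarrow> zeta s \<noteq> 0"
    and dser_inverse_zeta: "has_dser moebius (\<lambda>s. 1 / zeta s)"
proof -
  define M where "M = (\<lambda>s. \<Sum>n. moebius n / of_nat n powr s)"
  have M: "has_dser moebius M"
    unfolding has_dser_def has_sum_from_1_iff
  proof safe
    fix s :: complex assume "Re s > 1"
    hence *: "summable (\<lambda>n. norm (moebius n / of_nat n powr s))"
      by (intro summable_bounded_dirichlet) (auto simp: moebius_def norm_power)
    thus "((\<lambda>n. moebius n / of_nat n powr s) has_sum M s) UNIV"
      unfolding M_def by (intro norm_summable_imp_has_sum summable_sums summable_norm_cancel[OF *])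
  qed
  have prod: "zeta s * M s = 1" if s: "Re s > 1" for s
  proof -
    have "((\<lambda>n. dirichlet_conv (\<lambda>_. 1) moebius n / of_nat n powr s) has_sum zeta s * M s) {1..}"
      using dserD[OF dser_dconv[OF dser_zeta M] s] .
    also have "?this \<longleftrightarrow> ((\<lambda>n. (if n = 1 then 1 else 0) / of_nat n powr s) has_sum zeta s * M s) {1::nat..}"
      by (intro has_sum_cong) (simp add: dconv_moebius)
    finally show ?thesis using dserD[OF dser_delta s] has_sum_unique by blast
  qed
  thus "Re s > 1 \<Longrightarrow> zeta s \<noteq> 0" by fastforce
  show "has_dser moebius (\<lambda>s. 1 / zeta s)"
    using M by (rule dser_cong) (use prod in \<open>metis mult_zero_left nonzero_mult_div_cancel_left zero_neq_one\<close>)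
qed

lemma
  shows mu_coeff_0: "mu_coeff k 0 = 0"
    and mu_coeff_sums: "Re s > 1 \<Longrightarrow> (\<lambda>n. mu_coeff k n / of_nat n powr s) sums (1 / zeta s ^ k)"
proof -
  obtain g where "has_dser g (\<lambda>s. (1 / zeta s) ^ k)"
    using dser_power[OF dser_inverse_zeta] by blast
  hence "has_dser g (\<lambda>s. 1 / zeta s ^ k)" by (simp add: power_one_over)
  from dirichlet_coeffs_dser[OF this] show "mu_coeff k 0 = 0"
    "Re s > 1 \<Longrightarrow> (\<lambda>n. mu_coeff k n / of_nat n powr s) sums (1 / zeta s ^ k)"
    unfolding mu_coeff_def by blast+
qed

lemma
  assumes "a \<ge> 1" "b \<ge> 1" "c \<ge> 1"
  shows f_coeff_0: "f_coeff k a b c 0 = 0"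
    and f_coeff_sums: "Re s > 1 \<Longrightarrow> (\<lambda>n. f_coeff k a b c n / of_nat n powr s) sums
          (zeta (of_nat a * s) * zeta (of_nat b * s) / zeta (of_nat c * s) ^ k)"
proof -
  obtain g where "has_dser g (\<lambda>s. (1 / zeta (of_nat c * s)) ^ k)"
    using dser_power[OF dser_scale[OF dser_inverse_zeta assms(3)]] by blast
  from dser_dconv[OF dser_dconv[OF dser_scale[OF dser_zeta assms(1)] dser_scale[OF dser_zeta assms(2)]] this]
  obtain h where "has_dser h (\<lambda>s. zeta (of_nat a * s) * zeta (of_nat b * s) / zeta (of_nat c * s) ^ k)"
    by (auto simp: power_one_over)
  from dirichlet_coeffs_dser[OF this] show "f_coeff k a b c 0 = 0"
    "Re s > 1 \<Longrightarrow> (\<lambda>n. f_coeff k a b c n / of_nat n powr s) sums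
          (zeta (of_nat a * s) * zeta (of_nat b * s) / zeta (of_nat c * s) ^ k)"
    unfolding f_coeff_def by blast+
qed

end

theory Submission
  imports Defs "HOL-Number_Theory.Prime_Powers"
begin

text \<open>
  Let \<open>u = u_coeff k a c\<close> and \<open>z = x / y ^ b\<close>. Dirichlet's hyperbola method over the pairs
  \<open>m ^ b * n \<le> x\<close> writes the summatory function of \<open>f_coeff\<close> through \<open>\<Sum>u(n)\<close> for \<open>m \<le> y\<close> and
  through \<open>\<lfloor>(x / n) powr (1 / b)\<rfloor> - \<lfloor>y\<rfloor>\<close> for \<open>m > y\<close>. Replacing \<open>\<lfloor>t\<rfloor>\<close> by \<open>t - psi t - 1 / 2\<close>, what
  is left besides the two sums of the theorem is an Euler--Maclaurin remainder for
  \<open>\<Sum>d powr (- b / a)\<close> over \<open>d \<le> y\<close>, the term \<open>psi y * Delta_u k a c z\<close>, and the Riesz mean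
  \<open>\<Sum>u(n) * (n powr (- 1 / b) - z powr (- 1 / b))\<close> over \<open>n \<le> z\<close>. The Riesz mean has an absolutely
  convergent Perron integral, because its kernel decays quadratically whereas
  \<open>zeta (a * s) / zeta (c * s) ^ k\<close> grows more slowly than \<open>\<bar>s\<bar>\<close>. Under the Riemann Hypothesis the
  line of integration moves to real part \<open>1 / (2 * c) + \<epsilon>\<close>; the poles at \<open>1 / a\<close> and \<open>1 / b\<close> give
  the main terms.

  The bound \<open>1 / zeta s = O(\<bar>Im s\<bar> powr \<epsilon>)\<close> to the right of the critical line comes from a normal
  families argument instead of the theorems of Borel--Caratheodory and Hadamard. The hypothesis
  \<open>riemann_hypothesis\<close> concerns only the open strip, so \<open>zeta s \<noteq> 0\<close> for \<open>Re s = 1\<close> has to be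
  proved as well.
\<close>

section \<open>Regularization and growth of the zeta function\<close>

text \<open>The smoothing is forced by the hyperbola method. As \<open>x = z * y ^ b\<close>, one
  has \<open>(x / n) powr (1 / b) - y = x powr (1 / b) * (n powr (- 1 / b) - z powr (- 1 /
  b))\<close>, so the weight of \<open>u n\<close> vanishes at the cutoff \<open>n = z\<close>. A
  sharp cutoff would lead to a kernel of order \<open>1 / s\<close> and to a truncated formula whose
  error involves individual coefficients. With a kernel of order \<open>1 / s ^ 2\<close>, a
  generating function of size \<open>norm s powr (1 - \<eta>)\<close> is small enough; elementary
  summation gives this for \<open>zeta (a * s)\<close> without a functional equation, and the
  \<open>k\<close> reciprocal factors cost an arbitrarily small power.

  The pole at \<open>1 / b\<close> belongs to the kernel, not to the zeta factors;
  \<open>b < 2 * c\<close> puts it to the right of the new line, and its residue yields the second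
  main term. The residue at \<open>1 / a\<close> yields a multiple of
  \<open>x powr (1 / a) * y powr (1 - b / a)\<close>, which cancels against the integral term of the
  Euler--Maclaurin formula; the \<open>psi y\<close> term of that formula cancels against the main
  term of \<open>psi y * (\<Sum>u(n))\<close>.\<close>

definition zeta_reg :: "complex \<Rightarrow> complex" where
  "zeta_reg s = 1 + (\<Sum>n. zeta_rem 1 (Suc n) s)"

lemma zeta_reg_holomorphic: "zeta_reg holomorphic_on {s. Re s > 0}"
  using zeta_rem_holomorphic[of 1] unfolding zeta_reg_def by (intro holomorphic_intros) simp

lemma zeta_reg_1: "zeta_reg 1 = 1"
proof -
  have "zeta_rem 1 (Suc n) 1 = 0" for n
    using of_nat_neq_0[of n, where 'a = complex] of_nat_neq_0[of "Suc n", where 'a = complex]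
    by (simp add: zeta_rem_def add.commute)
  thus ?thesis by (simp add: zeta_reg_def)
qed

text \<open>By the case \<open>J = 0\<close> of \<open>zeta_recurrence\<close> both sides agree on
  \<open>Re s > 1\<close>; the punctured half-plane is connected, so the identity theorem applies.
  At \<open>1\<close> the value of \<open>zeta\<close> is a dummy, whereas \<open>zeta_reg\<close>
  has the analytic value \<open>1\<close>.\<close>

lemma zeta_reg_eq:
  assumes "Re s > 0" "s \<noteq> 1"
  shows "zeta_reg s = (s - 1) * zeta s"
proof -
  have eq: "zeta_reg z = (z - 1) * zeta z" if "z \<in> {s. Re s > 0} - {1}" for z
  proof (rule analytic_continuation_open[where f = zeta_reg and g = "\<lambda>z. (z - 1) * zeta z" and s = "{s. Re s > 1}" and s' = "{s. Re s > 0} - {1}"])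
    show "open {s. 1 < Re s}" "open ({s. 0 < Re s} - {1})"
      by (auto intro!: open_halfspace_Re_gt open_Diff)
    show "connected ({s. 0 < Re s} - {1})"
      by (rule connected_open_delete) (auto intro: open_halfspace_Re_gt convex_connected convex_halfspace_Re_gt)
    show "{s. 1 < Re s} \<noteq> {}" by (auto intro: exI[of _ 2])
    show "{s. 1 < Re s} \<subseteq> {s. 0 < Re s} - {1}" by auto
    show "zeta_reg holomorphic_on {s. 0 < Re s} - {1}"
      by (rule holomorphic_on_subset[OF zeta_reg_holomorphic]) auto
    show "(\<lambda>z. (z - 1) * zeta z) holomorphic_on {s. 0 < Re s} - {1}"
      by (intro holomorphic_intros holomorphic_on_subset[OF zeta_holomorphic]) auto
    show "z \<in> {s. 0 < Re s} - {1}" by fact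
    fix s :: complex assume "s \<in> {s. 1 < Re s}"
    hence s: "Re s > 1" by simp
    have "(\<lambda>n. of_nat (Suc n) powr (- s)) sums zeta s"
      using zeta_sums[OF s] sums_Suc_iff[of "\<lambda>n. of_nat n powr (- s)" "zeta s"] by simp
    hence "zeta_series s = zeta s"
      unfolding zeta_series_def by (simp add: sums_iff)
    thus "zeta_reg s = (s - 1) * zeta s"
      using zeta_recurrence[OF s, of 0] by (simp add: zeta_reg_def)
  qed
  show ?thesis using eq assms by simp
qed

text \<open>Passing from \<open>N\<close> to \<open>Suc N\<close> merely expands the first remainder
  of the tail. Divided by \<open>s - 1\<close>, this is the usual approximation of zeta by a partial
  sum, with an \<open>N\<close> that may depend on \<open>s\<close>.\<close>

lemma zeta_reg_split:
  assumes "Re s > 0" "N \<ge> 1"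
  shows "zeta_reg s = of_nat N powr (1 - s) + (s - 1) * (\<Sum>n=1..<N. of_nat n powr (- s))
           + (\<Sum>n. zeta_rem 1 (n + N) s)"
  using assms(2)
proof (induction N rule: dec_induct)
  case base
  show ?case by (simp add: zeta_reg_def)
next
  case (step N)
  have summ: "summable (\<lambda>n. zeta_rem 1 (n + N) s)"
    using summable_ignore_initial_segment[OF zeta_rem_summable[of s 1], of "N - 1"] assms step.hyps
    by simp
  have "(\<Sum>n. zeta_rem 1 (n + N) s) = zeta_rem 1 N s + (\<Sum>n. zeta_rem 1 (n + Suc N) s)"
    using suminf_split_head[OF summ] by (simp add: algebra_simps)
  also have "zeta_rem 1 N s = of_nat (Suc N) powr (1 - s) - of_nat N powr (1 - s)
      + (s - 1) * of_nat N powr (- s)"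
    by (simp add: zeta_rem_def algebra_simps)
  finally have split: "(\<Sum>n. zeta_rem 1 (n + N) s) = \<dots> + (\<Sum>n. zeta_rem 1 (n + Suc N) s)" .
  show ?case
    unfolding step.IH split using step.hyps by (simp add: algebra_simps)
qed

text \<open>In \<open>zeta_reg_split\<close> take \<open>N\<close> near the square root of
  \<open>norm s\<close>. After division by \<open>s - 1\<close> the first two terms are at most
  \<open>N\<close> each, and the tail is at most \<open>norm s\<close> times a sum of
  \<open>n powr (- \<sigma> - 1)\<close> over \<open>n \<ge> N\<close>.\<close>

lemma zeta_growth:
  assumes "0 < \<sigma>" "\<sigma> \<le> 2"
  shows "\<exists>C>0. \<forall>s. Re s \<ge> \<sigma> \<and> norm s \<ge> 2 \<longrightarrow> norm (zeta s) \<le> C * norm s powr (1 - \<sigma> / 4)"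
proof -
  define S where "S = (\<Sum>n. real (Suc n) powr (- \<sigma> / 2 - 1))"
  have S_summ: "summable (\<lambda>n. real (Suc n) powr (- \<sigma> / 2 - 1))"
    using assms by (intro summable_Suc_powr) simp
  have "S \<ge> 0" unfolding S_def by (intro suminf_nonneg S_summ) simp
  have "norm (zeta s) \<le> (4 + S) * norm s powr (1 - \<sigma> / 4)" if s: "Re s \<ge> \<sigma>" "norm s \<ge> 2" for s
  proof -
    define \<tau> where "\<tau> = norm s"
    have \<tau>: "\<tau> \<ge> 2" using s by (simp add: \<tau>_def)
    have s0: "Re s > 0" using s assms by simp
    have s1: "norm (s - 1) \<ge> 1" using norm_triangle_ineq2[of s 1] s by simp
    hence "s \<noteq> 1" by auto
    define N where "N = nat \<lceil>\<tau> powr (1 / 2)\<rceil>"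
    have root1: "\<tau> powr (1 / 2) \<ge> 1" using \<tau> by (intro ge_one_powr_ge_zero) auto
    have N_ge: "real N \<ge> \<tau> powr (1 / 2)" unfolding N_def by (rule real_nat_ceiling_ge)
    have N_le: "real N \<le> 2 * \<tau> powr (1 / 2)"
      unfolding N_def using root1 by linarith
    have N1: "N \<ge> 1" using N_ge root1 by linarith
    have pw: "norm (of_nat n powr z :: complex) = real n powr Re z" for n z
      using norm_powr_real_powr[of "of_nat n" z] by simp
    have A: "norm (of_nat N powr (1 - s) / (s - 1)) \<le> real N"
    proof -
      have "norm (of_nat N powr (1 - s) / (s - 1)) \<le> real N powr (1 - Re s) / 1"
        unfolding norm_divide pw using s1 by (intro frac_le) auto
      also have "\<dots> \<le> real N powr 1"
        using N1 s0 unfolding div_by_1 by (intro powr_mono) auto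
      finally show ?thesis using N1 by simp
    qed
    have B: "norm (\<Sum>n=1..<N. of_nat n powr (- s) :: complex) \<le> real N"
    proof -
      have "norm (of_nat n powr (- s) :: complex) \<le> 1" if "n \<ge> 1" for n
        using powr_mono[of "- Re s" 0 "real n"] that s0 by (simp add: pw)
      hence "norm (\<Sum>n=1..<N. of_nat n powr (- s) :: complex) \<le> (\<Sum>n=1..<N. 1)"
        by (intro sum_norm_le) auto
      thus ?thesis by simp
    qed
    have C: "norm (\<Sum>n. zeta_rem 1 (n + N) s) \<le> norm (s - 1) * \<tau> * \<tau> powr (- \<sigma> / 4) * S"
    proof -
      have le: "norm (zeta_rem 1 (n + N) s)
          \<le> norm (s - 1) * \<tau> * \<tau> powr (- \<sigma> / 4) * real (Suc n) powr (- \<sigma> / 2 - 1)" for n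
      proof -
        have "((1 - s) gchoose 2) = (1 - s) * (- s) / 2"
          by (simp add: gbinomial_prod_rev numeral_2_eq_2)
        hence gb: "2 * norm ((1 - s) gchoose 2) = norm (s - 1) * \<tau>"
          by (simp add: norm_mult norm_divide \<tau>_def norm_minus_commute)
        \<comment> \<open>Of the decay beyond exponent \<open>- 1\<close>, one half pays for the
          saving \<open>\<tau> powr (- \<sigma> / 4)\<close>; the other half keeps the series
          \<open>S\<close>, which is independent of \<open>N\<close>, convergent.\<close>
        have "real (n + N) powr (- Re s - 1) \<le> real (n + N) powr (- \<sigma> / 2 + (- \<sigma> / 2 - 1))"
          using s N1 by (intro powr_mono) auto
        also have "\<dots> = real (n + N) powr (- \<sigma> / 2) * real (n + N) powr (- \<sigma> / 2 - 1)"
          by (rule powr_add)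
        also have "\<dots> \<le> (\<tau> powr (1 / 2)) powr (- \<sigma> / 2) * real (Suc n) powr (- \<sigma> / 2 - 1)"
          using N_ge N1 root1 assms by (intro mult_mono powr_mono2') auto
        also have "(\<tau> powr (1 / 2)) powr (- \<sigma> / 2) = \<tau> powr (- \<sigma> / 4)"
          by (simp add: powr_powr)
        finally have "norm (s - 1) * \<tau> * real (n + N) powr (- Re s - 1)
            \<le> norm (s - 1) * \<tau> * (\<tau> powr (- \<sigma> / 4) * real (Suc n) powr (- \<sigma> / 2 - 1))"
          using \<tau> by (intro mult_left_mono) auto
        moreover have "norm (zeta_rem 1 (n + N) s) \<le> norm (s - 1) * \<tau> * real (n + N) powr (- Re s - 1)"
          using norm_zeta_rem_le[of "n + N" s 1] N1 s0 gb by (simp add: numeral_2_eq_2)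
        ultimately show ?thesis by (simp only: mult.assoc)
      qed
      have "norm (\<Sum>n. zeta_rem 1 (n + N) s)
          \<le> (\<Sum>n. norm (s - 1) * \<tau> * \<tau> powr (- \<sigma> / 4) * real (Suc n) powr (- \<sigma> / 2 - 1))"
        by (intro norm_suminf_le le summable_mult S_summ)
      also have "\<dots> = norm (s - 1) * \<tau> * \<tau> powr (- \<sigma> / 4) * S"
        unfolding S_def by (intro suminf_mult S_summ)
      finally show ?thesis .
    qed
    have "zeta s = zeta_reg s / (s - 1)"
      using zeta_reg_eq[OF s0 \<open>s \<noteq> 1\<close>] \<open>s \<noteq> 1\<close> by simp
    also have "\<dots> = of_nat N powr (1 - s) / (s - 1) + (\<Sum>n=1..<N. of_nat n powr (- s))
        + (\<Sum>n. zeta_rem 1 (n + N) s) / (s - 1)"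
      unfolding zeta_reg_split[OF s0 N1] using \<open>s \<noteq> 1\<close> by (simp add: add_divide_distrib)
    also have "norm \<dots> \<le> real N + real N + \<tau> * \<tau> powr (- \<sigma> / 4) * S"
    proof (intro norm_triangle_mono A B)
      show "norm ((\<Sum>n. zeta_rem 1 (n + N) s) / (s - 1)) \<le> \<tau> * \<tau> powr (- \<sigma> / 4) * S"
        using C s1 unfolding norm_divide by (subst pos_divide_le_eq) (auto simp: mult_ac)
    qed
    also have "\<tau> * \<tau> powr (- \<sigma> / 4) = \<tau> powr (1 - \<sigma> / 4)"
      using \<tau> powr_add[of \<tau> 1 "- \<sigma> / 4"] by simp
    \<comment> \<open>Here \<open>\<sigma> \<le> 2\<close> gives
      \<open>1 / 2 \<le> 1 - \<sigma> / 4\<close>. The two occurrences of \<open>N\<close> account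
      for the \<open>4\<close> in the constant.\<close>
    also have "real N \<le> 2 * \<tau> powr (1 - \<sigma> / 4)"
    proof -
      have "\<tau> powr (1 / 2) \<le> \<tau> powr (1 - \<sigma> / 4)" using \<tau> assms by (intro powr_mono) auto
      thus ?thesis using N_le by linarith
    qed
    finally show ?thesis by (simp add: \<tau>_def algebra_simps)
  qed
  thus ?thesis using \<open>S \<ge> 0\<close> by (intro exI[of _ "4 + S"]) auto
qed

section \<open>Non-vanishing on the line of real part one\<close>

lemma summable_ln_powr:
  assumes "\<sigma> > 1"
  shows "summable (\<lambda>n. ln (real n) * real n powr (- \<sigma>))"
proof (rule summable_comparison_test')
  define a where "a = (\<sigma> - 1) / 2"
  have a: "a > 0" "a - \<sigma> < - 1" using assms by (auto simp: a_def field_simps)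
  show "summable (\<lambda>n. real n powr (a - \<sigma>) / a)"
    using a by (intro summable_divide) (simp add: summable_real_powr_iff)
  fix n :: nat assume "n \<ge> 1"
  hence "ln (real n) \<le> real n powr a / a" using a by (intro ln_powr_bound) auto
  hence "ln (real n) * real n powr (- \<sigma>) \<le> real n powr a / a * real n powr (- \<sigma>)"
    by (intro mult_right_mono) auto
  also have "\<dots> = real n powr (a - \<sigma>) / a"
    by (simp add: powr_diff powr_minus divide_simps)
  finally show "norm (ln (real n) * real n powr (- \<sigma>)) \<le> real n powr (a - \<sigma>) / a"
    using \<open>n \<ge> 1\<close> by (simp add: abs_mult)
qed

lemma norm_of_nat_powr: "norm (of_nat n powr z :: complex) = real n powr Re z"
  using norm_powr_real_powr[of "of_nat n" z] by simp

lemma summable_dser_ln: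
  assumes "\<And>n. norm (f n :: complex) \<le> ln (real n)" "Re s > 1"
  shows "summable (\<lambda>n. norm (f n / of_nat n powr s))"
proof (rule summable_comparison_test')
  show "summable (\<lambda>n. ln (real n) * real n powr (- Re s))"
    using assms by (intro summable_ln_powr)
  show "norm (norm (f n / of_nat n powr s)) \<le> ln (real n) * real n powr (- Re s)" if "n \<ge> 0" for n
    using mult_right_mono[OF assms(1)[of n], of "real n powr (- Re s)"]
    by (simp add: norm_mult norm_inverse norm_of_nat_powr powr_minus divide_inverse)
qed

text \<open>Termwise differentiation of the zeta series, justified by the Weierstrass test on a
  closed half-plane that has \<open>s\<close> in its interior.\<close>

lemma dser_ln: "has_dser (\<lambda>n. of_real (ln (real n))) (\<lambda>s. - deriv zeta s)"
  unfolding has_dser_def has_sum_from_1_iff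
proof safe
  fix s :: complex assume s: "Re s > 1"
  define \<delta> where "\<delta> = (Re s - 1) / 2"
  define S where "S = {z. Re z \<ge> 1 + \<delta>}"
  have \<delta>: "\<delta> > 0" using s by (simp add: \<delta>_def)
  define f where "f = (\<lambda>n z. of_nat n powr (- z) :: complex)"
  define f' where "f' = (\<lambda>n z. - of_real (ln (real n)) * (of_nat n powr (- z)) :: complex)"
  have int: "s \<in> interior S"
  proof (rule interiorI[of "{z. Re z > 1 + \<delta>}"])
    show "s \<in> {z. Re z > 1 + \<delta>}" using s by (simp add: \<delta>_def field_simps)
  qed (auto simp: S_def open_halfspace_Re_gt)
  have sums: "(\<lambda>n. f n z) sums zeta z" if "Re z > 1" for z
    using zeta_sums[OF that] by (simp add: f_def)
  have "((\<lambda>z. \<Sum>n. f n z) has_field_derivative (\<Sum>n. f' n s)) (at s)"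
  proof (rule has_field_derivative_series'(2))
    show "convex S" unfolding S_def by (rule convex_halfspace_Re_ge)
    show "(f n has_field_derivative f' n z) (at z within S)" for n z
    proof (cases "n = 0")
      case True
      hence "f n = (\<lambda>_. 0)" "f' n z = 0" by (auto simp: f_def f'_def)
      thus ?thesis by simp
    next
      case False
      hence "Ln (of_nat n) = of_real (ln (real n))" by (intro Ln_of_nat) auto
      moreover have "((\<lambda>z. of_nat n powr z) has_field_derivative Ln (of_nat n) * of_nat n powr (- z)) (at (- z))"
        using False by (intro has_field_derivative_powr_right) auto
      from DERIV_chain2[OF this DERIV_minus[OF DERIV_ident]]
      have "((\<lambda>z. of_nat n powr (- z)) has_field_derivative Ln (of_nat n) * of_nat n powr (- z) * - 1) (at z within S)" .
      ultimately show ?thesis unfolding f_def f'_def by simp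
    qed
    show "uniformly_convergent_on S (\<lambda>n z. \<Sum>i<n. f' i z)"
    proof (rule Weierstrass_m_test')
      show "summable (\<lambda>n. ln (real n) * real n powr (- (1 + \<delta>)))"
        using \<delta> by (intro summable_ln_powr) simp
      fix n z assume "z \<in> S"
      hence z: "Re z \<ge> 1 + \<delta>" by (simp add: S_def)
      show "norm (f' n z) \<le> ln (real n) * real n powr (- (1 + \<delta>))"
      proof (cases "n = 0")
        case False
        thus ?thesis unfolding f'_def norm_mult norm_of_nat_powr
          using z by (intro mult_mono powr_mono) auto
      qed (auto simp: f'_def)
    qed
    show "s \<in> S" using int interior_subset by blast
    show "summable (\<lambda>n. f n s)" using sums[OF s] by (simp add: sums_iff)
  qed (rule int)
  hence "(zeta has_field_derivative (\<Sum>n. f' n s)) (at s)"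
  proof (rule has_field_derivative_transform_within_open[where S = "{z. Re z > 1}"])
    show "open {z. Re z > 1}" by (rule open_halfspace_Re_gt)
    show "s \<in> {z. Re z > 1}" using s by simp
    show "(\<Sum>n. f n z) = zeta z" if "z \<in> {z. Re z > 1}" for z
      using sums[of z] that by (simp add: sums_iff)
  qed
  hence deriv: "deriv zeta s = (\<Sum>n. f' n s)" by (rule DERIV_imp_deriv)
  have abs: "summable (\<lambda>n. norm (of_real (ln (real n)) / of_nat n powr s :: complex))"
  proof (intro summable_dser_ln s)
    show "norm (of_real (ln (real n)) :: complex) \<le> ln (real n)" for n
      by (cases "n = 0") auto
  qed
  have "(\<lambda>n. of_real (ln (real n)) / of_nat n powr s) = (\<lambda>n. - f' n s)"
    by (simp add: f'_def powr_minus divide_inverse)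
  moreover have "(\<lambda>n. - (- f' n s)) sums deriv zeta s"
    using summable_norm_cancel[OF abs] unfolding deriv calculation
    using summable_minus_iff[of "\<lambda>n. f' n s"] by (auto simp: sums_iff)
  hence "(\<lambda>n. - f' n s) sums - deriv zeta s"
    using sums_minus by fastforce
  ultimately show "((\<lambda>n. of_real (ln (real n)) / of_nat n powr s) has_sum - deriv zeta s) UNIV"
    using abs by (intro norm_summable_imp_has_sum) auto
qed

lemma mangoldt_nonneg: "mangoldt n \<ge> (0 :: real)"
  using aprimedivisor_gt_Suc_0_nat[OF primepow_gt_Suc_0, of n]
  by (auto simp: mangoldt_def intro!: ln_ge_zero)

lemma mangoldt_le_ln: "mangoldt n \<le> ln (real n)"
proof (cases "n = 0")
  case False
  have "mangoldt n \<le> (\<Sum>d | d dvd n. mangoldt d :: real)"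
    using False by (intro member_le_sum) (auto simp: mangoldt_nonneg)
  thus ?thesis using mangoldt_sum[OF False, where 'a = real] by simp
qed simp

text \<open>The sum of \<open>mangoldt\<close> over the divisors of \<open>n\<close> is
  \<open>ln n\<close>, so the series \<open>D\<close> satisfies
  \<open>zeta s * D s = - deriv zeta s\<close>; it converges absolutely because
  \<open>mangoldt n \<le> ln n\<close>.\<close>

lemma dser_mangoldt: "has_dser mangoldt (\<lambda>s. - deriv zeta s / zeta s)"
proof -
  define D where "D = (\<lambda>s. \<Sum>n. mangoldt n / of_nat n powr s :: complex)"
  have D: "has_dser mangoldt D"
    unfolding has_dser_def has_sum_from_1_iff
  proof safe
    fix s :: complex assume "Re s > 1"
    hence *: "summable (\<lambda>n. norm (mangoldt n / of_nat n powr s :: complex))"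
    proof (rule summable_dser_ln[rotated])
      show "norm (mangoldt n :: complex) \<le> ln (real n)" for n
        using mangoldt_le_ln[of n] mangoldt_nonneg[of n]
        by (metis of_real_mangoldt norm_of_real abs_of_nonneg)
    qed
    thus "((\<lambda>n. mangoldt n / of_nat n powr s) has_sum D s) UNIV"
      unfolding D_def by (intro norm_summable_imp_has_sum summable_sums summable_norm_cancel[OF *])
  qed
  have "zeta s * D s = - deriv zeta s" if s: "Re s > 1" for s
  proof -
    have conv: "dirichlet_conv (\<lambda>_. 1) mangoldt n = of_real (ln (real n))" if "n \<ge> 1" for n
    proof -
      have "dirichlet_conv (\<lambda>_. 1) mangoldt n = (\<Sum>d | d dvd n. mangoldt d)"
        unfolding dirichlet_conv_def using that
        by (intro sum.reindex_bij_witness[of _ "\<lambda>d. (n div d, d)" snd]) (auto simp: Suc_le_eq intro!: Nat.gr0I)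
      thus ?thesis using that mangoldt_sum[of n, where 'a = complex] by simp
    qed
    have "((\<lambda>n. dirichlet_conv (\<lambda>_. 1) mangoldt n / of_nat n powr s) has_sum zeta s * D s) {1..}"
      using dserD[OF dser_dconv[OF dser_zeta D] s] .
    also have "?this \<longleftrightarrow> ((\<lambda>n. of_real (ln (real n)) / of_nat n powr s) has_sum zeta s * D s) {1::nat..}"
      by (intro has_sum_cong) (simp add: conv)
    finally show ?thesis using dserD[OF dser_ln s] has_sum_unique by blast
  qed
  with zeta_nonzero show ?thesis
    by (intro dser_cong[OF D]) (simp add: field_simps)
qed

text \<open>Mertens' inequality: with \<open>\<theta> = t * ln n\<close>, \<open>3 + 4 * cos
  \<theta> + cos (2 * \<theta>) = 2 * (1 + cos \<theta>) ^ 2\<close>, and the coefficients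
  \<open>mangoldt n\<close> are nonnegative.\<close>

lemma zeta_341:
  assumes "\<sigma> > 1"
  defines "D \<equiv> \<lambda>s. - deriv zeta s / zeta s"
  shows "Re (3 * D (of_real \<sigma>) + 4 * D (Complex \<sigma> t) + D (Complex \<sigma> (2 * t))) \<ge> 0"
proof -
  have sums: "(\<lambda>n. mangoldt n / of_nat n powr s) sums D s" if "Re s > 1" for s
    using dser_sums[OF dser_mangoldt that] by (simp add: D_def)
  define g where "g = (\<lambda>n s. mangoldt n / of_nat n powr s :: complex)"
  have Re_g: "Re (g n (Complex \<sigma> u)) = mangoldt n * real n powr (- \<sigma>) * cos (u * ln (real n))" for n u
  proof (cases "n = 0")
    case False
    have "g n (Complex \<sigma> u) = of_real (mangoldt n) * of_nat n powr (- Complex \<sigma> u)"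
      by (simp add: g_def powr_minus divide_inverse)
    also have "of_nat n powr (- Complex \<sigma> u) = exp (Complex (- \<sigma> * ln (real n)) (- u * ln (real n)))"
      using False by (simp add: powr_def Ln_of_nat complex_eq_iff exp_eq_polar)
    finally show ?thesis using False
      by (simp add: Re_exp powr_def)
  qed (auto simp: g_def)
  have "(\<lambda>n. 3 * g n (Complex \<sigma> 0) + 4 * g n (Complex \<sigma> t) + g n (Complex \<sigma> (2 * t)))
          sums (3 * D (Complex \<sigma> 0) + 4 * D (Complex \<sigma> t) + D (Complex \<sigma> (2 * t)))"
    unfolding g_def using assms by (intro sums_add sums_mult sums) auto
  from sums_Re[OF this]
  have "(\<lambda>n. 2 * mangoldt n * real n powr (- \<sigma>) * (1 + cos (t * ln (real n)))\<^sup>2)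
          sums Re (3 * D (Complex \<sigma> 0) + 4 * D (Complex \<sigma> t) + D (Complex \<sigma> (2 * t)))"
  proof (rule back_subst[of "\<lambda>f. f sums _"])
    show "(\<lambda>n. Re (3 * g n (Complex \<sigma> 0) + 4 * g n (Complex \<sigma> t) + g n (Complex \<sigma> (2 * t))))
        = (\<lambda>n. 2 * mangoldt n * real n powr (- \<sigma>) * (1 + cos (t * ln (real n)))\<^sup>2)"
    proof
      fix n
      define X c where "X = mangoldt n * real n powr (- \<sigma>)" and "c = cos (t * ln (real n))"
      have "cos (2 * t * ln (real n)) = 2 * c\<^sup>2 - 1"
        using cos_double_cos[of "t * ln (real n)"] by (simp add: mult.assoc c_def)
      hence "Re (3 * g n (Complex \<sigma> 0) + 4 * g n (Complex \<sigma> t) + g n (Complex \<sigma> (2 * t)))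
          = 3 * X + 4 * (X * c) + X * (2 * c\<^sup>2 - 1)"
        by (simp add: Re_g X_def c_def)
      also have "\<dots> = 2 * X * (1 + c)\<^sup>2" by (simp add: algebra_simps power2_eq_square)
      finally show "Re (3 * g n (Complex \<sigma> 0) + 4 * g n (Complex \<sigma> t) + g n (Complex \<sigma> (2 * t)))
        = 2 * mangoldt n * real n powr (- \<sigma>) * (1 + cos (t * ln (real n)))\<^sup>2"
        by (simp add: X_def c_def mult.assoc)
    qed
  qed
  hence "0 \<le> Re (3 * D (Complex \<sigma> 0) + 4 * D (Complex \<sigma> t) + D (Complex \<sigma> (2 * t)))"
    by (rule sums_le[OF _ sums_zero, rotated]) (auto intro!: mult_nonneg_nonneg mangoldt_nonneg)
  thus ?thesis by (simp add: complex_of_real_def)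
qed

section \<open>Logarithmic derivatives at zeros and at the pole\<close>

lemma holomorphic_tendsto:
  assumes "f holomorphic_on S" "open S" "p \<in> S"
  shows "(f \<longlongrightarrow> f p) (at p)" "(deriv f \<longlongrightarrow> deriv f p) (at p)"
  using holomorphic_on_imp_continuous_on[OF assms(1)] assms(2,3)
    holomorphic_on_imp_continuous_on[OF holomorphic_deriv[OF assms(1,2)]]
  by (auto simp: continuous_on_eq_continuous_at isCont_def)

text \<open>The limit \<open>m\<close> is the order of vanishing at \<open>p\<close>: write
  \<open>f w = (w - p) ^ m * g w\<close> with \<open>g p \<noteq> 0\<close>. The point
  \<open>q\<close> certifies that \<open>f\<close> does not vanish identically.\<close>

lemma logderiv_tendsto:
  assumes "f holomorphic_on S" "open S" "connected S" "p \<in> S" "q \<in> S" "f q \<noteq> 0"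
  obtains m :: nat where "((\<lambda>w. (w - p) * (deriv f w / f w)) \<longlongrightarrow> of_nat m) (at p)"
    "f p = 0 \<Longrightarrow> m \<ge> 1"
proof (cases "f p = 0")
  case False
  have "((\<lambda>w. (w - p) * (deriv f w / f w)) \<longlongrightarrow> (p - p) * (deriv f p / f p)) (at p)"
    using False by (intro tendsto_intros holomorphic_tendsto[OF assms(1,2,4)])
  thus ?thesis using False by (intro that[of 0]) auto
next
  case True
  have "\<not> f constant_on S" using True assms(4-6) by (metis constant_on_def)
  from holomorphic_factor_zero_nonconstant[OF assms(1-4) True this]
  obtain g r n where gr: "0 < n" "0 < r" "ball p r \<subseteq> S" "g holomorphic_on ball p r"
      "\<And>w. w \<in> ball p r \<Longrightarrow> f w = (w - p) ^ n * g w" "\<And>w. w \<in> ball p r \<Longrightarrow> g w \<noteq> 0" by metis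
  have "((\<lambda>w. of_nat n + (w - p) * (deriv g w / g w)) \<longlongrightarrow> of_nat n + (p - p) * (deriv g p / g p)) (at p)"
    using gr(2,6) by (intro tendsto_intros holomorphic_tendsto[OF gr(4)]) auto
  hence lim: "((\<lambda>w. of_nat n + (w - p) * (deriv g w / g w)) \<longlongrightarrow> of_nat n) (at p)" by simp
  have eq: "of_nat n + (w - p) * (deriv g w / g w) = (w - p) * (deriv f w / f w)"
    if w: "w \<in> ball p r" "w \<noteq> p" for w
  proof -
    have "(g has_field_derivative deriv g w) (at w)"
      using gr(4) w by (intro holomorphic_derivI[of g "ball p r"]) auto
    hence "((\<lambda>w. (w - p) ^ n * g w) has_field_derivative
             of_nat n * (w - p) ^ (n - 1) * g w + (w - p) ^ n * deriv g w) (at w)"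
      by (auto intro!: derivative_eq_intros)
    hence "(f has_field_derivative
             of_nat n * (w - p) ^ (n - 1) * g w + (w - p) ^ n * deriv g w) (at w)"
      by (rule has_field_derivative_transform_within_open[of _ _ _ "ball p r"]) (use gr w in auto)
    hence "deriv f w = of_nat n * (w - p) ^ (n - 1) * g w + (w - p) ^ n * deriv g w"
      by (rule DERIV_imp_deriv)
    also have "(w - p) ^ n = (w - p) ^ (n - 1) * (w - p)"
      using gr(1) by (simp add: power_eq_if)
    finally have deriv: "deriv f w = of_nat n * (w - p) ^ (n - 1) * g w + (w - p) ^ (n - 1) * (w - p) * deriv g w" .
    have f: "f w = (w - p) ^ (n - 1) * (w - p) * g w"
      using gr(1) gr(5)[OF w(1)] by (simp add: power_eq_if)
    have "of_nat n + d * (y / x) = d * ((of_nat n * P * x + P * d * y) / (P * d * x))"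
      if "P \<noteq> 0" "d \<noteq> 0" "x \<noteq> 0" for P d x y :: complex
      using that by (simp add: field_simps)
    from this[of "(w - p) ^ (n - 1)" "w - p" "g w" "deriv g w"] show ?thesis
      unfolding deriv f using gr(6)[OF w(1)] w(2) by simp
  qed
  have "((\<lambda>w. (w - p) * (deriv f w / f w)) \<longlongrightarrow> of_nat n) (at p)"
    by (rule Lim_transform_within_open[OF lim open_ball _ eq]) (use gr(2) in auto)
  thus ?thesis using gr(1) by (intro that[of n]) auto
qed

text \<open>The pole is simple: the logarithmic derivative of \<open>zeta\<close> is that of
  \<open>zeta_reg\<close> minus \<open>1 / (s - 1)\<close>, and
  \<open>zeta_reg 1 = 1\<close>.\<close>

lemma zeta_logderiv_at_1: "((\<lambda>s. (s - 1) * (deriv zeta s / zeta s)) \<longlongrightarrow> - 1) (at 1)"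
proof -
  have op: "open {s::complex. Re s > 0}" by (rule open_halfspace_Re_gt)
  have "((\<lambda>s. (s - 1) * (deriv zeta_reg s / zeta_reg s) - 1) \<longlongrightarrow>
          (1 - 1) * (deriv zeta_reg 1 / zeta_reg 1) - 1) (at 1)"
    by (intro tendsto_intros holomorphic_tendsto[OF zeta_reg_holomorphic op]) (auto simp: zeta_reg_1)
  hence lim: "((\<lambda>s. (s - 1) * (deriv zeta_reg s / zeta_reg s) - 1) \<longlongrightarrow> - 1) (at 1)" by simp
  have "eventually (\<lambda>s. zeta_reg s \<noteq> 0) (at 1)"
    using holomorphic_tendsto(1)[OF zeta_reg_holomorphic op, of 1] zeta_reg_1
    by (intro tendsto_imp_eventually_ne[of _ 1]) auto
  moreover have "eventually (\<lambda>s. Re s > 0 \<and> s \<noteq> 1) (at 1)"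
    using eventually_at_in_open[OF op, of 1] by (auto elim: eventually_mono)
  ultimately have "eventually (\<lambda>s. (s - 1) * (deriv zeta_reg s / zeta_reg s) - 1
      = (s - 1) * (deriv zeta s / zeta s)) (at 1)"
  proof eventually_elim
    case (elim s)
    note 1 = elim
    have "(zeta_reg has_field_derivative deriv zeta_reg s) (at s)"
      using 1 by (intro holomorphic_derivI[OF zeta_reg_holomorphic op]) auto
    hence "((\<lambda>s. zeta_reg s / (s - 1)) has_field_derivative
        (deriv zeta_reg s * (s - 1) - zeta_reg s) / (s - 1)\<^sup>2) (at s)"
      using 1 by (auto intro!: derivative_eq_intros simp: power2_eq_square)
    hence "(zeta has_field_derivative
        (deriv zeta_reg s * (s - 1) - zeta_reg s) / (s - 1)\<^sup>2) (at s)"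
    proof (rule has_field_derivative_transform_within_open[of _ _ _ "{s. Re s > 0} - {1}"])
      show "zeta_reg z / (z - 1) = zeta z" if "z \<in> {s. Re s > 0} - {1}" for z
        using zeta_reg_eq[of z] that by auto
    qed (use op 1 in auto)
    hence "deriv zeta s = (deriv zeta_reg s * (s - 1) - zeta_reg s) / (s - 1)\<^sup>2"
      by (rule DERIV_imp_deriv)
    moreover have "zeta s = zeta_reg s / (s - 1)" using 1 zeta_reg_eq[of s] by simp
    moreover have "d * (y / x) - 1 = d * (((y * d - x) / d\<^sup>2) / (x / d))"
      if "d \<noteq> 0" "x \<noteq> 0" for d x y :: complex
      using that by (simp add: field_simps power2_eq_square)
    ultimately show ?case using 1 by simp
  qed
  with lim show ?thesis by (rule Lim_transform_eventually)
qed

text \<open>Multiplied by \<open>\<sigma> - 1\<close> and taken to the limit at \<open>1\<close>,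
  \<open>zeta_341\<close> becomes \<open>0 \<le> 3 - 4 * m - m'\<close>, where \<open>m\<close> and
  \<open>m'\<close> are the orders of vanishing at \<open>Complex 1 t\<close> and
  \<open>Complex 1 (2 * t)\<close>. A zero at \<open>Complex 1 t\<close> means
  \<open>m \<ge> 1\<close>.\<close>

lemma zeta_nonzero_Re_1:
  assumes "Re s = 1" "s \<noteq> 1"
  shows "zeta s \<noteq> 0"
proof
  assume zero: "zeta s = 0"
  define t where "t = Im s"
  have s: "s = Complex 1 t" using assms by (simp add: t_def complex_eq_iff)
  have t: "t \<noteq> 0" using assms s by (auto simp: complex_eq_iff)
  have conn: "connected (- {1 :: complex})" by (intro connected_punctured_universe) simp
  have ne: "Complex 1 t \<in> - {1}" "Complex 1 (2 * t) \<in> - {1}" "(2 :: complex) \<in> - {1}" "zeta 2 \<noteq> 0"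
    using t zeta_nonzero[of 2] by (auto simp: complex_eq_iff)
  obtain m :: nat where
    m: "((\<lambda>w. (w - Complex 1 t) * (deriv zeta w / zeta w)) \<longlongrightarrow> of_nat m) (at (Complex 1 t))"
       "m \<ge> 1"
    using logderiv_tendsto[OF zeta_holomorphic _ conn ne(1,3,4)] zero s by auto
  obtain m' :: nat where
    m': "((\<lambda>w. (w - Complex 1 (2*t)) * (deriv zeta w / zeta w)) \<longlongrightarrow> of_nat m') (at (Complex 1 (2*t)))"
    using logderiv_tendsto[OF zeta_holomorphic _ conn ne(2,3,4)] by auto
  \<comment> \<open>The sign is opposite to that of \<open>D\<close> in \<open>zeta_341\<close>;
    hence the outer minus signs below.\<close>
  define D where "D = (\<lambda>s. deriv zeta s / zeta s)"
  have line: "((\<lambda>\<sigma>. of_real (\<sigma> - 1) * D (Complex \<sigma> u)) \<longlongrightarrow> l) (at_right 1)"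
    if "((\<lambda>w. (w - Complex 1 u) * (deriv zeta w / zeta w)) \<longlongrightarrow> l) (at (Complex 1 u))" for u l
  proof -
    have "filterlim (\<lambda>\<sigma>. Complex \<sigma> u) (at (Complex 1 u)) (at_right 1)"
      unfolding filterlim_at
    proof
      show "\<forall>\<^sub>F x in at_right 1. Complex x u \<in> UNIV \<and> Complex x u \<noteq> Complex 1 u"
        using eventually_at_right_less[of 1] by eventually_elim auto
      show "((\<lambda>\<sigma>. Complex \<sigma> u) \<longlongrightarrow> Complex 1 u) (at_right 1)"
        by (intro tendsto_intros)
    qed
    from filterlim_compose[OF that this]
    have "((\<lambda>\<sigma>. (Complex \<sigma> u - Complex 1 u) * D (Complex \<sigma> u)) \<longlongrightarrow> l) (at_right 1)"
      by (simp add: D_def)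
    moreover have "Complex \<sigma> u - Complex 1 u = of_real (\<sigma> - 1)" for \<sigma> by (simp add: complex_eq_iff)
    ultimately show ?thesis by simp
  qed
  have "((\<lambda>\<sigma>. - Re (3 * (of_real (\<sigma> - 1) * D (Complex \<sigma> 0)) + 4 * (of_real (\<sigma> - 1) * D (Complex \<sigma> t))
      + of_real (\<sigma> - 1) * D (Complex \<sigma> (2 * t)))) \<longlongrightarrow> - Re (3 * (- 1) + 4 * of_nat m + of_nat m')) (at_right 1)"
    using zeta_logderiv_at_1
    by (intro tendsto_intros line m m') (simp add: complex_eq_iff flip: complex_of_real_def one_complex.code)
  moreover have "eventually (\<lambda>\<sigma>. - Re (3 * (of_real (\<sigma> - 1) * D (Complex \<sigma> 0)) + 4 * (of_real (\<sigma> - 1) * D (Complex \<sigma> t))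
      + of_real (\<sigma> - 1) * D (Complex \<sigma> (2 * t))) \<ge> 0) (at_right 1)"
    using eventually_at_right_less[of 1]
  proof eventually_elim
    case (elim \<sigma>)
    have "0 \<le> (\<sigma> - 1) * Re (3 * (- D (of_real \<sigma>)) + 4 * (- D (Complex \<sigma> t)) + (- D (Complex \<sigma> (2 * t))))"
      using zeta_341[OF elim, of t] elim by (intro mult_nonneg_nonneg) (auto simp: D_def)
    thus ?case by (simp add: algebra_simps complex_of_real_def)
  qed
  ultimately have "0 \<le> - Re (3 * (- 1) + 4 * of_nat m + of_nat m')"
    by (intro tendsto_lowerbound) auto
  thus False using m(2) by simp
qed

section \<open>Growth of the reciprocal under the Riemann Hypothesis\<close>

lemma zeta_nonzero_RH:
  assumes "riemann_hypothesis" "Re s > 1 / 2" "s \<noteq> 1"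
  shows "zeta s \<noteq> 0"
proof
  assume "zeta s = 0"
  moreover have "Re s \<noteq> 1" using zeta_nonzero_Re_1[of s] assms calculation by blast
  moreover have "\<not> Re s > 1" using zeta_nonzero[of s] calculation by blast
  ultimately show False using assms unfolding riemann_hypothesis_def by force
qed

lemma norm_dser_le:
  assumes "has_dser f F" "\<And>n. norm (f n) \<le> 1" "Re s \<ge> \<sigma>" "\<sigma> > 1"
  shows "norm (F s) \<le> (\<Sum>n. real n powr (- \<sigma>))"
proof -
  have "F s = (\<Sum>n. f n / of_nat n powr s)"
    using dser_sums[OF assms(1), of s] assms by (simp add: sums_iff)
  also have "norm \<dots> \<le> (\<Sum>n. real n powr (- \<sigma>))"
  proof (rule norm_suminf_le)
    show "summable (\<lambda>n. real n powr (- \<sigma>))" using assms by (simp add: summable_real_powr_iff)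
    fix n :: nat
    show "norm (f n / of_nat n powr s) \<le> real n powr (- \<sigma>)"
    proof (cases "n = 0")
      case False
      have "norm (f n / of_nat n powr s) \<le> 1 * real n powr (- Re s)"
        using mult_right_mono[OF assms(2)[of n], of "inverse (real n powr Re s)"]
        by (simp add: norm_mult norm_inverse norm_of_nat_powr powr_minus divide_inverse)
      also have "\<dots> \<le> real n powr (- \<sigma>)"
        using False assms by (simp, intro powr_mono) auto
      finally show ?thesis .
    qed auto
  qed
  finally show ?thesis .
qed

text \<open>The coefficients of \<open>zeta\<close> and of its reciprocal both have modulus at most
  \<open>1\<close>, so one majorant serves for both.\<close>

lemma zeta_bounded:
  assumes "\<sigma> > 1"
  obtains M where "M \<ge> 1" "\<And>s. Re s \<ge> \<sigma> \<Longrightarrow> norm (zeta s) \<le> M" "\<And>s. Re s \<ge> \<sigma> \<Longrightarrow> norm (1 / zeta s) \<le> M"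
proof (rule that[of "max 1 (\<Sum>n. real n powr (- \<sigma>))"])
  have moebius: "norm (moebius n) \<le> 1" for n by (auto simp: moebius_def norm_power)
  show "norm (zeta s) \<le> max 1 (\<Sum>n. real n powr (- \<sigma>))" if "Re s \<ge> \<sigma>" for s
    using norm_dser_le[OF dser_zeta _ that assms] by simp
  show "norm (1 / zeta s) \<le> max 1 (\<Sum>n. real n powr (- \<sigma>))" if "Re s \<ge> \<sigma>" for s
    using norm_dser_le[OF dser_inverse_zeta moebius that assms] by simp
qed simp

text \<open>
  Vertical translates of \<open>zeta\<close>, raised to the power \<open>1 / ln T\<close>, form a normal family on
  \<open>Re s > 1 / 2\<close>. Since \<open>zeta\<close> is bounded above and below on every half-plane inside
  \<open>Re s > 1\<close>, every limit function has modulus \<open>1\<close> there, hence everywhere.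
\<close>
lemma inverse_zeta_growth:
  assumes RH: "riemann_hypothesis" and "\<delta> > 0" "\<epsilon> > 0"
  shows "\<exists>T0. \<forall>s. Re s \<ge> 1 / 2 + \<delta> \<and> \<bar>Im s\<bar> \<ge> T0 \<longrightarrow> norm (1 / zeta s) \<le> \<bar>Im s\<bar> powr \<epsilon>"
proof (rule ccontr)
  assume contra: "\<not> ?thesis"
  have "(2 :: real) > 1" by simp
  from zeta_bounded[OF this] obtain M2 where M2: "M2 \<ge> 1"
    "\<And>s. Re s \<ge> 2 \<Longrightarrow> norm (1 / zeta s) \<le> M2" by metis
  \<comment> \<open>Above height \<open>K\<close> the bound \<open>M2\<close> on
    \<open>Re s \<ge> 2\<close> is already good enough, so counterexamples must have
    \<open>Re s < 2\<close>.\<close>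
  define K where "K = M2 powr (1 / \<epsilon>)"
  have K: "K \<ge> 0" "K powr \<epsilon> = M2"
    using M2 \<open>\<epsilon> > 0\<close> by (auto simp: K_def powr_powr)
  \<comment> \<open>Counterexamples at heights tending to infinity; the \<open>3\<close> keeps their
    translates away from the pole and makes \<open>ln T \<ge> 1\<close>.\<close>
  have "\<forall>n::nat. \<exists>s. Re s \<ge> 1 / 2 + \<delta> \<and> \<bar>Im s\<bar> \<ge> real n + 3 + K \<and> norm (1 / zeta s) > \<bar>Im s\<bar> powr \<epsilon>"
  proof
    fix n :: nat
    have "\<not> (\<forall>s. Re s \<ge> 1 / 2 + \<delta> \<and> \<bar>Im s\<bar> \<ge> real n + 3 + K \<longrightarrow> norm (1 / zeta s) \<le> \<bar>Im s\<bar> powr \<epsilon>)"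
      using contra by blast
    thus "\<exists>s. Re s \<ge> 1 / 2 + \<delta> \<and> \<bar>Im s\<bar> \<ge> real n + 3 + K \<and> norm (1 / zeta s) > \<bar>Im s\<bar> powr \<epsilon>"
      by (simp only: not_all not_imp not_le conj_assoc)
  qed
  then obtain s where s: "\<And>n. Re (s n) \<ge> 1 / 2 + \<delta>" "\<And>n::nat. \<bar>Im (s n)\<bar> \<ge> real n + 3 + K"
      "\<And>n. norm (1 / zeta (s n)) > \<bar>Im (s n)\<bar> powr \<epsilon>" by metis
  have s2: "Re (s n) < 2" for n
  proof (rule ccontr)
    assume "\<not> Re (s n) < 2"
    hence "norm (1 / zeta (s n)) \<le> M2" by (intro M2) auto
    also have "M2 \<le> \<bar>Im (s n)\<bar> powr \<epsilon>"
      unfolding K(2)[symmetric] using s(2)[of n] K(1) \<open>\<epsilon> > 0\<close> by (intro powr_mono2) auto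
    finally show False using s(3)[of n] by simp
  qed
  define T where "T = (\<lambda>n. \<bar>Im (s n)\<bar>)"
  define lnT where "lnT = (\<lambda>n. ln (T n))"
  have T3: "T n \<ge> 3" for n using s(2)[of n] K(1) by (simp add: T_def)
  have lnT1: "lnT n \<ge> 1" for n
  proof -
    have "exp 1 \<le> (3::real)" by (rule exp_le)
    hence "1 \<le> ln (3::real)" by (simp add: ln_ge_iff)
    also have "\<dots> \<le> lnT n" unfolding lnT_def using T3[of n] by (intro ln_mono) auto
    finally show ?thesis .
  qed
  \<comment> \<open>Convexity provides holomorphic logarithms; the box contains a region with
    \<open>Re w > 1\<close>, where the limit can be computed, and reaches down to the critical
    line.\<close>
  define D where "D = box (Complex (1 / 2) (- 1)) (Complex 3 1)"
  have D_iff: "w \<in> D \<longleftrightarrow> 1 / 2 < Re w \<and> Re w < 3 \<and> - 1 < Im w \<and> Im w < 1" for w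
    by (auto simp: D_def in_box_complex_iff)
  have D: "open D" "convex D" "connected D" "2 \<in> D"
    by (auto simp: D_iff) (auto simp: D_def convex_connected)
  define f where "f = (\<lambda>n w. zeta (w + \<i> * of_real (Im (s n))))"
  have ne1: "w + \<i> * of_real (Im (s n)) \<noteq> 1" if "w \<in> D" for n w
    using that T3[of n] by (auto simp: D_iff complex_eq_iff T_def)
  have "\<exists>L. L holomorphic_on D \<and> (\<forall>w\<in>D. exp (L w) = f n w)" for n
  proof -
    have "(zeta \<circ> (\<lambda>w. w + \<i> * of_real (Im (s n)))) holomorphic_on D"
      using ne1 by (intro holomorphic_on_compose_gen[OF _ zeta_holomorphic] holomorphic_intros) auto
    hence "f n holomorphic_on D" by (simp add: f_def o_def)
    moreover have "f n w \<noteq> 0" if "w \<in> D" for w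
      unfolding f_def using ne1 that by (intro zeta_nonzero_RH RH) (auto simp: D_iff)
    ultimately show ?thesis using holomorphic_logarithm_exists[OF D(2,1) _ _ D(4)] by metis
  qed
  then obtain L where L: "\<And>n. L n holomorphic_on D" "\<And>n w. w \<in> D \<Longrightarrow> exp (L n w) = f n w"
    by metis
  \<comment> \<open>A branch of \<open>f n\<close> to the power \<open>1 / ln T\<close>: polynomial
    growth in \<open>T\<close> becomes a uniform bound, and bounds independent of \<open>T\<close>
    tend to \<open>1\<close>.\<close>
  define h where "h = (\<lambda>n w. exp (L n w / of_real (lnT n)))"
  have norm_h: "norm (h n w) = exp (ln (norm (f n w)) / lnT n)" and norm_f: "norm (f n w) > 0"
    if "w \<in> D" for n w
  proof -
    have "norm (f n w) = exp (Re (L n w))" using L(2)[OF that, of n] by (metis norm_exp_eq_Re)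
    thus "norm (h n w) = exp (ln (norm (f n w)) / lnT n)" "norm (f n w) > 0" by (simp_all add: h_def)
  qed
  have h_hol: "h n holomorphic_on D" for n
    unfolding h_def using lnT1[of n] by (intro holomorphic_intros L) auto
  obtain C where C: "C > 0" "\<And>s. Re s \<ge> 1 / 2 \<Longrightarrow> norm s \<ge> 2 \<Longrightarrow> norm (zeta s) \<le> C * norm s powr (1 - (1 / 2) / 4)"
    using zeta_growth[of "1 / 2"] by auto
  define C' where "C' = 3 * max C 1"
  have h_bdd: "norm (h n w) \<le> exp (ln C' + 1)" if w: "w \<in> D" for n w
  proof -
    let ?z = "w + \<i> * of_real (Im (s n))"
    have "T n - 1 \<le> \<bar>Im ?z\<bar>" using w by (auto simp: D_iff T_def)
    hence z: "norm ?z \<ge> 2" using abs_Im_le_cmod[of ?z] T3[of n] by linarith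
    have "norm ?z \<le> \<bar>Re ?z\<bar> + \<bar>Im ?z\<bar>" by (rule cmod_le)
    also have "\<dots> \<le> 3 * T n" using w T3[of n] by (auto simp: D_iff T_def)
    finally have z3: "norm ?z \<le> 3 * T n" .
    have "norm (f n w) \<le> C * norm ?z powr (1 - (1 / 2) / 4)"
      unfolding f_def using w z by (intro C) (auto simp: D_iff)
    also have "\<dots> \<le> max C 1 * norm ?z powr 1"
      using z by (intro mult_mono powr_mono) auto
    also have "\<dots> \<le> max C 1 * (3 * T n)"
      using z3 by (intro mult_left_mono) auto
    finally have "norm (f n w) \<le> C' * T n" by (simp add: C'_def mult_ac)
    hence "ln (norm (f n w)) \<le> ln (C' * T n)"
      using norm_f[OF w] by (intro ln_mono) auto
    also have "\<dots> = ln C' + lnT n" using T3[of n] by (simp add: ln_mult C'_def lnT_def)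
    also have "\<dots> \<le> (ln C' + 1) * lnT n"
    proof -
      have "ln C' \<ge> 0" by (simp add: C'_def)
      hence "ln C' * 1 \<le> ln C' * lnT n" using lnT1[of n] by (intro mult_left_mono) auto
      thus ?thesis by (simp add: algebra_simps)
    qed
    finally have "ln (norm (f n w)) / lnT n \<le> ln C' + 1"
      using lnT1[of n] by (simp add: divide_le_eq)
    thus ?thesis unfolding norm_h[OF w] by simp
  qed
  obtain g r where gr: "g holomorphic_on D" "strict_mono (r :: nat \<Rightarrow> nat)"
      "\<And>x. x \<in> D \<Longrightarrow> (\<lambda>n. h (r n) x) \<longlonglongrightarrow> g x"
      "\<And>K. compact K \<Longrightarrow> K \<subseteq> D \<Longrightarrow> uniform_limit K (h \<circ> r) g sequentially"
    using Montel[of D "range h" h] D(1) h_hol h_bdd by (smt (verit) imageE order_refl subset_iff)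
  have lnT_lim: "filterlim lnT at_top sequentially"
  proof -
    have "filterlim (\<lambda>n. ln (real n)) at_top sequentially" by real_asymp
    thus ?thesis
    proof (rule filterlim_at_top_mono)
      have "ln (real n) \<le> lnT n" if "n \<ge> 1" for n
        unfolding lnT_def T_def using s(2)[of n] K(1) that by (intro ln_mono) auto
      thus "\<forall>\<^sub>F n in sequentially. ln (real n) \<le> lnT n"
        by (intro eventually_sequentiallyI[of 1])
    qed
  qed
  have g1: "norm (g w) = 1" if w: "w \<in> D" "Re w > 1" for w
  proof -
    obtain M where M: "M \<ge> 1" "\<And>s. Re s \<ge> Re w \<Longrightarrow> norm (zeta s) \<le> M"
      "\<And>s. Re s \<ge> Re w \<Longrightarrow> norm (1 / zeta s) \<le> M" using zeta_bounded[OF w(2)] by metis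
    have lnf: "\<bar>ln (norm (f n w))\<bar> \<le> ln M" for n
    proof -
      have "norm (f n w) \<le> M" unfolding f_def by (intro M) auto
      moreover have "norm (1 / f n w) \<le> M" unfolding f_def by (intro M) auto
      hence "inverse M \<le> norm (f n w)"
        using norm_f[OF w(1), of n] M(1) by (simp add: norm_divide field_simps)
      ultimately have "ln (norm (f n w)) \<le> ln M" "ln (inverse M) \<le> ln (norm (f n w))"
        using norm_f[OF w(1), of n] M(1) by (intro ln_mono; simp)+
      thus ?thesis using M(1) by (simp add: ln_inverse)
    qed
    have lim0: "(\<lambda>n. ln M / lnT (r n)) \<longlonglongrightarrow> 0"
      using filterlim_compose[OF lnT_lim filterlim_subseq[OF gr(2)]]
      by (rule real_tendsto_divide_at_top[OF tendsto_const])
    have "(\<lambda>n. ln (norm (f (r n) w)) / lnT (r n)) \<longlonglongrightarrow> 0"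
    proof (rule Lim_null_comparison[OF _ lim0], intro always_eventually allI)
      fix n show "norm (ln (norm (f (r n) w)) / lnT (r n)) \<le> ln M / lnT (r n)"
        using lnf[of "r n"] lnT1[of "r n"] by (simp add: divide_right_mono)
    qed
    hence "(\<lambda>n. norm (h (r n) w)) \<longlonglongrightarrow> exp 0"
      unfolding norm_h[OF w(1)] by (rule tendsto_exp)
    moreover have "(\<lambda>n. norm (h (r n) w)) \<longlonglongrightarrow> norm (g w)"
      by (intro tendsto_norm gr w)
    ultimately show ?thesis using LIMSEQ_unique by fastforce
  qed
  \<comment> \<open>The modulus of \<open>g\<close> is \<open>1\<close> throughout the open part
    \<open>Re w > 1\<close>, so it has a local maximum at \<open>2\<close>.\<close>
  have "g constant_on D"
  proof (rule maximum_modulus_principle[where U = "D \<inter> {w. Re w > 1}" and \<xi> = 2])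
    show "norm (g z) \<le> norm (g 2)" if "z \<in> D \<inter> {w. Re w > 1}" for z
      using g1[of z] g1[of 2] that D by simp
  qed (use gr D open_halfspace_Re_gt in auto)
  hence g: "norm (g w) = 1" if "w \<in> D" for w
    using g1[OF D(4)] that D(4) by (auto simp: constant_on_def)
  \<comment> \<open>A compact real segment containing the real parts of all counterexamples.\<close>
  define Q where "Q = cbox (Complex (1 / 2 + \<delta>) 0) (Complex 2 0)"
  have "Q \<subseteq> D" using \<open>\<delta> > 0\<close> by (auto simp: Q_def D_iff in_cbox_complex_iff)
  moreover have "compact Q" by (simp add: Q_def)
  ultimately have "uniform_limit Q (h \<circ> r) g sequentially" by (intro gr)
  \<comment> \<open>A counterexample forces \<open>norm (h m w) < exp (- \<epsilon>)\<close>, so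
    \<open>h m w\<close> lies farther than \<open>1 - exp (- \<epsilon>)\<close> from
    \<open>g w\<close>, which has modulus \<open>1\<close>.\<close>
  moreover have "1 - exp (- \<epsilon>) > 0" using \<open>\<epsilon> > 0\<close> by simp
  ultimately have "\<forall>\<^sub>F n in sequentially. \<forall>x\<in>Q. dist ((h \<circ> r) n x) (g x) < 1 - exp (- \<epsilon>)"
    by (rule uniform_limitD)
  then obtain n where n: "\<And>x. x \<in> Q \<Longrightarrow> dist (h (r n) x) (g x) < 1 - exp (- \<epsilon>)"
    using eventually_happens'[OF sequentially_bot] by fastforce
  define m where "m = r n"
  define w where "w = complex_of_real (Re (s m))"
  have wQ: "w \<in> Q" using s(1)[of m] s2[of m] by (auto simp: w_def Q_def in_cbox_complex_iff)
  hence wD: "w \<in> D" using \<open>Q \<subseteq> D\<close> by blast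
  have "w + \<i> * of_real (Im (s m)) = s m" by (simp add: w_def complex_eq_iff)
  hence "f m w = zeta (s m)" by (simp add: f_def)
  hence "T m powr \<epsilon> < inverse (norm (f m w))"
    using s(3)[of m] by (simp add: T_def norm_divide inverse_eq_divide)
  hence "ln (T m powr \<epsilon>) < ln (inverse (norm (f m w)))"
    using T3[of m] by (intro ln_less_cancel_iff[THEN iffD2]) (auto simp: norm_f[OF wD])
  hence "\<epsilon> * lnT m < - ln (norm (f m w))"
    using T3[of m] norm_f[OF wD, of m] by (simp add: ln_powr ln_inverse lnT_def)
  hence "ln (norm (f m w)) / lnT m < - \<epsilon>" using lnT1[of m] by (simp add: divide_less_eq)
  hence "norm (h m w) < exp (- \<epsilon>)" unfolding norm_h[OF wD] by simp
  moreover have "norm (g w) - norm (h m w) \<le> dist (h m w) (g w)"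
    by (metis dist_norm norm_minus_commute norm_triangle_ineq2)
  ultimately show False using n[OF wQ] g[OF wD] by (simp add: m_def)
qed

section \<open>Perron formula for Riesz means\<close>

lemma closed_segment_horizontal:
  assumes "z \<in> closed_segment (Complex x1 y) (Complex x2 y)" "x1 \<le> x2"
  shows "Im z = y" "Re z \<in> {x1..x2}"
  using assms closed_segment_same_Im[of "Complex x1 y" "Complex x2 y"]
  by (auto simp: closed_segment_eq_real_ivl)

lemma closed_segment_vertical:
  assumes "z \<in> closed_segment (Complex x y1) (Complex x y2)" "y1 \<le> y2"
  shows "Re z = x" "Im z \<in> {y1..y2}"
  using assms closed_segment_same_Re[of "Complex x y1" "Complex x y2"]
  by (auto simp: closed_segment_eq_real_ivl)

lemma contour_integral_rectpath:
  assumes "x1 \<le> x2" "y1 \<le> y2"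
    and f: "continuous_on (path_image (rectpath (Complex x1 y1) (Complex x2 y2))) f"
  defines "I \<equiv> \<lambda>z w. contour_integral (linepath z w) f"
  shows "contour_integral (rectpath (Complex x1 y1) (Complex x2 y2)) f
    = I (Complex x1 y1) (Complex x2 y1) + I (Complex x2 y1) (Complex x2 y2)
      - I (Complex x1 y2) (Complex x2 y2) - I (Complex x1 y1) (Complex x1 y2)"
    and "f contour_integrable_on linepath (Complex x1 y1) (Complex x2 y1)"
    and "f contour_integrable_on linepath (Complex x2 y1) (Complex x2 y2)"
    and "f contour_integrable_on linepath (Complex x1 y2) (Complex x2 y2)"
    and "f contour_integrable_on linepath (Complex x1 y1) (Complex x1 y2)"
proof -
  have "path_image (rectpath (Complex x1 y1) (Complex x2 y2)) =
      closed_segment (Complex x1 y1) (Complex x2 y1) \<union> closed_segment (Complex x2 y1) (Complex x2 y2)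
      \<union> closed_segment (Complex x1 y2) (Complex x2 y2) \<union> closed_segment (Complex x1 y1) (Complex x1 y2)"
    by (auto simp: rectpath_def Let_def path_image_join closed_segment_commute)
  hence cont: "continuous_on (closed_segment (Complex x1 y1) (Complex x2 y1)) f"
      "continuous_on (closed_segment (Complex x2 y1) (Complex x2 y2)) f"
      "continuous_on (closed_segment (Complex x1 y2) (Complex x2 y2)) f"
      "continuous_on (closed_segment (Complex x1 y1) (Complex x1 y2)) f"
    using f by (auto intro: continuous_on_subset)
  note int = cont[THEN contour_integrable_continuous_linepath]
  from int show "f contour_integrable_on linepath (Complex x1 y1) (Complex x2 y1)"
    "f contour_integrable_on linepath (Complex x2 y1) (Complex x2 y2)"
    "f contour_integrable_on linepath (Complex x1 y2) (Complex x2 y2)"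
    "f contour_integrable_on linepath (Complex x1 y1) (Complex x1 y2)" .
  have int': "f contour_integrable_on linepath (Complex x2 y2) (Complex x1 y2)"
      "f contour_integrable_on linepath (Complex x1 y2) (Complex x1 y1)"
    using cont by (auto intro!: contour_integrable_continuous_linepath simp: closed_segment_commute)
  show "contour_integral (rectpath (Complex x1 y1) (Complex x2 y2)) f
    = I (Complex x1 y1) (Complex x2 y1) + I (Complex x2 y1) (Complex x2 y2)
      - I (Complex x1 y2) (Complex x2 y2) - I (Complex x1 y1) (Complex x1 y2)"
    using int int' contour_integral_reverse_linepath[OF cont(3)] contour_integral_reverse_linepath[OF cont(4)]
    by (simp add: rectpath_def Let_def I_def)
qed

text \<open>By partial fractions the integrand is a difference of two with one simple pole each,
  divided by \<open>p - q\<close>; Cauchy's formula handles both.\<close>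

lemma Cauchy_two_poles_rectpath:
  assumes "g holomorphic_on S" "convex S" "open S" "cbox a b \<subseteq> S" "p \<in> box a b" "q \<in> box a b" "p \<noteq> q"
  shows "((\<lambda>s. g s / ((s - p) * (s - q))) has_contour_integral 2 * pi * \<i> * ((g p - g q) / (p - q))) (rectpath a b)"
proof -
  have le: "Re a \<le> Re b" "Im a \<le> Im b" using assms(5) by (auto simp: in_box_complex_iff)
  have img: "path_image (rectpath a b) \<subseteq> S - {p}" "path_image (rectpath a b) \<subseteq> S - {q}"
    using assms path_image_rectpath_cbox_minus_box[OF le] by auto
  have pq: "p \<in> interior S" "q \<in> interior S"
    using assms box_subset_cbox[of a b] by (auto simp: interior_open)
  have "((\<lambda>w. g w / (w - p)) has_contour_integral 2 * pi * \<i> * winding_number (rectpath a b) p * g p) (rectpath a b)"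
    using assms img pq by (intro Cauchy_integral_formula_convex_simple[of S]) auto
  moreover have "((\<lambda>w. g w / (w - q)) has_contour_integral 2 * pi * \<i> * winding_number (rectpath a b) q * g q) (rectpath a b)"
    using assms img pq by (intro Cauchy_integral_formula_convex_simple[of S]) auto
  ultimately have "((\<lambda>w. (g w / (w - p) - g w / (w - q)) / (p - q)) has_contour_integral
      (2 * pi * \<i> * winding_number (rectpath a b) p * g p - 2 * pi * \<i> * winding_number (rectpath a b) q * g q) / (p - q))
      (rectpath a b)"
    by (intro has_contour_integral_div has_contour_integral_diff)
  also have "(2 * pi * \<i> * winding_number (rectpath a b) p * g p - 2 * pi * \<i> * winding_number (rectpath a b) q * g q) / (p - q)
      = 2 * pi * \<i> * ((g p - g q) / (p - q))"
    using assms by (simp add: winding_number_rectpath right_diff_distrib diff_divide_distrib)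
  finally show ?thesis
  proof (rule has_contour_integral_eq)
    fix w assume "w \<in> path_image (rectpath a b)"
    hence "w \<noteq> p" "w \<noteq> q" using img by auto
    thus "(g w / (w - p) - g w / (w - q)) / (p - q) = g w / ((w - p) * (w - q))"
      using \<open>p \<noteq> q\<close> by (simp add: divide_simps) (simp add: algebra_simps)
  qed
qed

text \<open>The residues are \<open>1\<close> at \<open>\<beta>\<close> and
  \<open>- (X powr (- \<beta>))\<close> at \<open>0\<close>. The kernel fits Dirichlet series
  because \<open>n powr (- \<beta>) * riesz_kernel \<beta> (z / n) s = riesz_kernel \<beta> z s / n
  powr s\<close>.\<close>

definition riesz_kernel :: "real \<Rightarrow> real \<Rightarrow> complex \<Rightarrow> complex" where
  "riesz_kernel \<beta> X s = of_real X powr (s - of_real \<beta>) * of_real \<beta> / (s * (s - of_real \<beta>))"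

lemma norm_riesz_kernel:
  assumes "X > 0" "\<beta> > 0"
  shows "norm (riesz_kernel \<beta> X s) = X powr (Re s - \<beta>) * \<beta> / (norm s * norm (s - of_real \<beta>))"
  using assms by (simp add: riesz_kernel_def norm_mult norm_divide norm_powr_real_powr)

text \<open>
  The vertical line is closed to a large rectangle on the side where \<open>X powr s\<close> is small: to the
  left, past the poles \<open>0\<close> and \<open>\<beta>\<close>, if \<open>X \<ge> 1\<close>, and to the right otherwise.
\<close>
lemma riesz_kernel_integral:
  assumes X: "X > 0" and \<beta>: "0 < \<beta>" "\<beta> \<le> 1" and T: "T \<ge> 6"
  shows "norm (contour_integral (linepath (Complex 2 (- T)) (Complex 2 T)) (riesz_kernel \<beta> X)
           - 2 * pi * \<i> * of_real (if X \<ge> 1 then 1 - X powr (- \<beta>) else 0))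
         \<le> 16 * \<beta> * X powr (2 - \<beta>) / T"
proof -
  let ?K = "riesz_kernel \<beta> X"
  \<comment> \<open>On the three far sides both factors of the denominator are at least
    \<open>T / 2\<close>, and these sides have total length \<open>4 * T\<close>.
    \<open>T \<ge> 6\<close> ensures \<open>T - 2 \<ge> T / 2 + 1\<close> for the side at
    \<open>Re s = 2 - T\<close>; the extra \<open>1\<close> absorbs \<open>\<beta>\<close>.\<close>
  define B where "B = 4 * \<beta> * X powr (2 - \<beta>) / T\<^sup>2"
  have B0: "B \<ge> 0" using \<beta> T by (simp add: B_def)
  have B4: "16 * \<beta> * X powr (2 - \<beta>) / T = B * (4 * T)"
    using T by (simp add: B_def power2_eq_square)
  have bound: "norm (?K s) \<le> B"
    if "X powr (Re s - \<beta>) \<le> X powr (2 - \<beta>)" "\<bar>Im s\<bar> \<ge> T \<or> \<bar>Re s\<bar> \<ge> T / 2 + 1" for s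
  proof -
    have "norm s \<ge> T / 2"
      using that(2) abs_Re_le_cmod[of s] abs_Im_le_cmod[of s] T by linarith
    moreover have "norm (s - of_real \<beta>) \<ge> T / 2"
      using that(2) abs_Re_le_cmod[of "s - of_real \<beta>"] abs_Im_le_cmod[of "s - of_real \<beta>"] T \<beta>
      by simp linarith
    ultimately have "(T / 2) * (T / 2) \<le> norm s * norm (s - of_real \<beta>)"
      using T by (intro mult_mono) auto
    hence "norm (?K s) \<le> X powr (2 - \<beta>) * \<beta> / ((T / 2) * (T / 2))"
      unfolding norm_riesz_kernel[OF X \<beta>(1)] using that(1) \<beta> T
      by (intro frac_le mult_right_mono) auto
    thus ?thesis by (simp add: B_def power2_eq_square mult_ac)
  qed
  have cont: "continuous_on A ?K" if "0 \<notin> A" "of_real \<beta> \<notin> A" for A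
    unfolding riesz_kernel_def using that X
    by (intro continuous_intros) auto
  have bl: "norm (contour_integral (linepath z w) ?K) \<le> B * norm (w - z)"
    if "?K contour_integrable_on linepath z w" "\<And>s. s \<in> closed_segment z w \<Longrightarrow> norm (?K s) \<le> B" for z w
    using that B0 by (intro contour_integral_bound_linepath) auto
  show ?thesis
  proof (cases "X \<ge> 1")
    case True
    let ?a = "Complex (2 - T) (- T)" and ?b = "Complex 2 T"
    let ?R = "rectpath ?a ?b"
    have "((\<lambda>s. of_real X powr (s - of_real \<beta>) / ((s - of_real \<beta>) * (s - 0))) has_contour_integral
            2 * pi * \<i> * ((of_real X powr (of_real \<beta> - of_real \<beta>) - of_real X powr (0 - of_real \<beta>)) / (of_real \<beta> - 0))) ?R"
      using \<beta> T X by (intro Cauchy_two_poles_rectpath[of _ UNIV]) (auto simp: in_box_complex_iff intro!: holomorphic_intros)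
    from has_contour_integral_lmul[OF this, of "of_real \<beta>"]
    have res: "(?K has_contour_integral 2 * pi * \<i> * of_real (1 - X powr (- \<beta>))) ?R"
      using \<beta> X by (simp add: riesz_kernel_def[abs_def] mult_ac powr_of_real flip: of_real_minus)
    have "path_image ?R = cbox ?a ?b - box ?a ?b"
      using T by (intro path_image_rectpath_cbox_minus_box) auto
    hence "continuous_on (path_image ?R) ?K"
      using \<beta> T by (intro cont) (auto simp: in_box_complex_iff)
    note rect = contour_integral_rectpath[OF _ _ this]
    have small: "X powr (Re s - \<beta>) \<le> X powr (2 - \<beta>)" if "Re s \<le> 2" for s
      using that True by (intro powr_mono) auto
    have "norm (contour_integral (linepath (Complex (2 - T) (- T)) (Complex 2 (- T))) ?K) \<le> B * norm (Complex 2 (- T) - Complex (2 - T) (- T))"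
      using T by (intro bl rect bound small disjI1) (auto dest: closed_segment_horizontal)
    moreover have "norm (contour_integral (linepath (Complex (2 - T) T) (Complex 2 T)) ?K) \<le> B * norm (Complex 2 T - Complex (2 - T) T)"
      using T by (intro bl rect bound small disjI1) (auto dest: closed_segment_horizontal)
    moreover have "norm (contour_integral (linepath (Complex (2 - T) (- T)) (Complex (2 - T) T)) ?K) \<le> B * norm (Complex (2 - T) T - Complex (2 - T) (- T))"
      using T by (intro bl rect bound small disjI2) (auto dest: closed_segment_vertical)
    moreover have "norm (Complex 2 (- T) - Complex (2 - T) (- T)) = T" "norm (Complex 2 T - Complex (2 - T) T) = T"
       "norm (Complex (2 - T) T - Complex (2 - T) (- T)) = 2 * T"
      using T by (simp_all add: norm_complex_def real_sqrt_mult)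
    moreover have "contour_integral (linepath (Complex 2 (- T)) (Complex 2 T)) ?K
           - 2 * pi * \<i> * of_real (1 - X powr (- \<beta>))
       = contour_integral (linepath (Complex (2 - T) T) (Complex 2 T)) ?K
         + contour_integral (linepath (Complex (2 - T) (- T)) (Complex (2 - T) T)) ?K
         - contour_integral (linepath (Complex (2 - T) (- T)) (Complex 2 (- T))) ?K"
      using rect(1) contour_integral_unique[OF res] T by (simp add: algebra_simps)
    moreover have "norm (u + v - w) \<le> B * (4 * T)"
      if "norm w \<le> B * T" "norm u \<le> B * T" "norm v \<le> B * (2 * T)" for u v w :: complex
      using that norm_triangle_ineq4[of "u + v" w] norm_triangle_ineq[of u v] by (simp add: algebra_simps)
    ultimately show ?thesis using True unfolding B4 by simp
  next
    case False
    let ?a = "Complex 2 (- T)" and ?b = "Complex (2 + T) T"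
    let ?R = "rectpath ?a ?b"
    have img: "path_image ?R \<subseteq> cbox ?a ?b"
      using T by (intro path_image_rectpath_subset_cbox) auto
    have res: "(?K has_contour_integral 0) ?R"
    proof (rule Cauchy_theorem_convex_simple)
      show "?K holomorphic_on {s. Re s > 1}"
        unfolding riesz_kernel_def using \<beta> X by (intro holomorphic_intros) auto
      show "path_image ?R \<subseteq> {s. 1 < Re s}"
        using img by (auto simp: in_cbox_complex_iff)
    qed (auto simp: convex_halfspace_Re_gt)
    have "continuous_on (path_image ?R) ?K"
      using \<beta> T img by (intro cont) (auto simp: in_cbox_complex_iff)
    note rect = contour_integral_rectpath[OF _ _ this]
    have small: "X powr (Re s - \<beta>) \<le> X powr (2 - \<beta>)" if "Re s \<ge> 2" for s
      using that False X by (intro powr_mono') auto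
    have "norm (contour_integral (linepath (Complex 2 (- T)) (Complex (2 + T) (- T))) ?K) \<le> B * norm (Complex (2 + T) (- T) - Complex 2 (- T))"
      using T by (intro bl rect bound small disjI1) (auto dest: closed_segment_horizontal)
    moreover have "norm (contour_integral (linepath (Complex 2 T) (Complex (2 + T) T)) ?K) \<le> B * norm (Complex (2 + T) T - Complex 2 T)"
      using T by (intro bl rect bound small disjI1) (auto dest: closed_segment_horizontal)
    moreover have "norm (contour_integral (linepath (Complex (2 + T) (- T)) (Complex (2 + T) T)) ?K) \<le> B * norm (Complex (2 + T) T - Complex (2 + T) (- T))"
      using T by (intro bl rect bound small disjI2) (auto dest: closed_segment_vertical)
    moreover have "norm (Complex (2 + T) (- T) - Complex 2 (- T)) = T" "norm (Complex (2 + T) T - Complex 2 T) = T"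
       "norm (Complex (2 + T) T - Complex (2 + T) (- T)) = 2 * T"
      using T by (simp_all add: norm_complex_def real_sqrt_mult)
    moreover have "contour_integral (linepath (Complex 2 (- T)) (Complex 2 T)) ?K
       = contour_integral (linepath (Complex 2 (- T)) (Complex (2 + T) (- T))) ?K
         + contour_integral (linepath (Complex (2 + T) (- T)) (Complex (2 + T) T)) ?K
         - contour_integral (linepath (Complex 2 T) (Complex (2 + T) T)) ?K"
      using rect(1) contour_integral_unique[OF res] T by (simp add: algebra_simps)
    moreover have "norm (u + v - w) \<le> B * (4 * T)"
      if "norm w \<le> B * T" "norm u \<le> B * T" "norm v \<le> B * (2 * T)" for u v w :: complex
      using that norm_triangle_ineq4[of "u + v" w] norm_triangle_ineq[of u v] by (simp add: algebra_simps)
    ultimately show ?thesis using False unfolding B4 by simp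
  qed
qed

text \<open>The majorant has the explicit antiderivative \<open>F\<close>, whose increment is at
  most \<open>B / \<eta>\<close> whatever the length \<open>T\<close>; the bound therefore survives
  \<open>T\<close> tending to infinity.\<close>

lemma contour_integral_ray_bound:
  assumes f: "f contour_integrable_on linepath a (a + of_real T * d)"
    and "norm d = 1" "T > 0" "\<eta> > 0" "B \<ge> 0"
    and B: "\<And>t. 0 \<le> t \<Longrightarrow> t \<le> T \<Longrightarrow> norm (f (a + of_real t * d)) \<le> B * (1 + t) powr (- 1 - \<eta>)"
  shows "norm (contour_integral (linepath a (a + of_real T * d)) f) \<le> B / \<eta>"
proof -
  define h where "h = (\<lambda>x::real. f (linepath a (a + of_real T * d) x) * (of_real T * d))"
  define g where "g = (\<lambda>x. B * (1 + T * x) powr (- 1 - \<eta>) * T)"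
  define F where "F = (\<lambda>x. - B / \<eta> * (1 + T * x) powr (- \<eta>))"
  have "(h has_integral contour_integral (linepath a (a + of_real T * d)) f) {0..1}"
    using has_contour_integral_integral[OF f] unfolding has_contour_integral_linepath h_def by simp
  hence h: "h integrable_on {0..1}" "integral {0..1} h = contour_integral (linepath a (a + of_real T * d)) f"
    by (auto simp: has_integral_iff)
  have "(g has_integral F 1 - F 0) {0..1}"
  proof (rule fundamental_theorem_of_calculus)
    fix x :: real assume "x \<in> {0..1}"
    hence pos: "1 + T * x > 0" using \<open>T > 0\<close> by (intro add_pos_nonneg mult_nonneg_nonneg) auto
    have "(F has_real_derivative - B / \<eta> * (- \<eta> * (1 + T * x) powr (- \<eta> - 1) * T)) (at x within {0..1})"
      unfolding F_def using pos by (auto intro!: derivative_eq_intros)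
    also have "- B / \<eta> * (- \<eta> * (1 + T * x) powr (- \<eta> - 1) * T) = g x"
      using \<open>\<eta> > 0\<close> by (simp add: g_def add.commute[of 1 \<eta>] minus_diff_commute)
    finally show "(F has_vector_derivative g x) (at x within {0..1})"
      by (simp add: has_real_derivative_iff_has_vector_derivative)
  qed simp
  hence g: "g integrable_on {0..1}" "integral {0..1} g = F 1 - F 0" by (auto simp: has_integral_iff)
  have "norm (integral {0..1} h) \<le> integral {0..1} g"
  proof (rule integral_norm_bound_integral[OF h(1) g(1)])
    fix x :: real assume x: "x \<in> {0..1}"
    have "linepath a (a + of_real T * d) x = a + of_real (T * x) * d"
      by (simp add: linepath_def scaleR_conv_of_real algebra_simps)
    moreover have "norm (f (a + of_real (T * x) * d)) \<le> B * (1 + T * x) powr (- 1 - \<eta>)"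
      using x \<open>T > 0\<close> by (intro B) (auto intro!: mult_left_le)
    ultimately show "norm (h x) \<le> g x"
      using assms(2,3) by (simp add: h_def g_def norm_mult mult_right_mono)
  qed
  also have "\<dots> \<le> B / \<eta>"
    using assms unfolding g(2) by (simp add: F_def)
  finally show ?thesis using h g by simp
qed

section \<open>Perron integrals of Riesz means\<close>

lemma dser_abs_summable:
  assumes "has_dser u G" "Re s > 1"
  shows "summable (\<lambda>n. norm (u n) * real n powr (- Re s))"
proof -
  have "(\<lambda>n. u n / of_nat n powr s) summable_on UNIV"
    using dserD[OF assms] unfolding has_sum_from_1_iff by (rule has_sum_imp_summable)
  hence "(\<lambda>n. norm (u n / of_nat n powr s)) summable_on UNIV"
    by (simp add: summable_on_iff_abs_summable_on_complex)
  hence "summable (\<lambda>n. norm (u n / of_nat n powr s))" by (rule summable_on_imp_summable)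
  thus ?thesis by (simp add: norm_mult norm_inverse norm_of_nat_powr powr_minus divide_inverse)
qed

lemma of_real_powr_eq_exp:
  assumes "x > 0"
  shows "(of_real x :: complex) powr w = exp (w * of_real (ln x))"
  using assms by (simp add: powr_def Ln_of_real)

text \<open>The summand for \<open>n = z\<close> vanishes, so no half-weight convention is needed
  when \<open>z\<close> is an integer.\<close>

definition riesz_mean :: "(nat \<Rightarrow> complex) \<Rightarrow> real \<Rightarrow> real \<Rightarrow> complex" where
  "riesz_mean u \<beta> z = (\<Sum>n | n \<ge> 1 \<and> real n \<le> z. u n * of_real (real n powr (- \<beta>) - z powr (- \<beta>)))"

lemma finite_nat_le_real: "finite {n. n \<ge> 1 \<and> real n \<le> z}"
  by (rule finite_subset[of _ "{..nat \<lfloor>z\<rfloor>}"]) (auto simp: le_nat_floor)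

text \<open>On \<open>Re s = 2\<close> the Dirichlet series may be integrated term by term. Each
  term is a kernel integral with \<open>X = z / n\<close>, and the truncation errors add up against
  \<open>norm (u n) * n powr (- 2)\<close>.\<close>

lemma riesz_mean_perron:
  assumes u: "has_dser u G" and \<beta>: "0 < \<beta>" "\<beta> \<le> 1" and z: "z \<ge> 1" and T: "T \<ge> 6"
  shows "norm (contour_integral (linepath (Complex 2 (- T)) (Complex 2 T)) (\<lambda>s. G s * riesz_kernel \<beta> z s)
           - 2 * pi * \<i> * riesz_mean u \<beta> z)
         \<le> 16 * \<beta> * z powr (2 - \<beta>) * (\<Sum>n. norm (u n) * real n powr (- 2)) / T"
proof -
  let ?a = "Complex 2 (- T)" and ?b = "Complex 2 T"
  define v where "v = (\<lambda>n. norm (u n) * real n powr (- 2))"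
  define f where "f = (\<lambda>n s. u n / of_nat n powr s * riesz_kernel \<beta> z s)"
  define c where "c = (\<lambda>n. if n \<ge> 1 \<and> real n \<le> z then u n * of_real (real n powr (- \<beta>) - z powr (- \<beta>)) else 0)"
  have v: "summable v" using dser_abs_summable[OF u, of 2] by (simp add: v_def)
  have Re2: "Re s = 2" if "s \<in> closed_segment ?a ?b" for s
    using closed_segment_vertical[OF that] T by simp
  have ne: "s \<noteq> 0" "s \<noteq> of_real \<beta>" "norm s \<ge> 1" "norm (s - of_real \<beta>) \<ge> 1" if "Re s = 2" for s
    using that \<beta> abs_Re_le_cmod[of s] abs_Re_le_cmod[of "s - of_real \<beta>"] by auto
  have cont_K: "continuous_on (closed_segment ?a ?b) (riesz_kernel \<beta> X)" if "X > 0" for X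
    unfolding riesz_kernel_def using that ne Re2 by (intro continuous_intros) auto
  have f_eq: "f n s = u n * of_real (real n powr (- \<beta>)) * riesz_kernel \<beta> (z / real n) s" if "n \<ge> 1" for n s
  proof -
    have E: "of_real (real n powr (- \<beta>)) * of_real (z / real n) powr (s - of_real \<beta>)
        = (of_real z powr (s - of_real \<beta>) / of_nat n powr s :: complex)"
    proof -
      have ln: "ln (z / real n) = ln z - ln (real n)" using that z by (simp add: ln_div)
      have "of_real (z / real n) powr (s - of_real \<beta>) = exp ((s - of_real \<beta>) * (of_real (ln z) - of_real (ln (real n))))"
        using that z by (subst of_real_powr_eq_exp) (simp_all only: ln of_real_diff, simp)
      moreover have "of_real z powr (s - of_real \<beta>) = exp ((s - of_real \<beta>) * of_real (ln z))"
        using z by (intro of_real_powr_eq_exp) simp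
      moreover have "of_nat n powr s = exp (s * of_real (ln (real n)))"
        using of_real_powr_eq_exp[of "real n" s] that by simp
      moreover have "of_real (real n powr (- \<beta>)) = (exp (- of_real \<beta> * of_real (ln (real n))) :: complex)"
        using that of_real_powr_eq_exp[of "real n" "of_real (- \<beta>)"] powr_of_real[of "real n" "- \<beta>"] by simp
      moreover have "- of_real \<beta> * of_real (ln (real n)) + (s - of_real \<beta>) * (of_real (ln z) - of_real (ln (real n)))
          = (s - of_real \<beta>) * of_real (ln z) - s * of_real (ln (real n))"
        by (simp add: algebra_simps)
      ultimately show ?thesis by (simp only: exp_add[symmetric] exp_diff[symmetric])
    qed
    have "f n s = u n * (of_real z powr (s - of_real \<beta>) / of_nat n powr s) * (of_real \<beta> / (s * (s - of_real \<beta>)))"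
      by (simp add: f_def riesz_kernel_def)
    also have "\<dots> = u n * of_real (real n powr (- \<beta>)) * riesz_kernel \<beta> (z / real n) s"
      unfolding E[symmetric] by (simp add: riesz_kernel_def)
    finally show ?thesis .
  qed
  have f0: "f 0 = (\<lambda>_. 0)" by (simp add: f_def)
  have cont_f: "continuous_on (closed_segment ?a ?b) (f n)" for n
  proof (cases "n = 0")
    case False
    hence "f n = (\<lambda>s. u n * of_real (real n powr (- \<beta>)) * riesz_kernel \<beta> (z / real n) s)"
      by (intro ext f_eq) simp
    thus ?thesis using False z by (auto intro!: continuous_intros cont_K)
  qed (simp add: f0)
  have "uniform_limit (closed_segment ?a ?b) (\<lambda>N s. \<Sum>n<N. f n s) (\<lambda>s. \<Sum>n. f n s) sequentially"
  proof (rule Weierstrass_m_test)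
    show "summable (\<lambda>n. v n * (z powr (2 - \<beta>) * \<beta>))" by (intro summable_mult2 v)
    fix n s assume s: "s \<in> closed_segment ?a ?b"
    have "1 * 1 \<le> norm s * norm (s - of_real \<beta>)"
      using ne[OF Re2[OF s]] by (intro mult_mono) auto
    moreover have "z > 0" using z by simp
    ultimately have "norm (riesz_kernel \<beta> z s) \<le> z powr (2 - \<beta>) * \<beta> / (1 * 1)"
      unfolding norm_riesz_kernel[OF \<open>z > 0\<close> \<beta>(1)] Re2[OF s]
      using \<beta> by (intro divide_left_mono mult_nonneg_nonneg) auto
    hence "v n * norm (riesz_kernel \<beta> z s) \<le> v n * (z powr (2 - \<beta>) * \<beta>)"
      by (intro mult_left_mono) (auto simp: v_def)
    thus "norm (f n s) \<le> v n * (z powr (2 - \<beta>) * \<beta>)"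
      by (simp add: f_def v_def norm_mult norm_inverse norm_of_nat_powr Re2[OF s] powr_minus divide_inverse)
  qed
  from contour_integral_sums_linepath[OF this cont_f] obtain J where J:
    "((\<lambda>s. \<Sum>n. f n s) has_contour_integral J) (linepath ?a ?b)"
    "(\<lambda>n. contour_integral (linepath ?a ?b) (f n)) sums J" .
  have "((\<lambda>s. G s * riesz_kernel \<beta> z s) has_contour_integral J) (linepath ?a ?b)"
  proof (rule has_contour_integral_eq[OF J(1)])
    fix s assume "s \<in> path_image (linepath ?a ?b)"
    hence "Re s > 1" using Re2[of s] by simp
    from sums_mult2[OF dser_sums[OF u this], of "riesz_kernel \<beta> z s"]
    show "(\<Sum>n. f n s) = G s * riesz_kernel \<beta> z s" by (simp add: f_def sums_iff)
  qed
  hence J_eq: "contour_integral (linepath ?a ?b) (\<lambda>s. G s * riesz_kernel \<beta> z s) = J"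
    by (rule contour_integral_unique)
  have err: "norm (contour_integral (linepath ?a ?b) (f n) - 2 * pi * \<i> * c n)
      \<le> 16 * \<beta> * z powr (2 - \<beta>) / T * v n" for n
  proof (cases "n = 0")
    case False
    hence n: "n \<ge> 1" by simp
    define \<gamma> where "\<gamma> = u n * of_real (real n powr (- \<beta>))"
    define k where "k = (if z / real n \<ge> 1 then 1 - (z / real n) powr (- \<beta>) else 0)"
    let ?I = "contour_integral (linepath ?a ?b) (riesz_kernel \<beta> (z / real n))"
    have "riesz_kernel \<beta> (z / real n) contour_integrable_on linepath ?a ?b"
      using z n by (intro contour_integrable_continuous_linepath cont_K) auto
    hence int: "contour_integral (linepath ?a ?b) (f n) = \<gamma> * ?I"
      unfolding \<gamma>_def f_eq[OF n, abs_def] by (rule contour_integral_lmul)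
    have "real n powr (- \<beta>) * k = (if real n \<le> z then real n powr (- \<beta>) - z powr (- \<beta>) else 0)"
      using n z by (simp add: k_def powr_divide right_diff_distrib)
    moreover have "\<gamma> * of_real k = u n * of_real (real n powr (- \<beta>) * k)"
      by (simp add: \<gamma>_def)
    ultimately have "c n = \<gamma> * of_real k"
      using n by (simp add: c_def)
    hence "contour_integral (linepath ?a ?b) (f n) - 2 * pi * \<i> * c n = \<gamma> * (?I - 2 * pi * \<i> * of_real k)"
      by (simp add: int algebra_simps)
    also have "norm \<dots> \<le> norm \<gamma> * (16 * \<beta> * (z / real n) powr (2 - \<beta>) / T)"
      unfolding norm_mult k_def using z n \<beta> T by (intro mult_left_mono riesz_kernel_integral) auto
    also have "\<dots> = 16 * \<beta> * z powr (2 - \<beta>) / T * (norm (u n) * (real n powr (- \<beta>) / real n powr (2 - \<beta>)))"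
      using z n by (simp add: \<gamma>_def norm_mult powr_divide mult_ac)
    \<comment> \<open>The parameter \<open>\<beta>\<close> drops out, leaving exactly the absolutely
      convergent series at \<open>2\<close>.\<close>
    also have "real n powr (- \<beta>) / real n powr (2 - \<beta>) = real n powr (- 2)"
      by (simp flip: powr_diff)
    finally show ?thesis by (simp add: v_def)
  qed (simp add: f0 c_def v_def)
  have "c sums (\<Sum>n | n \<ge> 1 \<and> real n \<le> z. u n * of_real (real n powr (- \<beta>) - z powr (- \<beta>)))"
    unfolding c_def using finite_nat_le_real by (rule sums_If_finite)
  hence "c sums riesz_mean u \<beta> z" by (simp add: riesz_mean_def)
  hence "(\<lambda>n. contour_integral (linepath ?a ?b) (f n) - 2 * pi * \<i> * c n) sums (J - 2 * pi * \<i> * riesz_mean u \<beta> z)"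
    by (intro sums_diff sums_mult J)
  hence "norm (J - 2 * pi * \<i> * riesz_mean u \<beta> z) = norm (\<Sum>n. contour_integral (linepath ?a ?b) (f n) - 2 * pi * \<i> * c n)"
    by (simp add: sums_iff)
  also have "\<dots> \<le> (\<Sum>n. 16 * \<beta> * z powr (2 - \<beta>) / T * v n)"
    by (intro norm_suminf_le err summable_mult v)
  also have "\<dots> = 16 * \<beta> * z powr (2 - \<beta>) / T * (\<Sum>n. v n)"
    by (intro suminf_mult v)
  finally show ?thesis unfolding J_eq by (simp add: v_def)
qed

text \<open>Shift the line from \<open>2\<close> to \<open>\<sigma>0\<close>. Since
  \<open>\<Psi>\<close> is \<open>G\<close> freed of its pole, the integrand is holomorphic up to
  the factors \<open>s - p\<close> and \<open>s - \<beta>\<close>, whose residues form the main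
  term; the pole of the kernel at \<open>0\<close> is not reached. The gap between
  \<open>\<sigma>1\<close> and \<open>\<sigma>0\<close> leaves an open neighbourhood of the
  contour.\<close>

lemma riesz_mean_asymp:
  assumes u: "has_dser u G"
    and \<sigma>: "0 < \<sigma>1" "\<sigma>1 < \<sigma>0" "\<sigma>0 < \<beta>" "\<beta> < p" "p \<le> 1"
    and \<Psi>: "\<Psi> holomorphic_on {s. Re s > \<sigma>1}"
    and G: "\<And>s. Re s > \<sigma>1 \<Longrightarrow> s \<noteq> of_real p \<Longrightarrow> G s = \<Psi> s / (s - of_real p)"
    and growth: "\<And>s. \<sigma>0 \<le> Re s \<Longrightarrow> Re s \<le> 2 \<Longrightarrow> \<bar>Im s\<bar> \<ge> T0 \<Longrightarrow> norm (G s) \<le> C * norm s powr (1 - \<eta>)"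
    and \<eta>: "0 < \<eta>" "\<eta> \<le> 1" and C: "C \<ge> 0"
  shows "\<exists>C'. \<forall>z\<ge>1. norm (riesz_mean u \<beta> z
      - (\<Psi> (of_real p) * of_real (z powr (p - \<beta>) * \<beta> / (p * (p - \<beta>))) + G (of_real \<beta>))) \<le> C' * z powr (\<sigma>0 - \<beta>)"
proof -
  define H where "H = {s. Re s > \<sigma>1}"
  have H: "open H" "convex H" by (simp_all add: H_def open_halfspace_Re_gt convex_halfspace_Re_gt)
  define T1 where "T1 = max T0 2"
  define w where "w = (\<lambda>t. (1 + \<bar>t\<bar>) powr (- 1 - \<eta>))"
  \<comment> \<open>The integrand on the new line stripped of
    \<open>z powr (\<sigma>0 - \<beta>) * \<beta>\<close>; bounding it independently of
    \<open>z\<close> makes the final constant uniform.\<close>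
  define h where "h = (\<lambda>t. norm (G (Complex \<sigma>0 t)) / (norm (Complex \<sigma>0 t) * norm (Complex \<sigma>0 t - of_real \<beta>)))"
  have \<beta>: "0 < \<beta>" "\<beta> \<le> 1" using \<sigma> by auto
  have G_hol: "G holomorphic_on H - {of_real p}"
  proof (rule holomorphic_transform)
    show "(\<lambda>s. \<Psi> s / (s - of_real p)) holomorphic_on H - {of_real p}"
      by (intro holomorphic_intros holomorphic_on_subset[OF \<Psi>]) (auto simp: H_def)
  qed (auto simp: H_def G)
  have "\<exists>B. \<forall>t\<in>{- T1..T1}. h t * (1 + \<bar>t\<bar>) powr (1 + \<eta>) \<le> B"
  proof -
    have "continuous_on {- T1..T1} (\<lambda>t. h t * (1 + \<bar>t\<bar>) powr (1 + \<eta>))"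
      unfolding h_def using \<sigma> \<beta>
      by (intro continuous_intros continuous_on_compose2[OF holomorphic_on_imp_continuous_on[OF G_hol]])
         (auto simp: H_def complex_eq_iff)
    hence "bounded ((\<lambda>t. h t * (1 + \<bar>t\<bar>) powr (1 + \<eta>)) ` {- T1..T1})"
      by (intro compact_imp_bounded compact_continuous_image) auto
    then obtain B where "\<forall>t\<in>{- T1..T1}. norm (h t * (1 + \<bar>t\<bar>) powr (1 + \<eta>)) \<le> B"
      unfolding bounded_iff by blast
    thus ?thesis by (intro exI[of _ B]) auto
  qed
  then obtain B1 where B1: "\<And>t. t \<in> {- T1..T1} \<Longrightarrow> h t * (1 + \<bar>t\<bar>) powr (1 + \<eta>) \<le> B1" by blast
  \<comment> \<open>\<open>B1\<close> covers bounded heights by compactness. The \<open>4\<close>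
    bounds \<open>2 powr (1 + \<eta>)\<close>, the loss in replacing \<open>\<bar>t\<bar>\<close> by
    \<open>(1 + \<bar>t\<bar>) / 2\<close>.\<close>
  define B where "B = max (4 * C) B1"
  have B0: "B \<ge> 0" using C by (simp add: B_def)
  have hB: "h t \<le> B * w t" for t
  proof (cases "\<bar>t\<bar> \<le> T1")
    case True
    hence "h t * (1 + \<bar>t\<bar>) powr (1 + \<eta>) * w t \<le> B * w t"
      using B1[of t] True by (intro mult_right_mono) (auto simp: B_def w_def abs_le_iff)
    moreover have "(1 + \<bar>t\<bar>) powr (1 + \<eta>) * w t = 1"
      unfolding w_def by (simp flip: powr_add add: powr_zero_eq_one)
    ultimately show ?thesis by (simp add: mult.assoc)
  next
    case False
    define s where "s = Complex \<sigma>0 t"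
    have t: "\<bar>t\<bar> \<ge> 2" "\<bar>t\<bar> \<ge> T0" using False by (auto simp: T1_def)
    have s: "norm s \<ge> \<bar>t\<bar>" "norm (s - of_real \<beta>) \<ge> \<bar>t\<bar>"
      using abs_Im_le_cmod[of s] abs_Im_le_cmod[of "s - of_real \<beta>"] by (simp_all add: s_def)
    have "norm (G s) \<le> C * norm s powr (1 - \<eta>)"
      using \<sigma> t by (intro growth) (auto simp: s_def)
    hence "h t \<le> C * norm s powr (1 - \<eta>) / (norm s * norm (s - of_real \<beta>))"
      unfolding h_def s_def[symmetric] by (intro divide_right_mono) auto
    also have "\<dots> = C * norm s powr (- \<eta>) / norm (s - of_real \<beta>)"
    proof -
      have "norm s powr (1 - \<eta>) = norm s * norm s powr (- \<eta>)"
        using s t powr_add[of "norm s" 1 "- \<eta>"] by simp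
      thus ?thesis using s t by simp
    qed
    also have "\<dots> \<le> C * \<bar>t\<bar> powr (- \<eta>) / \<bar>t\<bar>"
      using s t C \<eta> by (intro frac_le mult_left_mono powr_mono2') auto
    also have "\<dots> = C * \<bar>t\<bar> powr (- 1 - \<eta>)"
      using t powr_add[of "\<bar>t\<bar>" "- 1" "- \<eta>"] by (simp add: powr_minus divide_inverse)
    also have "\<dots> \<le> C * ((1 + \<bar>t\<bar>) / 2) powr (- 1 - \<eta>)"
      using t C \<eta> by (intro mult_left_mono powr_mono2') auto
    also have "\<dots> = C * (2 powr (1 + \<eta>) * w t)"
    proof -
      have "2 powr (1 + \<eta>) = 1 / 2 powr (- 1 - \<eta>)"
        using powr_minus_divide[of 2 "- 1 - \<eta>"] by (simp add: add.commute)
      thus ?thesis by (simp only: w_def powr_divide times_divide_eq_left mult_1)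
    qed
    also have "\<dots> \<le> C * (2 powr 2 * w t)"
      using C \<eta> by (intro mult_left_mono mult_right_mono powr_mono) (auto simp: w_def)
    also have "\<dots> = (4 * C) * w t" by (simp add: powr_numeral)
    also have "\<dots> \<le> B * w t" by (intro mult_right_mono) (auto simp: B_def w_def)
    finally show ?thesis .
  qed
  define M where "M = (\<lambda>z. \<Psi> (of_real p) * of_real (z powr (p - \<beta>) * \<beta> / (p * (p - \<beta>))) + G (of_real \<beta>))"
  have main: "norm (riesz_mean u \<beta> z - M z) \<le> 2 * \<beta> * B / \<eta> * z powr (\<sigma>0 - \<beta>)" if z: "z \<ge> 1" for z
  proof -
    define P where "P = (\<lambda>s. G s * riesz_kernel \<beta> z s)"
    define \<Phi> where "\<Phi> = (\<lambda>s. \<Psi> s * (of_real z powr (s - of_real \<beta>) * of_real \<beta> / s))"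
    define A where "A = z powr (\<sigma>0 - \<beta>) * \<beta> * B"
    define D where "D = 16 * \<beta> * z powr (2 - \<beta>) * (\<Sum>n. norm (u n) * real n powr (- 2))"
    define E where "E = \<beta> * z powr (2 - \<beta>) * C * 2"
    have A0: "A \<ge> 0" using B0 \<beta> by (simp add: A_def)
    have pb: "of_real p \<noteq> (of_real \<beta> :: complex)" using \<sigma> by simp
    have \<Phi>_hol: "\<Phi> holomorphic_on H"
      unfolding \<Phi>_def H_def using z \<sigma> by (intro holomorphic_intros \<Psi>) auto
    have P_eq: "P s = \<Phi> s / ((s - of_real p) * (s - of_real \<beta>))" if "s \<in> H" "s \<noteq> of_real p" for s
      using that G[of s] by (simp add: P_def \<Phi>_def H_def riesz_kernel_def mult_ac)
    have res_eq: "(\<Phi> (of_real p) - \<Phi> (of_real \<beta>)) / (of_real p - of_real \<beta>) = M z"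
    proof -
      have "\<Phi> (of_real \<beta>) = \<Psi> (of_real \<beta>)" using \<beta> z by (simp add: \<Phi>_def)
      moreover have "\<Phi> (of_real p) = \<Psi> (of_real p) * of_real (z powr (p - \<beta>) * \<beta> / p)"
        using z by (simp add: \<Phi>_def powr_of_real flip: of_real_diff)
      moreover have "G (of_real \<beta>) = - (\<Psi> (of_real \<beta>) / (of_real p - of_real \<beta>))"
        using G[of "of_real \<beta>"] \<sigma> pb by (simp add: minus_divide_right)
      ultimately show ?thesis
        by (simp add: M_def diff_divide_distrib)
    qed
    have bound_T: "norm (2 * pi * \<i> * riesz_mean u \<beta> z - 2 * pi * \<i> * M z) \<le> (D + 2 * E) / T + 2 * (A / \<eta>)"
      if T: "T \<ge> max T1 6" for T
    proof -
      let ?a = "Complex \<sigma>0 (- T)" and ?b = "Complex 2 T"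
      let ?R = "rectpath ?a ?b"
      have T': "T \<ge> 6" "T \<ge> T0" using T by (auto simp: T1_def)
      have img_eq: "path_image ?R = cbox ?a ?b - box ?a ?b"
        using T' \<sigma> by (intro path_image_rectpath_cbox_minus_box) auto
      have box: "cbox ?a ?b \<subseteq> H" using \<sigma> by (auto simp: in_cbox_complex_iff H_def)
      have in_box: "of_real p \<in> box ?a ?b" "of_real \<beta> \<in> box ?a ?b"
        using \<sigma> T' by (auto simp: in_box_complex_iff)
      have "((\<lambda>s. \<Phi> s / ((s - of_real p) * (s - of_real \<beta>))) has_contour_integral
              2 * pi * \<i> * ((\<Phi> (of_real p) - \<Phi> (of_real \<beta>)) / (of_real p - of_real \<beta>))) ?R"
        using \<Phi>_hol H box in_box pb by (intro Cauchy_two_poles_rectpath) auto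
      hence res: "(P has_contour_integral 2 * pi * \<i> * M z) ?R"
        unfolding res_eq
      proof (rule has_contour_integral_eq)
        fix s assume s: "s \<in> path_image ?R"
        hence "s \<in> H" "s \<noteq> of_real p" using box in_box unfolding img_eq by auto
        from P_eq[OF this] show "\<Phi> s / ((s - of_real p) * (s - of_real \<beta>)) = P s" by simp
      qed
      have "continuous_on (H - {of_real p, of_real \<beta>}) P"
        unfolding P_def riesz_kernel_def using z \<sigma>
        by (intro continuous_intros continuous_on_subset[OF holomorphic_on_imp_continuous_on[OF G_hol]])
           (auto simp: H_def)
      moreover have "path_image ?R \<subseteq> H - {of_real p, of_real \<beta>}"
        using box in_box unfolding img_eq by auto
      ultimately have cont: "continuous_on (path_image ?R) P" by (rule continuous_on_subset)
      note rect = contour_integral_rectpath[OF _ _ cont]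
      have normP: "norm (P s) = norm (G s) * (z powr (Re s - \<beta>) * \<beta> / (norm s * norm (s - of_real \<beta>)))" for s
        using z \<beta> by (simp add: P_def norm_mult norm_riesz_kernel)
      have horiz: "norm (P s) \<le> \<beta> * z powr (2 - \<beta>) * C / T"
        if "\<sigma>0 \<le> Re s" "Re s \<le> 2" "\<bar>Im s\<bar> = T" for s
      proof -
        have s: "norm s \<ge> T" "norm (s - of_real \<beta>) \<ge> T"
          using that abs_Im_le_cmod[of s] abs_Im_le_cmod[of "s - of_real \<beta>"] by simp_all
        have "norm (G s) \<le> C * norm s powr (1 - \<eta>)" using that T' by (intro growth) auto
        also have "\<dots> \<le> C * norm s powr 1"
          using s T' C \<eta> by (intro mult_left_mono powr_mono) auto
        finally have "norm (G s) \<le> C * norm s" using s T' by simp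
        moreover have "norm s * T > 0" using s T' by (intro mult_pos_pos) auto
        ultimately have "norm (P s) \<le> (C * norm s) * (z powr (2 - \<beta>) * \<beta> / (norm s * T))"
          unfolding normP using that z \<beta> s T' C
          by (intro mult_mono frac_le mult_right_mono powr_mono mult_left_mono) auto
        also have "\<dots> = \<beta> * z powr (2 - \<beta>) * C / T"
        proof -
          have "s \<noteq> 0" using s T' by auto
          thus ?thesis by simp
        qed
        finally show ?thesis .
      qed
      have horiz_int: "norm (contour_integral (linepath (Complex \<sigma>0 y) (Complex 2 y)) P) \<le> E / T"
        if "P contour_integrable_on linepath (Complex \<sigma>0 y) (Complex 2 y)" "\<bar>y\<bar> = T" for y
      proof -
        have "norm (contour_integral (linepath (Complex \<sigma>0 y) (Complex 2 y)) P)
            \<le> \<beta> * z powr (2 - \<beta>) * C / T * norm (Complex 2 y - Complex \<sigma>0 y)"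
          using that \<beta> C T' \<sigma>
          by (intro contour_integral_bound_linepath horiz) (auto dest: closed_segment_horizontal)
        also have "\<dots> \<le> \<beta> * z powr (2 - \<beta>) * C / T * 2"
          using \<sigma> \<beta> C T' by (intro mult_left_mono) (auto simp: norm_complex_def)
        finally show ?thesis by (simp add: E_def)
      qed
      \<comment> \<open>The left side is cut at the real axis, because the majorant decays in
        \<open>\<bar>t\<bar>\<close> in both directions.\<close>
      have ray: "norm (contour_integral (linepath (Complex \<sigma>0 0) (Complex \<sigma>0 0 + of_real T * d)) P) \<le> A / \<eta>"
        if "d = \<i> \<or> d = - \<i>" for d
      proof (rule contour_integral_ray_bound)
        have pt: "Complex \<sigma>0 0 + of_real t * d = Complex \<sigma>0 (t * Im d)" for t
          using that by (auto simp: complex_eq_iff)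
        have seg: "s \<in> closed_segment (Complex \<sigma>0 0) (Complex \<sigma>0 0 + of_real T * d) \<Longrightarrow> s \<in> path_image ?R" for s
          unfolding pt using that \<sigma> T' 
          by (auto simp: img_eq in_cbox_complex_iff in_box_complex_iff closed_segment_same_Re closed_segment_eq_real_ivl split: if_splits)
        show "P contour_integrable_on linepath (Complex \<sigma>0 0) (Complex \<sigma>0 0 + of_real T * d)"
          by (intro contour_integrable_continuous_linepath continuous_on_subset[OF cont]) (use seg in auto)
        show "norm (P (Complex \<sigma>0 0 + of_real t * d)) \<le> A * (1 + t) powr (- 1 - \<eta>)" if t: "0 \<le> t" "t \<le> T" for t
        proof -
          have "norm (P (Complex \<sigma>0 (t * Im d))) = z powr (\<sigma>0 - \<beta>) * \<beta> * h (t * Im d)"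
            by (simp add: normP h_def)
          also have "\<dots> \<le> z powr (\<sigma>0 - \<beta>) * \<beta> * (B * w (t * Im d))"
            using \<beta> by (intro mult_left_mono hB) auto
          also have "w (t * Im d) = (1 + t) powr (- 1 - \<eta>)"
            using \<open>d = \<i> \<or> d = - \<i>\<close> t by (auto simp: w_def)
          finally show ?thesis unfolding pt by (simp add: A_def mult.assoc)
        qed
      qed (use that T' \<eta> A0 in auto)
      have zero_mem: "Complex \<sigma>0 0 \<in> closed_segment ?a (Complex \<sigma>0 T)"
        using T' by (simp add: closed_segment_same_Re closed_segment_eq_real_ivl)
      have cont_left: "continuous_on (closed_segment ?a (Complex \<sigma>0 T)) P"
        using T' \<sigma> by (intro continuous_on_subset[OF cont])
          (auto simp: img_eq in_cbox_complex_iff in_box_complex_iff closed_segment_same_Re closed_segment_eq_real_ivl)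
      have left_eq: "contour_integral (linepath ?a (Complex \<sigma>0 T)) P
          = contour_integral (linepath (Complex \<sigma>0 0) (Complex \<sigma>0 0 + of_real T * \<i>)) P
            - contour_integral (linepath (Complex \<sigma>0 0) (Complex \<sigma>0 0 + of_real T * (- \<i>))) P"
      proof -
        have "Complex \<sigma>0 0 + of_real T * \<i> = Complex \<sigma>0 T" "Complex \<sigma>0 0 + of_real T * (- \<i>) = ?a"
          by (auto simp: complex_eq_iff)
        moreover have "continuous_on (closed_segment ?a (Complex \<sigma>0 0)) P"
          using zero_mem by (intro continuous_on_subset[OF cont_left]) (simp add: subset_closed_segment)
        ultimately show ?thesis
          using contour_integral_split_linepath[OF cont_left zero_mem]
            contour_integral_reverse_linepath[of ?a "Complex \<sigma>0 0" P] by simp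
      qed
      have tri: "norm (m - j) \<le> D / T + (E / T + E / T + (A / \<eta> + A / \<eta>))"
        if "j = bot + r - top - (l1 - l2)" "norm (r - m) \<le> D / T" "norm bot \<le> E / T" "norm top \<le> E / T"
          "norm l1 \<le> A / \<eta>" "norm l2 \<le> A / \<eta>" for m j r bot top l1 l2 :: complex
      proof -
        have "m - j = - (r - m) + (top - bot + (l1 - l2))" using that(1) by simp
        also have "norm \<dots> \<le> norm (r - m) + (norm top + norm bot + (norm l1 + norm l2))"
          by (metis norm_minus_cancel norm_triangle_mono norm_triangle_ineq4 order_refl)
        finally show ?thesis using that by linarith
      qed
      have "norm (2 * pi * \<i> * riesz_mean u \<beta> z - 2 * pi * \<i> * M z) \<le> D / T + (E / T + E / T + (A / \<eta> + A / \<eta>))"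
      proof (rule tri)
        show "2 * pi * \<i> * M z = contour_integral (linepath ?a (Complex 2 (- T))) P
            + contour_integral (linepath (Complex 2 (- T)) ?b) P
            - contour_integral (linepath (Complex \<sigma>0 T) ?b) P
            - (contour_integral (linepath (Complex \<sigma>0 0) (Complex \<sigma>0 0 + of_real T * \<i>)) P
            - contour_integral (linepath (Complex \<sigma>0 0) (Complex \<sigma>0 0 + of_real T * (- \<i>))) P)"
          using rect(1) contour_integral_unique[OF res] T' \<sigma> unfolding left_eq by simp
        show "norm (contour_integral (linepath (Complex 2 (- T)) ?b) P - 2 * pi * \<i> * riesz_mean u \<beta> z) \<le> D / T"
          unfolding P_def D_def by (intro riesz_mean_perron u \<beta> z T')
        show "norm (contour_integral (linepath ?a (Complex 2 (- T))) P) \<le> E / T"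
          "norm (contour_integral (linepath (Complex \<sigma>0 T) ?b) P) \<le> E / T"
          using T' \<sigma> rect by (auto intro!: horiz_int)
      qed (rule ray, simp)+
      thus ?thesis by (simp add: add_divide_distrib)
    qed
    \<comment> \<open>\<open>D\<close> and \<open>E\<close> depend badly on \<open>z\<close>, but
      \<open>z\<close> is fixed while \<open>T\<close> tends to infinity, and only the two rays
      remain.\<close>
    have "((\<lambda>T. (D + 2 * E) / T + 2 * (A / \<eta>)) \<longlongrightarrow> 0 + 2 * (A / \<eta>)) at_top"
      by (intro tendsto_intros real_tendsto_divide_at_top[OF tendsto_const filterlim_ident])
    hence "norm (2 * pi * \<i> * riesz_mean u \<beta> z - 2 * pi * \<i> * M z) \<le> 0 + 2 * (A / \<eta>)"
      by (rule tendsto_lowerbound) (use bound_T in \<open>auto intro!: eventually_at_top_linorderI[of "max T1 6"]\<close>)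
    moreover have "norm (2 * pi * \<i> * riesz_mean u \<beta> z - 2 * pi * \<i> * M z) = 2 * pi * norm (riesz_mean u \<beta> z - M z)"
      by (simp add: norm_mult flip: right_diff_distrib)
    moreover have "1 * norm (riesz_mean u \<beta> z - M z) \<le> 2 * pi * norm (riesz_mean u \<beta> z - M z)"
      using pi_gt3 by (intro mult_right_mono) auto
    ultimately show ?thesis by (simp add: A_def mult_ac)
  qed
  show ?thesis
    by (intro exI[of _ "2 * \<beta> * B / \<eta>"] allI impI) (use main in \<open>simp add: M_def\<close>)
qed

section \<open>Convolutions, the hyperbola method and Euler--Maclaurin summation\<close>

lemma dirichlet_conv_powers:
  assumes "a \<ge> 1" "c \<ge> 1"
  shows "dirichlet_conv (\<lambda>n. \<Sum>m | m \<ge> 1 \<and> m ^ a = n. f m) (\<lambda>n. \<Sum>m | m \<ge> 1 \<and> m ^ c = n. g m) n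
    = (\<Sum>(l, d) | l \<ge> 1 \<and> d \<ge> 1 \<and> l ^ a * d ^ c = n. f l * g d)"
proof -
  define A where "A = {(l, d). l \<ge> 1 \<and> d \<ge> 1 \<and> l ^ a * d ^ c = n}"
  define T where "T = {(i, j). i \<ge> 1 \<and> j \<ge> 1 \<and> i * j = n}"
  define \<phi> where "\<phi> = (\<lambda>(l::nat, d::nat). (l ^ a, d ^ c))"
  have "A \<subseteq> {..n} \<times> {..n}"
  proof
    fix p assume "p \<in> A"
    then obtain l d where ld: "p = (l, d)" "l \<ge> 1" "d \<ge> 1" "l ^ a * d ^ c = n" by (auto simp: A_def)
    have "l \<le> l ^ a" "d \<le> d ^ c" using ld assms by (auto intro: self_le_power)
    moreover have "l ^ a \<le> l ^ a * d ^ c" "d ^ c \<le> l ^ a * d ^ c" using ld by auto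
    ultimately have "l \<le> n" "d \<le> n" unfolding ld(4)[symmetric] by (blast intro: order.trans)+
    thus "p \<in> {..n} \<times> {..n}" by (simp add: ld(1))
  qed
  hence fin: "finite A" by (rule finite_subset) auto
  have T: "finite T" unfolding T_def by (rule finite_factor_pairs)
  \<comment> \<open>Group the pairs \<open>(l, d)\<close> by \<open>(l ^ a, d ^ c)\<close>; each
    fibre is a product set.\<close>
  have "(\<Sum>(l, d)\<in>A. f l * g d) = (\<Sum>y\<in>T. \<Sum>x\<in>{x \<in> A. \<phi> x = y}. (case x of (l, d) \<Rightarrow> f l * g d))"
    by (rule sum.group[symmetric, OF fin T]) (auto simp: A_def T_def \<phi>_def)
  also have "\<dots> = (\<Sum>(i, j)\<in>T. (\<Sum>m | m \<ge> 1 \<and> m ^ a = i. f m) * (\<Sum>m | m \<ge> 1 \<and> m ^ c = j. g m))"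
  proof (rule sum.cong, rule refl, clarify)
    fix i j assume "(i, j) \<in> T"
    hence "{x \<in> A. \<phi> x = (i, j)} = {m. m \<ge> 1 \<and> m ^ a = i} \<times> {m. m \<ge> 1 \<and> m ^ c = j}"
      by (auto simp: A_def T_def \<phi>_def)
    thus "(\<Sum>x\<in>{x \<in> A. \<phi> x = (i, j)}. (case x of (l, d) \<Rightarrow> f l * g d))
        = (\<Sum>m | m \<ge> 1 \<and> m ^ a = i. f m) * (\<Sum>m | m \<ge> 1 \<and> m ^ c = j. g m)"
      by (simp add: sum_product sum.cartesian_product)
  qed
  finally show ?thesis by (simp add: dirichlet_conv_def A_def T_def)
qed

text \<open>\<open>has_dser\<close> does not see the value at \<open>0\<close>, whereas
  \<open>dirichlet_coeffs\<close> is \<open>0\<close> there; hence the comparison with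
  \<open>g(0 := 0)\<close>.\<close>

lemma dirichlet_coeffs_eq:
  assumes "has_dser g F" "n \<ge> 1"
  shows "dirichlet_coeffs F n = g n"
proof -
  have eq: "(g(0 := 0)) n / of_nat n powr s = g n / of_nat n powr s" for n s by simp
  have "dirichlet_coeffs F = g(0 := 0)"
    by (rule dirichlet_coeffs_unique[of _ _ F])
       (simp_all only: dirichlet_coeffs_0[OF assms(1)] dirichlet_coeffs_sums[OF assms(1)] eq dser_sums[OF assms(1)], simp)
  thus ?thesis using assms by simp
qed

lemma has_dser_cong_coeffs:
  assumes "has_dser f F" "\<And>n. n \<ge> 1 \<Longrightarrow> f n = g n"
  shows "has_dser g F"
  unfolding has_dser_def
proof safe
  fix s :: complex assume "Re s > 1"
  from dserD[OF assms(1) this] show "((\<lambda>n. g n / of_nat n powr s) has_sum F s) {1..}"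
    by (rule has_sum_cong[THEN iffD1, rotated]) (simp add: assms(2))
qed

lemma dser_mu_coeff: "has_dser (mu_coeff k) (\<lambda>s. 1 / zeta s ^ k)"
proof -
  obtain g where "has_dser g (\<lambda>s. (1 / zeta s) ^ k)"
    using dser_power[OF dser_inverse_zeta] by blast
  hence g: "has_dser g (\<lambda>s. 1 / zeta s ^ k)" by (simp add: power_one_over)
  show ?thesis unfolding mu_coeff_def
    by (rule has_dser_cong_coeffs[OF g]) (simp add: dirichlet_coeffs_eq[OF g])
qed

lemma dser_u_coeff:
  assumes "a \<ge> 1" "c \<ge> 1"
  shows "has_dser (u_coeff k a c) (\<lambda>s. zeta (of_nat a * s) / zeta (of_nat c * s) ^ k)"
proof -
  from dser_dconv[OF dser_scale[OF dser_zeta assms(1)] dser_scale[OF dser_mu_coeff assms(2)], of k]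
  have "has_dser (dirichlet_conv (\<lambda>n. \<Sum>m | m \<ge> 1 \<and> m ^ a = n. 1) (\<lambda>n. \<Sum>m | m \<ge> 1 \<and> m ^ c = n. mu_coeff k m))
     (\<lambda>s. zeta (of_nat a * s) * (1 / zeta (of_nat c * s) ^ k))" .
  moreover have "dirichlet_conv (\<lambda>n. \<Sum>m | m \<ge> 1 \<and> m ^ a = n. 1) (\<lambda>n. \<Sum>m | m \<ge> 1 \<and> m ^ c = n. mu_coeff k m)
      = u_coeff k a c"
    using dirichlet_conv_powers[OF assms, of "\<lambda>_. 1" "mu_coeff k"] by (intro ext) (simp add: u_coeff_def)
  ultimately show ?thesis by simp
qed

text \<open>The factor \<open>zeta (b * s)\<close> is the series of the indicator of
  \<open>b\<close>-th powers; the remaining quotient is the series of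
  \<open>u_coeff\<close>.\<close>

lemma f_coeff_eq:
  assumes "a \<ge> 1" "b \<ge> 1" "c \<ge> 1" "n \<ge> 1"
  shows "f_coeff k a b c n = (\<Sum>(m, j) | m \<ge> 1 \<and> j \<ge> 1 \<and> m ^ b * j = n. u_coeff k a c j)"
proof -
  \<comment> \<open>\<open>u_coeff\<close> as a sum over first powers, the shape that
    \<open>dirichlet_conv_powers\<close> expects.\<close>
  let ?u = "\<lambda>n. \<Sum>m | m \<ge> 1 \<and> m ^ 1 = n. u_coeff k a c m"
  have "?u n = u_coeff k a c n" if "n \<ge> 1" for n
  proof -
    have "{m. m \<ge> 1 \<and> m ^ 1 = n} = {n}" using that by auto
    thus ?thesis by simp
  qed
  hence "has_dser ?u (\<lambda>s. zeta (of_nat a * s) / zeta (of_nat c * s) ^ k)"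
    by (intro has_dser_cong_coeffs[OF dser_u_coeff[OF assms(1,3)]]) simp
  from dser_dconv[OF dser_scale[OF dser_zeta assms(2)] this]
  have "has_dser (dirichlet_conv (\<lambda>n. \<Sum>m | m \<ge> 1 \<and> m ^ b = n. 1) ?u)
      (\<lambda>s. zeta (of_nat a * s) * zeta (of_nat b * s) / zeta (of_nat c * s) ^ k)"
    by (simp add: mult_ac)
  from dirichlet_coeffs_eq[OF this assms(4)] show ?thesis
    unfolding f_coeff_def using dirichlet_conv_powers[of b 1 "\<lambda>_. 1" "u_coeff k a c" n] assms by simp
qed

section \<open>The hyperbola method for \<open>m ^ b * n \<le> x\<close>\<close>

lemma power_le_iff_le_powr:
  assumes "q > 0" "m \<ge> 0" "b \<ge> 1"
  shows "m ^ b \<le> q \<longleftrightarrow> m \<le> q powr (1 / real b)"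
proof
  assume "m ^ b \<le> q"
  hence "(m ^ b) powr (1 / real b) \<le> q powr (1 / real b)" using assms by (intro powr_mono2) auto
  moreover have "(m ^ b) powr (1 / real b) = m"
    using assms by (cases "m = 0") (auto simp: powr_powr simp flip: powr_realpow)
  ultimately show "m \<le> q powr (1 / real b)" by simp
next
  assume "m \<le> q powr (1 / real b)"
  hence "m ^ b \<le> (q powr (1 / real b)) ^ b" using assms by (intro power_mono) auto
  also have "\<dots> = q" using assms by (simp add: powr_powr flip: powr_realpow)
  finally show "m ^ b \<le> q" .
qed

lemma card_nat_between:
  assumes "0 \<le> y" "y \<le> r"
  shows "real (card {m::nat. y < real m \<and> real m \<le> r}) = of_int \<lfloor>r\<rfloor> - of_int \<lfloor>y\<rfloor>"
proof -
  have "{m::nat. y < real m \<and> real m \<le> r} = {nat \<lfloor>y\<rfloor><..nat \<lfloor>r\<rfloor>}"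
    using assms by (auto simp: le_nat_floor nat_less_iff floor_less_iff le_nat_iff le_floor_iff)
  hence "real (card {m::nat. y < real m \<and> real m \<le> r}) = real (nat \<lfloor>r\<rfloor> - nat \<lfloor>y\<rfloor>)" by simp
  also have "\<dots> = of_int \<lfloor>r\<rfloor> - of_int \<lfloor>y\<rfloor>"
    using assms floor_mono[OF assms(2)] by (simp add: of_nat_diff nat_mono)
  finally show ?thesis .
qed

text \<open>Split the pairs at \<open>m \<le> y\<close>. For \<open>m > y\<close> sum over
  \<open>m\<close> first: given \<open>j\<close>, it runs through the integers above
  \<open>y\<close> up to \<open>(x / j) powr (1 / b)\<close>, and there are none unless
  \<open>j \<le> x / y ^ b\<close>. Subtracting \<open>\<lfloor>y\<rfloor>\<close> replaces the
  doubly counted rectangle of the symmetric form.\<close>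

lemma hyperbola_powers:
  fixes u :: "nat \<Rightarrow> complex"
  assumes "b \<ge> 1" "x \<ge> 1" "1 \<le> y" "y < x powr (1 / real b)"
  shows "(\<Sum>n | n \<ge> 1 \<and> real n \<le> x. \<Sum>(m, j) | m \<ge> 1 \<and> j \<ge> 1 \<and> m ^ b * j = n. u j)
    = (\<Sum>m | m \<ge> 1 \<and> real m \<le> y. \<Sum>n | n \<ge> 1 \<and> real n \<le> x / real m ^ b. u n)
      + (\<Sum>n | n \<ge> 1 \<and> real n \<le> x / y ^ b.
           u n * of_real (of_int \<lfloor>(x / real n) powr (1 / real b)\<rfloor> - of_int \<lfloor>y\<rfloor>))"
proof -
  define S where "S = {(m, j). m \<ge> 1 \<and> j \<ge> 1 \<and> real (m ^ b * j) \<le> x}"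
  define S1 where "S1 = {(m, j). m \<ge> 1 \<and> j \<ge> 1 \<and> real (m ^ b * j) \<le> x \<and> real m \<le> y}"
  define S2 where "S2 = {(m, j). m \<ge> 1 \<and> j \<ge> 1 \<and> real (m ^ b * j) \<le> x \<and> y < real m}"
  have "S \<subseteq> {..nat \<lfloor>x\<rfloor>} \<times> {..nat \<lfloor>x\<rfloor>}"
  proof
    fix p assume "p \<in> S"
    then obtain m j where mj: "p = (m, j)" "m \<ge> 1" "j \<ge> 1" "real (m ^ b * j) \<le> x" by (auto simp: S_def)
    have "m \<le> m ^ b" using mj assms by (intro self_le_power) auto
    moreover have "m ^ b \<le> m ^ b * j" "j \<le> m ^ b * j" using mj by auto
    moreover have "m ^ b * j \<le> nat \<lfloor>x\<rfloor>" using mj(4) by (intro le_nat_floor)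
    ultimately have "m \<le> nat \<lfloor>x\<rfloor>" "j \<le> nat \<lfloor>x\<rfloor>" by (blast intro: order.trans)+
    thus "p \<in> {..nat \<lfloor>x\<rfloor>} \<times> {..nat \<lfloor>x\<rfloor>}" by (simp add: mj(1))
  qed
  hence finS: "finite S" by (rule finite_subset) auto
  have S12: "S = S1 \<union> S2" "S1 \<inter> S2 = {}" by (auto simp: S_def S1_def S2_def)
  hence fin: "finite S1" "finite S2" using finS by auto
  have "(\<Sum>(m, j)\<in>S. u j) = (\<Sum>n | n \<ge> 1 \<and> real n \<le> x. \<Sum>p\<in>{p \<in> S. (\<lambda>(m, j). m ^ b * j) p = n}. (case p of (m, j) \<Rightarrow> u j))"
    by (rule sum.group[symmetric, OF finS finite_nat_le_real]) (auto simp: S_def)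
  also have "\<dots> = (\<Sum>n | n \<ge> 1 \<and> real n \<le> x. \<Sum>(m, j) | m \<ge> 1 \<and> j \<ge> 1 \<and> m ^ b * j = n. u j)"
  proof (intro sum.cong refl)
    fix n assume "n \<in> {n. n \<ge> 1 \<and> real n \<le> x}"
    thus "{p \<in> S. (\<lambda>(m, j). m ^ b * j) p = n} = {(m, j). m \<ge> 1 \<and> j \<ge> 1 \<and> m ^ b * j = n}"
      by (auto simp: S_def)
  qed
  finally have "(\<Sum>n | n \<ge> 1 \<and> real n \<le> x. \<Sum>(m, j) | m \<ge> 1 \<and> j \<ge> 1 \<and> m ^ b * j = n. u j)
      = (\<Sum>(m, j)\<in>S1. u j) + (\<Sum>(m, j)\<in>S2. u j)"
    using sum.union_disjoint[OF fin S12(2), of "\<lambda>(m, j). u j"] S12(1) by simp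
  also have "(\<Sum>(m, j)\<in>S1. u j) = (\<Sum>m | m \<ge> 1 \<and> real m \<le> y. \<Sum>n | n \<ge> 1 \<and> real n \<le> x / real m ^ b. u n)"
  proof -
    have "S1 = (SIGMA m:{m. m \<ge> 1 \<and> real m \<le> y}. {n. n \<ge> 1 \<and> real n \<le> x / real m ^ b})"
      by (auto simp: S1_def field_simps)
    thus ?thesis using finite_nat_le_real by (simp add: sum.Sigma)
  qed
  also have "(\<Sum>(m, j)\<in>S2. u j) = (\<Sum>n | n \<ge> 1 \<and> real n \<le> x / y ^ b.
           u n * of_real (of_int \<lfloor>(x / real n) powr (1 / real b)\<rfloor> - of_int \<lfloor>y\<rfloor>))"
  proof -
    define R where "R = (\<lambda>n. {m::nat. y < real m \<and> real m \<le> (x / real n) powr (1 / real b)})"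
    have finR: "finite (R n)" for n
      by (rule finite_subset[OF _ finite_nat_le_real[of "(x / real n) powr (1 / real b)"]])
         (use assms in \<open>auto simp: R_def\<close>)
    have R: "m \<in> R n \<longleftrightarrow> y < real m \<and> real (m ^ b * n) \<le> x" if "n \<ge> 1" for m n
      using power_le_iff_le_powr[of "x / real n" "real m" b] assms that
      by (auto simp: R_def field_simps)
    have "(\<Sum>(m, j)\<in>S2. u j) = (\<Sum>(n, m)\<in>(SIGMA n:{n. n \<ge> 1 \<and> real n \<le> x / y ^ b}. R n). u n)"
    proof (rule sum.reindex_bij_witness[of _ prod.swap prod.swap])
      fix p assume p: "p \<in> S2"
      then obtain m j where mj: "p = (m, j)" "j \<ge> 1" "real (m ^ b * j) \<le> x" "y < real m"
        by (auto simp: S2_def)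
      have "y ^ b * real j \<le> real m ^ b * real j"
        using mj assms by (intro mult_right_mono power_mono) auto
      also have "\<dots> \<le> x" using mj by simp
      finally have "real j \<le> x / y ^ b" using assms by (simp add: field_simps)
      thus "prod.swap p \<in> (SIGMA n:{n. n \<ge> 1 \<and> real n \<le> x / y ^ b}. R n)"
        using mj R[of j m] by simp
    next
      fix q assume "q \<in> (SIGMA n:{n. n \<ge> 1 \<and> real n \<le> x / y ^ b}. R n)"
      then obtain n m where nm: "q = (n, m)" "n \<ge> 1" "m \<in> R n" by auto
      thus "prod.swap q \<in> S2" using R[of n m] assms by (auto simp: S2_def)
    qed auto
    also have "\<dots> = (\<Sum>n | n \<ge> 1 \<and> real n \<le> x / y ^ b. \<Sum>m\<in>R n. u n)"
      by (intro sum.Sigma[symmetric] finite_nat_le_real ballI finR)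
    also have "\<dots> = (\<Sum>n | n \<ge> 1 \<and> real n \<le> x / y ^ b.
           u n * of_real (of_int \<lfloor>(x / real n) powr (1 / real b)\<rfloor> - of_int \<lfloor>y\<rfloor>))"
    proof (intro sum.cong refl)
      fix n assume "n \<in> {n. n \<ge> 1 \<and> real n \<le> x / y ^ b}"
      hence n: "n \<ge> 1" "real n \<le> x / y ^ b" by auto
      hence "y ^ b \<le> x / real n" using assms by (simp add: field_simps)
      hence "y \<le> (x / real n) powr (1 / real b)"
        using power_le_iff_le_powr[of "x / real n" y b] n assms by auto
      hence "real (card (R n)) = of_int \<lfloor>(x / real n) powr (1 / real b)\<rfloor> - of_int \<lfloor>y\<rfloor>"
        unfolding R_def using assms by (intro card_nat_between) auto
      thus "(\<Sum>m\<in>R n. u n) = u n * of_real (of_int \<lfloor>(x / real n) powr (1 / real b)\<rfloor> - of_int \<lfloor>y\<rfloor>)"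
        by (metis mult.commute of_real_of_nat_eq sum_constant)
    qed
    finally show ?thesis .
  qed
  finally show ?thesis .
qed

text \<open>
  Second-order Euler--Maclaurin summation: after adding the periodic Bernoulli polynomial of degree
  two, the error function is monotone, and it turns antitone when \<open>s / 8 * t powr (- s - 1)\<close> is
  added.
\<close>
lemma zeta_partial_sum:
  fixes s :: real
  assumes s: "s > 1"
  shows "\<exists>C. \<forall>y\<ge>1. norm ((\<Sum>d | d \<ge> 1 \<and> real d \<le> y. of_real (real d powr (- s))) - zeta (of_real s)
      + of_real (y powr (1 - s) / (s - 1) + psi y * y powr (- s))) \<le> C * y powr (- 1 - s)"
proof -
  \<comment> \<open>The index \<open>d = 0\<close> contributes \<open>0\<close>, since
    \<open>0 powr (- s) = 0\<close>.\<close>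
  define S where "S = (\<lambda>N. \<Sum>d<Suc N. real d powr (- s))"
  define Z where "Z = (\<Sum>d. real d powr (- s))"
  \<comment> \<open>For \<open>N \<le> t < N + 1\<close> this is the error at \<open>t\<close>;
    keeping \<open>N\<close> fixed makes it differentiable up to the right end.\<close>
  define \<phi> where "\<phi> = (\<lambda>N t. S N - Z + t powr (1 - s) / (s - 1) + (t - real N - 1 / 2) * t powr (- s))"
  \<comment> \<open>The quadratic polynomial is taken without constant term, so that the correction
    vanishes at both ends of the interval.\<close>
  define \<rho> where "\<rho> = (\<lambda>N t. \<phi> N t + s / 2 * ((t - real N)\<^sup>2 - (t - real N)) * t powr (- s - 1))"
  \<comment> \<open>The \<open>1 / 8\<close> is \<open>1 / 2\<close> times the maximum
    \<open>1 / 4\<close> of \<open>w * (1 - w)\<close>, so that the derivative of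
    \<open>\<kappa>\<close> dominates that of \<open>\<rho>\<close>.\<close>
  define \<kappa> where "\<kappa> = (\<lambda>t. s / 8 * t powr (- s - 1))"
  have summ: "summable (\<lambda>d. real d powr (- s))" using s by (simp add: summable_real_powr_iff)
  have "(\<lambda>d. of_nat d powr (- of_real s)) = (\<lambda>d. of_real (real d powr (- s)) :: complex)"
  proof
    fix d show "of_nat d powr (- of_real s) = (of_real (real d powr (- s)) :: complex)"
      using powr_of_real[of "real d" "- s"] by simp
  qed
  hence "(\<lambda>d. of_real (real d powr (- s))) sums zeta (of_real s)"
    using zeta_sums[of "of_real s"] s by simp
  moreover have "(\<lambda>d. of_real (real d powr (- s))) sums (of_real Z :: complex)"
    unfolding Z_def using summ by (intro sums_of_real summable_sums)
  ultimately have zeta: "zeta (of_real s) = of_real Z" by (rule sums_unique2)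
  have powr_deriv: "((\<lambda>t. t powr e) has_real_derivative e * t powr (e - 1)) (at t)" if "t > 0" for e t :: real
    using that by (rule has_real_derivative_powr)
  have \<rho>': "(\<rho> N has_real_derivative s * (s + 1) / 2 * ((t - real N) * (1 - (t - real N))) * t powr (- s - 2)) (at t)"
    if t: "t > 0" for N t
  proof -
    have "(\<phi> N has_real_derivative 0 + (1 - s) * t powr (1 - s - 1) / (s - 1)
        + (1 * t powr (- s) + (- s * t powr (- s - 1)) * (t - real N - 1 / 2))) (at t)"
      unfolding \<phi>_def
      by (intro DERIV_add DERIV_const DERIV_cdivide DERIV_mult powr_deriv t) (auto intro!: derivative_eq_intros)
    also have "(1 - s) * t powr (1 - s - 1) / (s - 1) = - (t powr (- s))"
      using s by (simp add: field_simps)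
    finally have \<phi>': "(\<phi> N has_real_derivative - s * (t - real N - 1 / 2) * t powr (- s - 1)) (at t)"
      by (simp add: mult_ac)
    have "((\<lambda>t. s / 2 * ((t - real N)\<^sup>2 - (t - real N)) * t powr (- s - 1)) has_real_derivative
        s / 2 * (2 * (t - real N) - 1) * t powr (- s - 1)
        + (- s - 1) * t powr (- s - 1 - 1) * (s / 2 * ((t - real N)\<^sup>2 - (t - real N)))) (at t)"
      by (intro DERIV_mult DERIV_cmult powr_deriv t) (auto intro!: derivative_eq_intros)
    from DERIV_add[OF \<phi>' this] show ?thesis unfolding \<rho>_def
      by (rule DERIV_cong) (simp add: algebra_simps power2_eq_square add_divide_distrib diff_divide_distrib)
  qed
  have \<kappa>': "(\<kappa> has_real_derivative - (s * (s + 1) / 8) * t powr (- s - 2)) (at t)" if t: "t > 0" for t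
  proof -
    have "(\<kappa> has_real_derivative s / 8 * ((- s - 1) * t powr (- s - 1 - 1))) (at t)"
      unfolding \<kappa>_def by (intro DERIV_cmult powr_deriv t)
    thus ?thesis by (rule DERIV_cong) (simp add: algebra_simps)
  qed
  have mono: "\<rho> N t1 \<le> \<rho> N t2" and anti: "\<rho> N t2 + \<kappa> t2 \<le> \<rho> N t1 + \<kappa> t1"
    if "N \<ge> 1" "real N \<le> t1" "t1 \<le> t2" "t2 \<le> real N + 1" for N t1 t2
  proof -
    show "\<rho> N t1 \<le> \<rho> N t2"
    proof (rule DERIV_nonneg_imp_nondecreasing[OF that(3)])
      fix t assume t: "t1 \<le> t" "t \<le> t2"
      have "0 \<le> s * (s + 1) / 2 * ((t - real N) * (1 - (t - real N))) * t powr (- s - 2)"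
        using that s t by (intro mult_nonneg_nonneg) auto
      moreover have "t > 0" using that t by linarith
      ultimately show "\<exists>y. (\<rho> N has_real_derivative y) (at t) \<and> 0 \<le> y" using \<rho>'[of t N] by blast
    qed
    show "\<rho> N t2 + \<kappa> t2 \<le> \<rho> N t1 + \<kappa> t1"
    proof (rule DERIV_nonpos_imp_nonincreasing[OF that(3)])
      fix t assume t: "t1 \<le> t" "t \<le> t2"
      have t0: "t > 0" using that t by linarith
      have "(t - real N) * (1 - (t - real N)) \<le> 1 / 4"
        using zero_le_power2[of "t - real N - 1 / 2"] by (simp add: power2_eq_square algebra_simps)
      hence "s * (s + 1) / 2 * ((t - real N) * (1 - (t - real N))) * t powr (- s - 2)
          \<le> s * (s + 1) / 2 * (1 / 4) * t powr (- s - 2)"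
        using s by (intro mult_right_mono mult_left_mono) auto
      hence "s * (s + 1) / 2 * ((t - real N) * (1 - (t - real N))) * t powr (- s - 2)
          + - (s * (s + 1) / 8) * t powr (- s - 2) \<le> 0" by simp
      with DERIV_add[OF \<rho>'[OF t0, of N] \<kappa>'[OF t0]]
      show "\<exists>y. ((\<lambda>t. \<rho> N t + \<kappa> t) has_real_derivative y) (at t) \<and> y \<le> 0" by blast
    qed
  qed
  define e where "e = (\<lambda>N. \<phi> N (real N))"
  have \<rho>_left: "\<rho> N (real N) = e N" for N by (simp add: \<rho>_def e_def)
  \<comment> \<open>The pieces join up: the jump of \<open>psi\<close> at \<open>N + 1\<close> is
    offset by the new summand of \<open>S\<close>.\<close>
  have \<rho>_right: "\<rho> N (real N + 1) = e (Suc N)" for N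
    by (simp add: \<rho>_def e_def \<phi>_def S_def add_ac)
  have inc: "incseq (\<lambda>n. e (Suc n))"
  proof (rule incseq_SucI)
    fix n show "e (Suc n) \<le> e (Suc (Suc n))"
      using mono[of "Suc n" "real (Suc n)" "real (Suc n) + 1"] unfolding \<rho>_left \<rho>_right by simp
  qed
  have dec: "decseq (\<lambda>n. e (Suc n) + \<kappa> (real (Suc n)))"
  proof (rule decseq_SucI)
    fix n show "e (Suc (Suc n)) + \<kappa> (real (Suc (Suc n))) \<le> e (Suc n) + \<kappa> (real (Suc n))"
      using anti[of "Suc n" "real (Suc n)" "real (Suc n) + 1"] unfolding \<rho>_left \<rho>_right by (simp add: add_ac)
  qed
  have S_lim: "S \<longlonglongrightarrow> Z"
    unfolding S_def Z_def using summable_sums[OF summ] unfolding sums_def by (rule LIMSEQ_Suc)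
  have "(\<lambda>n. S n - Z + real n powr (1 - s) / (s - 1) - 1 / 2 * real n powr (- s)) \<longlonglongrightarrow> Z - Z + 0 / (s - 1) - 1 / 2 * 0"
  proof (intro tendsto_intros S_lim)
    show "(\<lambda>n. real n powr (1 - s)) \<longlonglongrightarrow> 0" using s by real_asymp
    show "(\<lambda>n. real n powr (- s)) \<longlonglongrightarrow> 0" using s by real_asymp
  qed (use s in auto)
  hence "e \<longlonglongrightarrow> 0" by (simp add: e_def \<phi>_def)
  hence e_lim: "(\<lambda>n. e (Suc n)) \<longlonglongrightarrow> 0" by (rule LIMSEQ_Suc)
  have "(\<lambda>n. \<kappa> (real n)) \<longlonglongrightarrow> s / 8 * 0"
    unfolding \<kappa>_def
  proof (intro tendsto_intros)
    show "(\<lambda>n. real n powr (- s - 1)) \<longlonglongrightarrow> 0" using s by real_asymp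
  qed
  hence "(\<lambda>n. \<kappa> (real (Suc n))) \<longlonglongrightarrow> 0" using LIMSEQ_Suc[of "\<lambda>n. \<kappa> (real n)" 0] by simp
  from tendsto_add[OF e_lim this] have ek_lim: "(\<lambda>n. e (Suc n) + \<kappa> (real (Suc n))) \<longlonglongrightarrow> 0" by simp
  \<comment> \<open>\<open>e\<close> increases to \<open>0\<close>, and \<open>e + \<kappa>\<close>
    decreases to \<open>0\<close>.\<close>
  have e_bounds: "e N \<le> 0" "- \<kappa> (real N) \<le> e N" if "N \<ge> 1" for N
    using incseq_le[OF inc e_lim, of "N - 1"] decseq_ge[OF dec ek_lim, of "N - 1"] that by auto
  have "norm ((\<Sum>d | d \<ge> 1 \<and> real d \<le> y. of_real (real d powr (- s))) - zeta (of_real s)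
      + of_real (y powr (1 - s) / (s - 1) + psi y * y powr (- s))) \<le> (2 powr (s + 1) + 1) * (s / 8) * y powr (- 1 - s)"
    if y: "y \<ge> 1" for y
  proof -
    define N where "N = nat \<lfloor>y\<rfloor>"
    have N: "real N = of_int \<lfloor>y\<rfloor>" using y by (simp add: N_def)
    hence N': "N \<ge> 1" "real N \<le> y" "y < real N + 1" using y by linarith+
    define w where "w = y - real N"
    have w: "0 \<le> w" "w < 1" using N' by (auto simp: w_def)
    have "(\<Sum>d | d \<ge> 1 \<and> real d \<le> y. real d powr (- s)) = S N"
      unfolding S_def using N' by (intro sum.mono_neutral_left) (auto simp: not_le)
    hence S: "(\<Sum>d | d \<ge> 1 \<and> real d \<le> y. of_real (real d powr (- s))) = (of_real (S N) :: complex)"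
      by (metis of_real_sum)
    have "\<phi> N y = S N - Z + (y powr (1 - s) / (s - 1) + psi y * y powr (- s))"
      by (simp add: \<phi>_def psi_def frac_def N)
    hence eq: "(\<Sum>d | d \<ge> 1 \<and> real d \<le> y. of_real (real d powr (- s))) - zeta (of_real s)
      + of_real (y powr (1 - s) / (s - 1) + psi y * y powr (- s)) = (of_real (\<phi> N y) :: complex)"
      by (simp only: S zeta of_real_add of_real_diff)
    have "\<rho> N y \<le> 0" "- \<kappa> (real N) \<le> \<rho> N y"
      using mono[of N y "real N + 1"] mono[of N "real N" y] e_bounds[of "Suc N"] e_bounds[of N] N'
      unfolding \<rho>_left \<rho>_right by auto
    moreover have "\<bar>s / 2 * (w\<^sup>2 - w) * y powr (- s - 1)\<bar> \<le> \<kappa> y"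
    proof -
      have "w\<^sup>2 - w \<ge> - (1 / 4)" using zero_le_power2[of "w - 1 / 2"] by (simp add: power2_eq_square algebra_simps)
      moreover have "w\<^sup>2 - w \<le> 0" using w by (simp add: power2_eq_square mult_left_le)
      ultimately have "\<bar>w\<^sup>2 - w\<bar> \<le> 1 / 4" by simp
      hence "s / 2 * \<bar>w\<^sup>2 - w\<bar> * y powr (- s - 1) \<le> s / 2 * (1 / 4) * y powr (- s - 1)"
        using s by (intro mult_right_mono mult_left_mono) auto
      thus ?thesis using s by (simp add: abs_mult \<kappa>_def)
    qed
    moreover have "\<phi> N y = \<rho> N y - s / 2 * (w\<^sup>2 - w) * y powr (- s - 1)" by (simp add: \<rho>_def w_def)
    ultimately have "\<bar>\<phi> N y\<bar> \<le> \<kappa> (real N) + \<kappa> y" by linarith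
    \<comment> \<open>From \<open>y < N + 1 \<le> 2 * N\<close>.\<close>
    moreover have "\<kappa> (real N) \<le> 2 powr (s + 1) * \<kappa> y"
    proof -
      have "real N powr (- s - 1) \<le> (y / 2) powr (- s - 1)"
        using N' s by (intro powr_mono2') auto
      also have "\<dots> = y powr (- s - 1) * 2 powr (s + 1)"
      proof -
        have "2 powr (s + 1) = 1 / 2 powr (- s - 1)" using powr_minus_divide[of 2 "- s - 1"] by (simp add: add.commute)
        thus ?thesis by (simp only: powr_divide times_divide_eq_right mult_1_right)
      qed
      finally have "s / 8 * real N powr (- s - 1) \<le> s / 8 * (y powr (- s - 1) * 2 powr (s + 1))"
        using s by (intro mult_left_mono) auto
      thus ?thesis by (simp add: \<kappa>_def mult_ac)
    qed
    ultimately have "\<bar>\<phi> N y\<bar> \<le> (2 powr (s + 1) + 1) * \<kappa> y" by (simp add: algebra_simps)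
    also have "\<kappa> y = s / 8 * y powr (- 1 - s)" by (simp add: \<kappa>_def minus_diff_commute)
    finally show ?thesis unfolding eq norm_of_real by (simp add: mult.assoc)
  qed
  thus ?thesis by blast
qed

section \<open>The main estimate\<close>

text \<open>The point \<open>1\<close> fits in: \<open>1 / zeta 1 = 1 / 0 = 0\<close> is also the
  value of \<open>(s - 1) / zeta_reg s\<close> there, that is, the zero of the reciprocal at the
  pole of zeta.\<close>

lemma inverse_zeta_holomorphic:
  assumes "riemann_hypothesis"
  shows "(\<lambda>s. 1 / zeta s) holomorphic_on {s. Re s > 1 / 2}"
proof (rule holomorphic_transform)
  have nz: "zeta_reg s \<noteq> 0" if "Re s > 1 / 2" for s
    using zeta_nonzero_RH[OF assms that] zeta_reg_eq[of s] zeta_reg_1 that by (cases "s = 1") auto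
  show "(\<lambda>s. (s - 1) / zeta_reg s) holomorphic_on {s. Re s > 1 / 2}"
    using nz by (intro holomorphic_intros holomorphic_on_subset[OF zeta_reg_holomorphic]) auto
  show "(s - 1) / zeta_reg s = 1 / zeta s" if "s \<in> {s. Re s > 1 / 2}" for s
    using zeta_reg_eq[of s] that by (cases "s = 1") (auto simp: zeta_1)
qed

lemma u_coeff_gen_growth:
  assumes RH: "riemann_hypothesis" and "a \<ge> 1" "c \<ge> 1" "k \<ge> 1"
    and \<sigma>: "\<sigma> > 1 / (2 * real c)" "real a * \<sigma> \<le> 2"
  obtains T0 C \<eta> where "0 < \<eta>" "\<eta> \<le> 1" "C \<ge> 0"
    "\<And>s. \<sigma> \<le> Re s \<Longrightarrow> \<bar>Im s\<bar> \<ge> T0 \<Longrightarrow>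
       norm (zeta (of_nat a * s) / zeta (of_nat c * s) ^ k) \<le> C * norm s powr (1 - \<eta>)"
proof -
  define \<sigma>' where "\<sigma>' = real a * \<sigma>"
  define \<delta> where "\<delta> = real c * \<sigma> - 1 / 2"
  have "\<sigma> > 0" using \<sigma>(1) by (rule order.strict_trans[rotated]) (use assms in simp)
  hence \<sigma>': "0 < \<sigma>'" "\<sigma>' \<le> 2" using assms by (auto simp: \<sigma>'_def)
  have \<delta>: "\<delta> > 0" using \<sigma>(1) assms by (simp add: \<delta>_def field_simps)
  \<comment> \<open>\<open>zeta_growth\<close> saves \<open>\<sigma>' / 4\<close> in the exponent.
    Half of it pays for the \<open>k\<close> reciprocal factors, \<open>\<eta> / k\<close> each; the
    other half remains.\<close>
  define \<eta> where "\<eta> = \<sigma>' / 8"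
  have \<eta>: "0 < \<eta>" "\<eta> \<le> 1" using \<sigma>' by (auto simp: \<eta>_def)
  define \<epsilon> where "\<epsilon> = \<eta> / real k"
  have \<epsilon>: "\<epsilon> > 0" "real k * \<epsilon> = \<eta>" using \<eta> assms by (auto simp: \<epsilon>_def)
  obtain C1 where C1: "C1 > 0" "\<And>s. Re s \<ge> \<sigma>' \<Longrightarrow> norm s \<ge> 2 \<Longrightarrow> norm (zeta s) \<le> C1 * norm s powr (1 - \<sigma>' / 4)"
    using zeta_growth[OF \<sigma>'] by auto
  obtain T1 where T1: "\<And>s. Re s \<ge> 1 / 2 + \<delta> \<Longrightarrow> \<bar>Im s\<bar> \<ge> T1 \<Longrightarrow> norm (1 / zeta s) \<le> \<bar>Im s\<bar> powr \<epsilon>"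
    using inverse_zeta_growth[OF RH \<delta> \<epsilon>(1)] by blast
  define C where "C = C1 * real a powr (1 - \<sigma>' / 4) * real c powr \<eta>"
  have "norm (zeta (of_nat a * s) / zeta (of_nat c * s) ^ k) \<le> C * norm s powr (1 - \<eta>)"
    if s: "\<sigma> \<le> Re s" "\<bar>Im s\<bar> \<ge> max 2 T1" for s
  proof -
    have norm_s: "norm s \<ge> 2" using s(2) abs_Im_le_cmod[of s] by linarith
    have "1 * norm s \<le> real a * norm s" using assms by (intro mult_right_mono) auto
    hence "norm (zeta (of_nat a * s)) \<le> C1 * norm (of_nat a * s) powr (1 - \<sigma>' / 4)"
      using s norm_s assms by (intro C1) (auto simp: \<sigma>'_def norm_mult intro!: mult_left_mono)
    also have "norm (of_nat a * s) powr (1 - \<sigma>' / 4) = real a powr (1 - \<sigma>' / 4) * norm s powr (1 - \<sigma>' / 4)"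
      by (simp add: norm_mult powr_mult)
    finally have A: "norm (zeta (of_nat a * s)) \<le> C1 * real a powr (1 - \<sigma>' / 4) * norm s powr (1 - \<sigma>' / 4)"
      by (simp only: mult.assoc)
    have "1 * \<bar>Im s\<bar> \<le> real c * \<bar>Im s\<bar>" using assms by (intro mult_right_mono) auto
    hence "norm (1 / zeta (of_nat c * s)) \<le> \<bar>Im (of_nat c * s)\<bar> powr \<epsilon>"
      using s assms by (intro T1) (auto simp: \<delta>_def abs_mult intro!: mult_left_mono)
    also have "\<dots> = (real c * \<bar>Im s\<bar>) powr \<epsilon>" by (simp add: abs_mult)
    also have "\<dots> \<le> (real c * norm s) powr \<epsilon>"
      using \<epsilon> abs_Im_le_cmod[of s] by (intro powr_mono2 mult_left_mono) auto
    finally have "norm (1 / zeta (of_nat c * s)) ^ k \<le> ((real c * norm s) powr \<epsilon>) ^ k"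
      by (intro power_mono) auto
    also have "\<dots> = (real c * norm s) powr (\<epsilon> * real k)"
    proof -
      have "0 < (real c * norm s) powr \<epsilon>" using assms norm_s by auto
      from powr_realpow[OF this, of k] show ?thesis by (simp add: powr_powr)
    qed
    also have "\<dots> = real c powr \<eta> * norm s powr \<eta>"
      using \<epsilon>(2) by (simp add: powr_mult mult.commute)
    finally have B: "norm (1 / zeta (of_nat c * s)) ^ k \<le> real c powr \<eta> * norm s powr \<eta>" .
    have "norm (zeta (of_nat a * s) / zeta (of_nat c * s) ^ k)
        = norm (zeta (of_nat a * s)) * norm (1 / zeta (of_nat c * s)) ^ k"
      by (simp add: norm_mult norm_power divide_inverse power_inverse norm_inverse)
    also have "\<dots> \<le> (C1 * real a powr (1 - \<sigma>' / 4) * norm s powr (1 - \<sigma>' / 4)) * (real c powr \<eta> * norm s powr \<eta>)"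
      using C1(1) by (intro mult_mono A B) auto
    also have "\<dots> = C * (norm s powr (1 - \<sigma>' / 4) * norm s powr \<eta>)"
      by (simp add: C_def mult_ac)
    also have "norm s powr (1 - \<sigma>' / 4) * norm s powr \<eta> = norm s powr (1 - \<eta>)"
      by (simp add: \<eta>_def flip: powr_add)
    finally show ?thesis .
  qed
  thus ?thesis using \<eta> C1(1) by (intro that[of \<eta> C "max 2 T1"]) (auto simp: C_def)
qed

lemma u_coeff_riesz_mean:
  assumes RH: "riemann_hypothesis"
    and "a \<ge> 1" "k \<ge> 1" "a < c" "c < b" "b < 2 * c" "\<epsilon> > 0"
  shows "\<exists>C\<ge>0. \<forall>z\<ge>1. norm (riesz_mean (u_coeff k a c) (1 / real b) z
      - (1 / zeta (of_nat c / of_nat a) ^ k * of_real (z powr (1 / real a - 1 / real b) / (real b / real a - 1))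
         + zeta (of_nat a / of_nat b) / zeta (of_nat c / of_nat b) ^ k))
      \<le> C * z powr (1 / (2 * real c) + \<epsilon> - 1 / real b)"
proof -
  have pos: "real a > 0" "real b > 0" "real c > 0" using assms by auto
  \<comment> \<open>The second entry keeps the line of integration to the left of
    \<open>1 / b\<close> even for large \<open>\<epsilon>\<close>; it is positive because
    \<open>b < 2 * c\<close>.\<close>
  define d where "d = min \<epsilon> ((1 / real b - 1 / (2 * real c)) / 2)"
  have gap: "1 / real b - 1 / (2 * real c) > 0"
    using pos \<open>b < 2 * c\<close> by (simp add: field_simps)
  have d: "d > 0" "d \<le> \<epsilon>" "1 / (2 * real c) + d < 1 / real b"
    using gap \<open>\<epsilon> > 0\<close> by (auto simp: d_def min_def field_simps)
  define \<sigma>1 where "\<sigma>1 = 1 / (2 * real c) + d / 2"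
  define \<sigma>0 where "\<sigma>0 = 1 / (2 * real c) + d"
  define \<beta> where "\<beta> = 1 / real b"
  define p where "p = 1 / real a"
  define G where "G = (\<lambda>s. zeta (of_nat a * s) / zeta (of_nat c * s) ^ k)"
  \<comment> \<open>From \<open>zeta (a * s) = zeta_reg (a * s) / (a * (s - 1 / a))\<close>. At
    \<open>s = 1 / c\<close> both \<open>G\<close> and \<open>\<Psi>\<close> are \<open>0\<close>,
    by division by the dummy value \<open>zeta 1 = 0\<close>.\<close>
  define \<Psi> where "\<Psi> = (\<lambda>s. zeta_reg (of_nat a * s) / of_nat a * (1 / zeta (of_nat c * s)) ^ k)"
  have \<sigma>: "0 < \<sigma>1" "\<sigma>1 < \<sigma>0" "\<sigma>0 < \<beta>" "\<beta> < p" "p \<le> 1"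
  proof -
    show "\<beta> < p" unfolding \<beta>_def p_def using assms by (intro divide_strict_left_mono) auto
    show "p \<le> 1" using pos assms by (simp add: p_def)
  qed (use d pos in \<open>auto simp: \<sigma>1_def \<sigma>0_def \<beta>_def intro: add_pos_pos\<close>)
  have a\<sigma>0: "real a * \<sigma>0 \<le> 2"
  proof -
    have "real a * \<sigma>0 \<le> real a * p" using \<sigma> by (intro mult_left_mono) auto
    thus ?thesis using pos by (simp add: p_def)
  qed
  have c_half: "Re (of_nat c * s) > 1 / 2" if "Re s > \<sigma>1" for s
  proof -
    have "real c * (1 / (2 * real c)) < real c * Re s"
      using that d pos by (intro mult_strict_left_mono) (auto simp: \<sigma>1_def)
    thus ?thesis using pos by simp
  qed
  have u: "has_dser (u_coeff k a c) G"
    unfolding G_def using assms by (intro dser_u_coeff) auto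
  have \<Psi>: "\<Psi> holomorphic_on {s. Re s > \<sigma>1}"
  proof -
    have A: "(zeta_reg \<circ> (\<lambda>s. of_nat a * s)) holomorphic_on {s. Re s > \<sigma>1}"
      using pos \<sigma>(1) by (intro holomorphic_on_compose_gen[OF _ zeta_reg_holomorphic] holomorphic_intros) auto
    have B: "((\<lambda>s. 1 / zeta s) \<circ> (\<lambda>s. of_nat c * s)) holomorphic_on {s. Re s > \<sigma>1}"
      using c_half by (intro holomorphic_on_compose_gen[OF _ inverse_zeta_holomorphic[OF RH]] holomorphic_intros) auto
    show ?thesis
      using holomorphic_on_mult[OF holomorphic_on_divide[OF A holomorphic_on_const, of "of_nat a"] holomorphic_on_power[OF B, of k]] pos
      by (simp add: \<Psi>_def o_def)
  qed
  have G: "G s = \<Psi> s / (s - of_real p)" if "Re s > \<sigma>1" "s \<noteq> of_real p" for s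
  proof -
    have as: "of_nat a * s - 1 = of_nat a * (s - of_real p)"
      using pos by (simp add: p_def field_simps)
    hence "of_nat a * s \<noteq> 1" using that pos by auto
    hence "zeta_reg (of_nat a * s) = of_nat a * (s - of_real p) * zeta (of_nat a * s)"
      using zeta_reg_eq[of "of_nat a * s"] that \<sigma> pos by (simp add: as)
    thus ?thesis using that pos by (simp add: G_def \<Psi>_def power_one_over)
  qed
  have "\<sigma>0 > 1 / (2 * real c)" using d by (simp add: \<sigma>0_def)
  then obtain T0 C \<eta> where gr: "0 < \<eta>" "\<eta> \<le> 1" "C \<ge> 0"
    "\<And>s. \<sigma>0 \<le> Re s \<Longrightarrow> \<bar>Im s\<bar> \<ge> T0 \<Longrightarrow> norm (G s) \<le> C * norm s powr (1 - \<eta>)"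
    unfolding G_def using u_coeff_gen_growth[OF RH _ _ _ _ a\<sigma>0, of c k] assms by (metis le_trans less_imp_le_nat)
  obtain C' where C': "\<And>z. z \<ge> 1 \<Longrightarrow> norm (riesz_mean (u_coeff k a c) \<beta> z
      - (\<Psi> (of_real p) * of_real (z powr (p - \<beta>) * \<beta> / (p * (p - \<beta>))) + G (of_real \<beta>))) \<le> C' * z powr (\<sigma>0 - \<beta>)"
    using riesz_mean_asymp[OF u \<sigma> \<Psi> G gr(4) gr(1-3)] by blast
  have \<Psi>p: "\<Psi> (of_real p) = 1 / zeta (of_nat c / of_nat a) ^ k / of_nat a"
    using pos by (simp add: \<Psi>_def p_def zeta_reg_1 power_one_over)
  have G\<beta>: "G (of_real \<beta>) = zeta (of_nat a / of_nat b) / zeta (of_nat c / of_nat b) ^ k"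
    by (simp add: G_def \<beta>_def)
  \<comment> \<open>This brings the residue at \<open>1 / a\<close> into the shape of the integral
    term in \<open>zeta_partial_sum\<close>.\<close>
  have const: "\<beta> / (p * (p - \<beta>)) / real a = 1 / (real b / real a - 1)"
    using pos \<sigma>(4) by (simp add: \<beta>_def p_def field_simps)
  have "norm (riesz_mean (u_coeff k a c) (1 / real b) z
      - (1 / zeta (of_nat c / of_nat a) ^ k * of_real (z powr (1 / real a - 1 / real b) / (real b / real a - 1))
         + zeta (of_nat a / of_nat b) / zeta (of_nat c / of_nat b) ^ k))
      \<le> max C' 0 * z powr (1 / (2 * real c) + \<epsilon> - 1 / real b)" if z: "z \<ge> 1" for z
  proof -
    have "\<Psi> (of_real p) * of_real (z powr (p - \<beta>) * \<beta> / (p * (p - \<beta>)))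
        = 1 / zeta (of_nat c / of_nat a) ^ k * of_real (z powr (p - \<beta>) * (\<beta> / (p * (p - \<beta>)) / real a))"
      unfolding \<Psi>p by simp
    also have "\<dots> = 1 / zeta (of_nat c / of_nat a) ^ k * of_real (z powr (1 / real a - 1 / real b) / (real b / real a - 1))"
      unfolding const by (simp add: p_def \<beta>_def)
    finally have "norm (riesz_mean (u_coeff k a c) (1 / real b) z
      - (1 / zeta (of_nat c / of_nat a) ^ k * of_real (z powr (1 / real a - 1 / real b) / (real b / real a - 1))
         + zeta (of_nat a / of_nat b) / zeta (of_nat c / of_nat b) ^ k)) \<le> C' * z powr (\<sigma>0 - \<beta>)"
      using C'[OF z] unfolding G\<beta> by (simp only: \<beta>_def)
    also have "\<dots> \<le> max C' 0 * z powr (1 / (2 * real c) + \<epsilon> - 1 / real b)"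
      using z d by (intro mult_mono powr_mono) (auto simp: \<sigma>0_def \<beta>_def)
    finally show ?thesis .
  qed
  thus ?thesis by (intro exI[of _ "max C' 0"]) auto
qed

text \<open>Below the threshold of the asymptotic bound, \<open>Delta_u\<close> is at most the
  trivial \<open>B\<close>, while \<open>z powr e\<close> is at least \<open>m\<close>; the minimum
  in \<open>m\<close> covers both signs of \<open>e\<close>.\<close>

lemma Delta_u_bound:
  assumes "a \<ge> 1" "(\<lambda>x. norm (Delta_u k a c x)) \<in> O[at_top](\<lambda>x. x powr e)"
  shows "\<exists>C\<ge>0. \<forall>z\<ge>1. norm (Delta_u k a c z) \<le> C * z powr e"
proof -
  obtain C0 where "eventually (\<lambda>x. norm (norm (Delta_u k a c x)) \<le> C0 * norm (x powr e)) at_top"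
    using assms(2) by (elim landau_o.bigE)
  then obtain Z0 where Z0: "\<And>x. x \<ge> Z0 \<Longrightarrow> norm (Delta_u k a c x) \<le> C0 * x powr e"
    by (auto simp: eventually_at_top_linorder)
  define Z where "Z = max Z0 1"
  define K where "K = 1 / zeta (of_nat c / of_nat a) ^ k"
  define A where "A = norm K"
  define B where "B = (\<Sum>n | n \<ge> 1 \<and> real n \<le> Z. norm (u_coeff k a c n)) + Z powr (1 / real a) * A"
  define m where "m = min 1 (Z powr e)"
  have m: "m > 0" by (auto simp: m_def Z_def)
  have B0: "B \<ge> 0" by (auto simp: B_def A_def intro!: add_nonneg_nonneg sum_nonneg)
  have "norm (Delta_u k a c z) \<le> (max C0 0 + B / m) * z powr e" if z: "z \<ge> 1" for z
  proof (cases "z \<ge> Z0")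
    case True
    have "norm (Delta_u k a c z) \<le> C0 * z powr e" using Z0 True by blast
    also have "\<dots> \<le> (max C0 0 + B / m) * z powr e"
      using B0 m by (intro mult_right_mono) (auto intro: add_increasing2)
    finally show ?thesis .
  next
    case False
    hence zZ: "z \<le> Z" by (simp add: Z_def)
    have "Delta_u k a c z = (\<Sum>n | n \<ge> 1 \<and> real n \<le> z. u_coeff k a c n)
        - of_real (z powr (1 / real a)) * K"
      by (simp add: Delta_u_def K_def)
    also have "norm \<dots> \<le> (\<Sum>n | n \<ge> 1 \<and> real n \<le> z. norm (u_coeff k a c n)) + z powr (1 / real a) * A"
      by (rule order.trans[OF norm_triangle_ineq4]) (auto simp: norm_mult A_def intro: add_mono norm_sum)
    also have "\<dots> \<le> B"
      unfolding B_def using zZ z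
      by (intro add_mono sum_mono2 finite_nat_le_real mult_right_mono powr_mono2) (auto simp: A_def)
    finally have le_B: "norm (Delta_u k a c z) \<le> B" .
    have m_le: "m \<le> z powr e"
    proof (cases "e \<ge> 0")
      case True
      thus ?thesis using ge_one_powr_ge_zero[OF z True] by (simp add: m_def min.coboundedI1)
    next
      case False
      hence "Z powr e \<le> z powr e" using z zZ by (intro powr_mono2') auto
      thus ?thesis by (simp add: m_def)
    qed
    have "B / m * m \<le> B / m * z powr e" using m_le B0 m by (intro mult_left_mono) auto
    with le_B have "norm (Delta_u k a c z) \<le> B / m * z powr e" using m by simp
    also have "\<dots> \<le> (max C0 0 + B / m) * z powr e" by (intro mult_right_mono) auto
    finally show ?thesis .
  qed
  moreover have "max C0 0 + B / m \<ge> 0" using B0 m by auto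
  ultimately show ?thesis by blast
qed

text \<open>The three error terms come, in this order, from the Riesz mean multiplied by
  \<open>x powr (1 / b)\<close>, from \<open>psi y * Delta_u k a c z\<close> and from the
  Euler--Maclaurin remainder multiplied by \<open>x powr (1 / a)\<close>.\<close>

theorem theorem3:
  fixes a b c k :: nat and \<alpha> :: real
  assumes "riemann_hypothesis"
    and "a \<ge> 1" "b \<ge> 1" "c \<ge> 1" "k \<ge> 1"
    and "gcd a (gcd b c) = 1"
    and "a < c" "c < b" "b < 2 * c"
    and "\<alpha> < 1 / real b"
    and "\<And>\<epsilon>. \<epsilon> > 0 \<Longrightarrow> (\<lambda>x. norm (Delta_u k a c x)) \<in> O[at_top](\<lambda>x. x powr (\<alpha> + \<epsilon>))"
  shows "\<forall>\<epsilon>>0. \<exists>C. \<forall>x y :: real. x \<ge> 2 \<and> 1 \<le> y \<and> y < x powr (1 / real b) \<longrightarrow>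
    norm (Delta_f k a b c x
        - ((\<Sum>d | d \<ge> 1 \<and> real d \<le> y. Delta_u k a c (x / real d ^ b))
          - (\<Sum>m | m \<ge> 1 \<and> real m \<le> x / y ^ b.
               u_coeff k a c m * of_real (psi ((x / real m) powr (1 / real b))))))
    \<le> C * (x powr (1 / (2 * real c) + \<epsilon>) * y powr (1 - real b / (2 * real c))
          + (x * y powr (- real b)) powr (\<alpha> + \<epsilon>)
          + x powr (1 / real a) * y powr (- 1 - real b / real a))"
proof (intro allI impI)
  fix \<epsilon> :: real assume \<epsilon>: "\<epsilon> > 0"
  define s where "s = real b / real a"
  define \<beta> where "\<beta> = 1 / real b"
  define A where "A = 1 / zeta (of_nat c / of_nat a) ^ k"
  define G where "G = zeta (of_nat a / of_nat b) / zeta (of_nat c / of_nat b) ^ k"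
  define u where "u = u_coeff k a c"
  have pos: "real a > 0" "real b > 0" "real c > 0" using assms by auto
  have s: "s > 1" using assms by (simp add: s_def)
  obtain C1 where C1: "C1 \<ge> 0" "\<And>z. z \<ge> 1 \<Longrightarrow> norm (riesz_mean u \<beta> z
      - (A * of_real (z powr (1 / real a - \<beta>) / (s - 1)) + G)) \<le> C1 * z powr (1 / (2 * real c) + \<epsilon> - \<beta>)"
    using u_coeff_riesz_mean[OF assms(1) assms(2,5,7-9) \<epsilon>]
    unfolding u_def \<beta>_def A_def G_def s_def by blast
  obtain C2 where C2: "C2 \<ge> 0" "\<And>z. z \<ge> 1 \<Longrightarrow> norm (Delta_u k a c z) \<le> C2 * z powr (\<alpha> + \<epsilon>)"
    using Delta_u_bound[OF assms(2) assms(11)[OF \<epsilon>]] by blast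
  obtain C3 where C3: "\<And>y. y \<ge> 1 \<Longrightarrow> norm ((\<Sum>d | d \<ge> 1 \<and> real d \<le> y. of_real (real d powr (- s))) - zeta (of_real s)
      + of_real (y powr (1 - s) / (s - 1) + psi y * y powr (- s))) \<le> C3 * y powr (- 1 - s)"
    using zeta_partial_sum[OF s] by blast
  define C where "C = C1 + C2 + norm A * \<bar>C3\<bar>"
  show "\<exists>C. \<forall>x y :: real. x \<ge> 2 \<and> 1 \<le> y \<and> y < x powr (1 / real b) \<longrightarrow>
    norm (Delta_f k a b c x
        - ((\<Sum>d | d \<ge> 1 \<and> real d \<le> y. Delta_u k a c (x / real d ^ b))
          - (\<Sum>m | m \<ge> 1 \<and> real m \<le> x / y ^ b.
               u_coeff k a c m * of_real (psi ((x / real m) powr (1 / real b))))))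
    \<le> C * (x powr (1 / (2 * real c) + \<epsilon>) * y powr (1 - real b / (2 * real c))
          + (x * y powr (- real b)) powr (\<alpha> + \<epsilon>)
          + x powr (1 / real a) * y powr (- 1 - real b / real a))"
  proof (intro exI[of _ C] allI impI)
    fix x y :: real assume "x \<ge> 2 \<and> 1 \<le> y \<and> y < x powr (1 / real b)"
    hence x: "x \<ge> 2" and y: "1 \<le> y" "y < x powr (1 / real b)" by auto
    define z where "z = x / y ^ b"
    define U where "U = (\<lambda>t. \<Sum>n | n \<ge> 1 \<and> real n \<le> t. u n)"
    define S\<Delta> where "S\<Delta> = (\<Sum>d | d \<ge> 1 \<and> real d \<le> y. Delta_u k a c (x / real d ^ b))"
    define S\<psi> where "S\<psi> = (\<Sum>m | m \<ge> 1 \<and> real m \<le> z. u m * of_real (psi ((x / real m) powr (1 / real b))))"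
    define D where "D = (\<Sum>d | d \<ge> 1 \<and> real d \<le> y. of_real (real d powr (- s)) :: complex)"
    define V where "V = riesz_mean u \<beta> z"
    define P where "P = x powr (1 / real a)"
    define W where "W = x powr \<beta>"
    have z_eq: "z = x * y powr (- real b)"
      using y by (simp add: z_def powr_minus powr_realpow divide_inverse)
    have "y ^ b \<le> x" using power_le_iff_le_powr[of x y b] x y assms by simp
    hence z: "z \<ge> 1" using y by (simp add: z_def)
    have "z \<le> x / 1" unfolding z_def using x y by (intro divide_left_mono) auto
    hence zx: "z \<le> x" by simp
    have z_powr: "z powr e = x powr e * y powr (- real b * e)" for e
      using x y by (simp add: z_eq powr_mult powr_powr)
    have U_eq: "U t = of_real (t powr (1 / real a)) * A + Delta_u k a c t" for t
      by (simp add: U_def u_def Delta_u_def A_def)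
    have za: "z powr (1 / real a) = P * y powr (- s)"
      by (simp add: z_powr P_def s_def)
    have W_z: "W * z powr (- \<beta>) = y"
    proof -
      have "W * z powr (- \<beta>) = (x powr \<beta> * x powr (- \<beta>)) * y powr (real b * \<beta>)"
        by (simp add: z_powr W_def mult_ac)
      also have "\<dots> = y" using x y pos by (simp add: \<beta>_def flip: powr_add)
      finally show ?thesis .
    qed
    have W_Z: "W * z powr (1 / real a - \<beta>) = P * y powr (1 - s)"
    proof -
      have "W * z powr (1 / real a - \<beta>) = (W * z powr (- \<beta>)) * z powr (1 / real a)"
        using powr_add[of z "1 / real a" "- \<beta>"] by simp
      also have "\<dots> = P * (y * y powr (- s))" unfolding W_z za by simp
      also have "y * y powr (- s) = y powr (1 - s)" using y powr_add[of y 1 "- s"] by simp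
      finally show ?thesis .
    qed
    have "(\<Sum>d | d \<ge> 1 \<and> real d \<le> y. U (x / real d ^ b)) = of_real P * A * D + S\<Delta>"
    proof -
      have "U (x / real d ^ b) = of_real P * A * of_real (real d powr (- s)) + Delta_u k a c (x / real d ^ b)"
        if "d \<ge> 1" for d
      proof -
        have "(x / real d ^ b) powr (1 / real a) = P * real d powr (- s)"
        proof -
          have "(x / real d ^ b) powr (1 / real a) = P / (real d powr real b) powr (1 / real a)"
            using that x by (simp add: powr_divide P_def powr_realpow)
          thus ?thesis by (simp add: powr_powr s_def powr_minus_divide)
        qed
        thus ?thesis unfolding U_eq by simp
      qed
      thus ?thesis by (simp add: D_def S\<Delta>_def sum.distrib sum_distrib_left)
    qed
    moreover have "(\<Sum>n | n \<ge> 1 \<and> real n \<le> z. u n * of_real (of_int \<lfloor>(x / real n) powr (1 / real b)\<rfloor> - of_int \<lfloor>y\<rfloor>))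
        = of_real W * V - S\<psi> + of_real (psi y) * U z"
    proof -
      have "u n * of_real (of_int \<lfloor>(x / real n) powr (1 / real b)\<rfloor> - of_int \<lfloor>y\<rfloor>)
          = of_real W * (u n * of_real (real n powr (- \<beta>) - z powr (- \<beta>)))
            - u n * of_real (psi ((x / real n) powr (1 / real b))) + of_real (psi y) * u n" if "n \<ge> 1" for n
      proof -
        define r where "r = (x / real n) powr (1 / real b)"
        have "r = W * real n powr (- \<beta>)"
          using that x by (simp add: r_def W_def \<beta>_def powr_divide powr_minus_divide)
        hence r: "r - y = W * (real n powr (- \<beta>) - z powr (- \<beta>))"
          using W_z by (simp add: right_diff_distrib)
        \<comment> \<open>The two constants \<open>1 / 2\<close> cancel.\<close>
        have "of_int \<lfloor>r\<rfloor> - of_int \<lfloor>y\<rfloor> = (r - y) - psi r + psi y"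
          by (simp add: psi_def frac_def)
        hence "of_int \<lfloor>r\<rfloor> - of_int \<lfloor>y\<rfloor> = W * (real n powr (- \<beta>) - z powr (- \<beta>)) - psi r + psi y"
          unfolding r .
        hence "u n * of_real (of_int \<lfloor>r\<rfloor> - of_int \<lfloor>y\<rfloor>)
            = u n * of_real (W * (real n powr (- \<beta>) - z powr (- \<beta>)) - psi r + psi y)" by (simp only:)
        thus ?thesis unfolding r_def[symmetric] by (simp add: algebra_simps)
      qed
      hence "(\<Sum>n | n \<ge> 1 \<and> real n \<le> z. u n * of_real (of_int \<lfloor>(x / real n) powr (1 / real b)\<rfloor> - of_int \<lfloor>y\<rfloor>))
          = (\<Sum>n | n \<ge> 1 \<and> real n \<le> z. of_real W * (u n * of_real (real n powr (- \<beta>) - z powr (- \<beta>)))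
            - u n * of_real (psi ((x / real n) powr (1 / real b))) + of_real (psi y) * u n)"
        by (intro sum.cong refl) blast
      also have "\<dots> = of_real W * V - S\<psi> + of_real (psi y) * U z"
        unfolding sum.distrib sum_subtractf sum_distrib_left[symmetric] V_def riesz_mean_def S\<psi>_def U_def ..
      finally show ?thesis .
    qed
    moreover have "(\<Sum>n | n \<ge> 1 \<and> real n \<le> x. f_coeff k a b c n)
        = (\<Sum>d | d \<ge> 1 \<and> real d \<le> y. U (x / real d ^ b))
          + (\<Sum>n | n \<ge> 1 \<and> real n \<le> z. u n * of_real (of_int \<lfloor>(x / real n) powr (1 / real b)\<rfloor> - of_int \<lfloor>y\<rfloor>))"
    proof -
      have "(\<Sum>n | n \<ge> 1 \<and> real n \<le> x. f_coeff k a b c n)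
          = (\<Sum>n | n \<ge> 1 \<and> real n \<le> x. \<Sum>(m, j) | m \<ge> 1 \<and> j \<ge> 1 \<and> m ^ b * j = n. u j)"
        unfolding u_def using assms by (intro sum.cong refl f_coeff_eq) auto
      also have "\<dots> = (\<Sum>d | d \<ge> 1 \<and> real d \<le> y. U (x / real d ^ b))
          + (\<Sum>n | n \<ge> 1 \<and> real n \<le> z. u n * of_real (of_int \<lfloor>(x / real n) powr (1 / real b)\<rfloor> - of_int \<lfloor>y\<rfloor>))"
        unfolding U_def z_def using assms x y by (intro hyperbola_powers) auto
      finally show ?thesis .
    qed
    ultimately have sum_f: "(\<Sum>n | n \<ge> 1 \<and> real n \<le> x. f_coeff k a b c n)
        = of_real P * A * D + S\<Delta> + (of_real W * V - S\<psi>
          + of_real (psi y) * (of_real (P * y powr (- s)) * A + Delta_u k a c z))"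
      by (simp only: U_eq za)
    have "zeta (of_real s) = zeta (of_nat b / of_nat a)" by (simp add: s_def)
    hence Delta_f: "Delta_f k a b c x = (\<Sum>n | n \<ge> 1 \<and> real n \<le> x. f_coeff k a b c n)
        - zeta (of_real s) * A * of_real P - G * of_real W"
      by (simp add: Delta_f_def A_def G_def P_def W_def \<beta>_def)
    \<comment> \<open>In \<open>P * A * E1 + W * E2\<close> the terms with
      \<open>y powr (1 - s) / (s - 1)\<close> cancel, thanks to \<open>W_Z\<close>.\<close>
    define E1 where "E1 = D - zeta (of_real s) + of_real (y powr (1 - s) / (s - 1) + psi y * y powr (- s))"
    define E2 where "E2 = V - (A * of_real (z powr (1 / real a - \<beta>) / (s - 1)) + G)"
    have "of_real W * (A * of_real (z powr (1 / real a - \<beta>) / (s - 1))) = A * of_real (P * y powr (1 - s) / (s - 1))"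
      unfolding W_Z[symmetric] by simp
    hence "of_real W * E2 = of_real W * V - A * of_real P * of_real (y powr (1 - s) / (s - 1)) - of_real W * G"
      unfolding E2_def by (simp add: right_diff_distrib distrib_left)
    moreover have "of_real P * A * E1 = of_real P * A * D - of_real P * A * zeta (of_real s)
        + A * of_real P * of_real (y powr (1 - s) / (s - 1)) + of_real P * A * of_real (psi y) * of_real (y powr (- s))"
      unfolding E1_def by (simp add: algebra_simps)
    ultimately have error: "Delta_f k a b c x - (S\<Delta> - S\<psi>)
        = of_real P * A * E1 + of_real W * E2 + of_real (psi y) * Delta_u k a c z"
      unfolding Delta_f sum_f by (simp add: algebra_simps)
    define T1 where "T1 = x powr (1 / (2 * real c) + \<epsilon>) * y powr (1 - real b / (2 * real c))"
    define T2 where "T2 = z powr (\<alpha> + \<epsilon>)"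
    define T3 where "T3 = P * y powr (- 1 - s)"
    have T: "T1 \<ge> 0" "T2 \<ge> 0" "T3 \<ge> 0" by (auto simp: T1_def T2_def T3_def P_def)
    have "norm (of_real P * A * E1) \<le> norm A * \<bar>C3\<bar> * T3"
    proof -
      have "norm E1 \<le> C3 * y powr (- 1 - s)" unfolding E1_def D_def using y by (intro C3)
      also have "\<dots> \<le> \<bar>C3\<bar> * y powr (- 1 - s)" by (intro mult_right_mono) auto
      finally have "P * norm A * norm E1 \<le> P * norm A * (\<bar>C3\<bar> * y powr (- 1 - s))"
        by (intro mult_left_mono) (auto simp: P_def)
      thus ?thesis by (simp add: norm_mult T3_def P_def mult_ac)
    qed
    moreover have "norm (of_real W * E2) \<le> C1 * T1"
    proof -
      have "W * norm E2 \<le> W * (C1 * z powr (1 / (2 * real c) + \<epsilon> - \<beta>))"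
        unfolding E2_def V_def using z by (intro mult_left_mono C1) (auto simp: W_def)
      also have "\<dots> = C1 * ((W * z powr (- \<beta>)) * (z powr (1 / (2 * real c)) * z powr \<epsilon>))"
      proof -
        have "1 / (2 * real c) + \<epsilon> - \<beta> = - \<beta> + (1 / (2 * real c) + \<epsilon>)" by simp
        thus ?thesis by (simp only: powr_add mult_ac)
      qed
      \<comment> \<open>Only \<open>z powr \<epsilon>\<close> is enlarged, using
        \<open>z \<le> x\<close>; the remaining power of \<open>z\<close> is expanded exactly and
        gives the exponent of \<open>y\<close>.\<close>
      also have "\<dots> \<le> C1 * (y * (z powr (1 / (2 * real c)) * x powr \<epsilon>))"
        unfolding W_z using C1 x y z zx \<epsilon> by (intro mult_left_mono powr_mono2) auto
      also have "y * (z powr (1 / (2 * real c)) * x powr \<epsilon>)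
          = (x powr (1 / (2 * real c)) * x powr \<epsilon>) * (y powr 1 * y powr (- real b / (2 * real c)))"
        using y by (simp add: z_powr mult_ac)
      also have "\<dots> = T1" by (simp only: T1_def powr_add[symmetric]) simp
      finally show ?thesis by (simp add: norm_mult W_def)
    qed
    moreover have "norm (of_real (psi y) * Delta_u k a c z) \<le> C2 * T2"
    proof -
      have "\<bar>psi y\<bar> \<le> 1" using frac_ge_0[of y] frac_lt_1[of y] unfolding psi_def by linarith
      hence "\<bar>psi y\<bar> * norm (Delta_u k a c z) \<le> 1 * (C2 * z powr (\<alpha> + \<epsilon>))"
        using z by (intro mult_mono C2) auto
      thus ?thesis by (simp add: norm_mult T2_def)
    qed
    ultimately have "norm (Delta_f k a b c x - (S\<Delta> - S\<psi>)) \<le> norm A * \<bar>C3\<bar> * T3 + C1 * T1 + C2 * T2"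
      unfolding error by (intro norm_triangle_mono)
    also have "\<dots> \<le> C * (T1 + T2 + T3)"
    proof -
      have "norm A * \<bar>C3\<bar> \<ge> 0" by simp
      hence "norm A * \<bar>C3\<bar> \<le> C" "C1 \<le> C" "C2 \<le> C"
        unfolding C_def using C1(1) C2(1) by linarith+
      hence "norm A * \<bar>C3\<bar> * T3 \<le> C * T3" "C1 * T1 \<le> C * T1" "C2 * T2 \<le> C * T2"
        using T by (intro mult_right_mono; simp)+
      thus ?thesis by (simp add: distrib_left)
    qed
    finally show "norm (Delta_f k a b c x
        - ((\<Sum>d | d \<ge> 1 \<and> real d \<le> y. Delta_u k a c (x / real d ^ b))
          - (\<Sum>m | m \<ge> 1 \<and> real m \<le> x / y ^ b.
               u_coeff k a c m * of_real (psi ((x / real m) powr (1 / real b))))))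
    \<le> C * (x powr (1 / (2 * real c) + \<epsilon>) * y powr (1 - real b / (2 * real c))
          + (x * y powr (- real b)) powr (\<alpha> + \<epsilon>)
          + x powr (1 / real a) * y powr (- 1 - real b / real a))"
      unfolding T1_def T2_def T3_def S\<Delta>_def S\<psi>_def u_def z_def[symmetric] z_eq[symmetric] P_def s_def .
  qed
qed

end
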